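(* Let $H$ be a Hopf algebra over a field $\Bbbk$ and let $(E,m,u,\Delta,\varepsilon,\omega)$ be a coquasi-bialgebra in ${}_H^H\mathcal{YD}$. Let $\gamma:E\otimes E\to\Bbbk$ be a gauge transformation in ${}_H^H\mathcal{YD}$. Set $$\Gamma:(E\#H)\otimes(E\#H)\to\Bbbk,\qquad (x\#h)\otimes(x'\#h')\mapsto\gamma(x\otimes hx')\,\varepsilon_H(h').$$ Then $\Gamma$ is a gauge transformation (for the ordinary coquasi-bialgebra $E\#H$) and $(E\#H)^\Gamma=E^\gamma\#H$ as ordinary coquasi-bialgebras.
   Context: ${}_H^H\mathcal{YD}$ is the category of left-left Yetter-Drinfeld modules over $H$: left $H$-modules and left $H$-comodules $V$ (coaction $v\mapsto v_{-1}\otimes v_0$) with $(h_1v)_{-1}h_2\otimes(h_1v)_0=h_1v_{-1}\otimes h_2v_0$. It is monoidal (diagonal action, codiagonal coaction, unit $\Bbbk$ with trivial structures) and pre-braided by $c_{V,W}(v\otimes w)=v_{-1}w\otimes v_0$. Tensor products of coalgebras in ${}_H^H\mathcal{YD}$ have comultiplication $(C\otimes c_{C,D}\otimes D)(\Delta_C\otimes\Delta_D)$, and $*$ denotes convolution with respect to such comultiplications. A coquasi-bialgebra $(Q,m,u,\Delta,\varepsilon,\omega)$ in ${}_H^H\mathcal{YD}$ is a coalgebra $(Q,\Delta,\varepsilon)$ in ${}_H^H\mathcal{YD}$ with coalgebra morphisms $m:Q\otimes Q\to Q$, $u:\Bbbk\to Q$ in ${}_H^H\mathcal{YD}$ and a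 convolution invertible $\omega\in{}_H^H\mathcal{YD}(Q^{\otimes3},\Bbbk)$ such that $\omega(Q\otimes Q\otimes m)*\omega(m\otimes Q\otimes Q)=(\varepsilon\otimes\omega)*\omega(Q\otimes m\otimes Q)*(\omega\otimes\varepsilon)$; $\omega(Q\otimes u\otimes Q)=\omega(u\otimes Q\otimes Q)=\omega(Q\otimes Q\otimes u)=\varepsilon_{Q\otimes Q}$; $m(Q\otimes m)*\omega=\omega*m(m\otimes Q)$; $m(u\otimes Q)=\mathrm{Id}_Q=m(Q\otimes u)$. An ordinary coquasi-bialgebra is the same notion in the category of vector spaces (with the flip). A gauge transformation for $Q$ in ${}_H^H\mathcal{YD}$ is a morphism $\gamma:Q\otimes Q\to\Bbbk$ in ${}_H^H\mathcal{YD}$ that is convolution invertible in ${}_H^H\mathcal{YD}$ and unitary on both entries: $\gamma(1_Q\otimes x)=\varepsilon(x)=\gamma(x\otimes1_Q)$. Then $Q^\gamma=(Q,m^\gamma,u,\Delta,\varepsilon,\omega^\gamma)$ with $m^\gamma=\gamma*m*\gamma^{-1}$, $\omega^\gamma=(\varepsilon\otimes\gamma)*\gamma(Q\otimes m)*\omega*\gamma^{-1}(m\otimes Q)*(\gamma^{-1}\otimes\varepsilon)$ is a coquasi-bialgebra in ${}_H^H\mathcal{YD}$. The same definitions apply to ordinary coquasi-bialgebras. The bosonization $E\#H$ of a coquasi-bialgebra $E$ in ${}_H^H\mathcal{YD}$ is the ordinary coquasi-bialgebra with underlying space $E\otimes H$, multiplication $(x\#h)(x'\#h')=m(x\otimes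 h_1x')\#h_2h'$, unit $1_E\#1_H$, comultiplication $\Delta(x\#h)=\sum(x^{(1)}\#(x^{(2)})_{-1}h_1)\otimes((x^{(2)})_0\#h_2)$ (where $\Delta(x)=\sum x^{(1)}\otimes x^{(2)}$), counit $\varepsilon\otimes\varepsilon_H$ and reassociator $\omega_{E\#H}\big((r\#h)\otimes(s\#l)\otimes(t\#k)\big)=\omega(r\otimes h_1s\otimes h_2lt)\,\varepsilon_H(k)$. *)

theory Defs
  imports Complex_Main
begin

section \<open>Vector spaces and tensor products\<close>

text \<open>A vector space is a linear subspace (the carrier) of an ambient vector space living on a type.
  Taking the carrier to be \<open>UNIV\<close> gives an arbitrary vector space on a type; carriers are needed
  because tensor products are subspaces of the types below.  Maps between vector spaces are total
  functions of which only the values on carriers matter.\<close>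

record ('k, 'v) vs =
  carr :: "'v set"
  scl :: "'k \<Rightarrow> 'v \<Rightarrow> 'v"

definition is_vs :: "('k::field, 'v::ab_group_add, 'a) vs_scheme \<Rightarrow> bool" where
  "is_vs V \<longleftrightarrow> vector_space (scl V) \<and> module.subspace (scl V) (carr V)"

definition kvs :: "('k::field, 'k) vs" where
  "kvs = \<lparr>carr = UNIV, scl = (*)\<rparr>"

definition lin ::
  "('k::field, 'v::ab_group_add, 'a) vs_scheme \<Rightarrow> ('k, 'w::ab_group_add, 'b) vs_scheme \<Rightarrow> ('v \<Rightarrow> 'w) \<Rightarrow> bool"
  where
  "lin V W f \<longleftrightarrow>
     (\<forall>v\<in>carr V. f v \<in> carr W) \<and>
     (\<forall>u\<in>carr V. \<forall>v\<in>carr V. f (u + v) = f u + f v) \<and>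
     (\<forall>a. \<forall>v\<in>carr V. f (scl V a v) = scl W a (f v))"

definition bilin ::
  "('k::field, 'v::ab_group_add, 'a) vs_scheme \<Rightarrow> ('k, 'w::ab_group_add, 'b) vs_scheme \<Rightarrow>
   ('k, 'x::ab_group_add, 'c) vs_scheme \<Rightarrow> ('v \<Rightarrow> 'w \<Rightarrow> 'x) \<Rightarrow> bool"
  where
  "bilin V W X b \<longleftrightarrow>
     (\<forall>v\<in>carr V. lin W X (b v)) \<and> (\<forall>w\<in>carr W. lin V X (\<lambda>v. b v w))"

text \<open>Over a field, \<open>V \<otimes> W\<close> embeds into the dual of the space of bilinear forms on \<open>V \<times> W\<close>, sending
  \<open>v \<otimes> w\<close> to evaluation at \<open>(v, w)\<close>; we take the span of these evaluations as the tensor product.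
  The universal property is proved as \<open>tensor_universal\<close> below.\<close>

typedef ('k, 'v, 'w) tensor = "UNIV :: (('v \<Rightarrow> 'w \<Rightarrow> 'k) \<Rightarrow> 'k) set"
  morphisms teval Tensor
  by simp

lemma teval_Tensor [simp]: "teval (Tensor f) = f"
  by (simp add: Tensor_inverse)

lemma tensor_eqI: "(\<And>\<phi>. teval s \<phi> = teval t \<phi>) \<Longrightarrow> s = t"
  by (metis ext teval_inject)

instantiation tensor :: (ab_group_add, type, type) ab_group_add
begin

definition "0 = Tensor (\<lambda>\<phi>. 0)"
definition "s + t = Tensor (\<lambda>\<phi>. teval s \<phi> + teval t \<phi>)"
definition "s - t = Tensor (\<lambda>\<phi>. teval s \<phi> - teval t \<phi>)"
definition "- t = Tensor (\<lambda>\<phi>. - teval t \<phi>)"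

instance
  by standard
    (simp_all add: zero_tensor_def plus_tensor_def minus_tensor_def uminus_tensor_def
       ac_simps teval_inverse)

end

lemma teval_simps [simp]:
  "teval 0 \<phi> = 0" "teval (s + t) \<phi> = teval s \<phi> + teval t \<phi>"
  "teval (s - t) \<phi> = teval s \<phi> - teval t \<phi>" "teval (- t) \<phi> = - teval t \<phi>"
  by (simp_all add: zero_tensor_def plus_tensor_def minus_tensor_def uminus_tensor_def)

definition tscl :: "'k::field \<Rightarrow> ('k, 'v, 'w) tensor \<Rightarrow> ('k, 'v, 'w) tensor" where
  "tscl a t = Tensor (\<lambda>\<phi>. a * teval t \<phi>)"

definition pure ::
  "('k::field, 'v::ab_group_add, 'a) vs_scheme \<Rightarrow> ('k, 'w::ab_group_add, 'b) vs_scheme \<Rightarrow>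
   'v \<Rightarrow> 'w \<Rightarrow> ('k, 'v, 'w) tensor"
  where
  "pure V W v w = Tensor (\<lambda>\<phi>. if bilin V W kvs \<phi> then \<phi> v w else 0)"

definition tens ::
  "('k::field, 'v::ab_group_add, 'a) vs_scheme \<Rightarrow> ('k, 'w::ab_group_add, 'b) vs_scheme \<Rightarrow>
   ('k, ('k, 'v, 'w) tensor) vs"  (infixr \<open>\<otimes>\<close> 70)
  where
  "V \<otimes> W = \<lparr>carr = module.span tscl {pure V W v w | v w. v \<in> carr V \<and> w \<in> carr W}, scl = tscl\<rparr>"

text \<open>\<open>trep V W t\<close> chooses a presentation of \<open>t\<close> as a finite sum of pure tensors, and \<open>tlift V W b\<close>
  is the linear map on \<open>V \<otimes> W\<close> induced by a bilinear map \<open>b\<close>.  It serves to write Sweedler sums: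
  \<open>tlift C C (\<lambda>x1 x2. b x1 x2) (\<Delta> x)\<close> is the sum of \<open>b x1 x2\<close> over \<open>\<Delta> x = \<Sum> x1 \<otimes> x2\<close>.\<close>

definition trep ::
  "('k::field, 'v::ab_group_add, 'a) vs_scheme \<Rightarrow> ('k, 'w::ab_group_add, 'b) vs_scheme \<Rightarrow>
   ('k, 'v, 'w) tensor \<Rightarrow> ('v \<times> 'w) list"
  where
  "trep V W t =
     (SOME ps. set ps \<subseteq> carr V \<times> carr W \<and> t = (\<Sum>(v, w)\<leftarrow>ps. pure V W v w))"

definition tlift ::
  "('k::field, 'v::ab_group_add, 'a) vs_scheme \<Rightarrow> ('k, 'w::ab_group_add, 'b) vs_scheme \<Rightarrow>
   ('v \<Rightarrow> 'w \<Rightarrow> 'x::comm_monoid_add) \<Rightarrow> ('k, 'v, 'w) tensor \<Rightarrow> 'x"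
  where
  "tlift V W b t = (\<Sum>(v, w)\<leftarrow>trep V W t. b v w)"

lemma vector_space_field: "vector_space ((*) :: 'k::field \<Rightarrow> 'k \<Rightarrow> 'k)"
  by unfold_locales (simp_all add: algebra_simps)

lemma vector_space_tscl: "vector_space (tscl :: 'k::field \<Rightarrow> ('k, 'v, 'w) tensor \<Rightarrow> _)"
  by unfold_locales (auto intro!: tensor_eqI simp: tscl_def algebra_simps)

lemma is_vs_kvs: "is_vs (kvs :: ('k::field, 'k) vs)"
proof -
  interpret vector_space "(*) :: 'k \<Rightarrow> 'k \<Rightarrow> 'k" by (rule vector_space_field)
  show ?thesis by (simp add: is_vs_def kvs_def vector_space_field)
qed

lemma is_vs_closed:
  assumes "is_vs V"
  shows "0 \<in> carr V" "u \<in> carr V \<Longrightarrow> v \<in> carr V \<Longrightarrow> u + v \<in> carr V"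
    "v \<in> carr V \<Longrightarrow> scl V a v \<in> carr V"
proof -
  interpret vector_space "scl V" using assms by (simp add: is_vs_def)
  show "0 \<in> carr V" "u \<in> carr V \<Longrightarrow> v \<in> carr V \<Longrightarrow> u + v \<in> carr V"
    "v \<in> carr V \<Longrightarrow> scl V a v \<in> carr V"
    using assms by (auto simp: is_vs_def subspace_def)
qed

lemma is_vs_tens:
  fixes V :: "('k::field, 'v::ab_group_add, 'a) vs_scheme" and W :: "('k, 'w::ab_group_add, 'b) vs_scheme"
  shows "is_vs (V \<otimes> W)"
proof -
  interpret vector_space "tscl :: 'k \<Rightarrow> ('k, 'v, 'w) tensor \<Rightarrow> _"
    by (rule vector_space_tscl)
  show ?thesis by (simp add: is_vs_def tens_def vector_space_tscl)
qed

lemma pure_in_tens: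
  fixes V :: "('k::field, 'v::ab_group_add, 'a) vs_scheme" and W :: "('k, 'w::ab_group_add, 'b) vs_scheme"
  assumes "v \<in> carr V" "w \<in> carr W"
  shows "pure V W v w \<in> carr (V \<otimes> W)"
proof -
  interpret vector_space "tscl :: 'k \<Rightarrow> ('k, 'v, 'w) tensor \<Rightarrow> _"
    by (rule vector_space_tscl)
  show ?thesis using assms by (auto simp: tens_def intro!: span_base)
qed

lemma bilin_pure: "bilin V W (V \<otimes> W) (pure V W)"
  by (auto simp: bilin_def[of V W "V \<otimes> W"] lin_def pure_in_tens)
     (auto intro!: tensor_eqI simp: pure_def tens_def tscl_def bilin_def lin_def kvs_def)

lemma tens_rep_ex:
  fixes V :: "('k::field, 'v::ab_group_add, 'a) vs_scheme" and W :: "('k, 'w::ab_group_add, 'b) vs_scheme"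
  assumes "is_vs V" "is_vs W" "t \<in> carr (V \<otimes> W)"
  shows "\<exists>ps. set ps \<subseteq> carr V \<times> carr W \<and> t = (\<Sum>(v, w)\<leftarrow>ps. pure V W v w)"
proof -
  interpret vector_space "tscl :: 'k \<Rightarrow> ('k, 'v, 'w) tensor \<Rightarrow> _"
    by (rule vector_space_tscl)
  have "t \<in> span {pure V W v w | v w. v \<in> carr V \<and> w \<in> carr W}"
    using assms(3) by (simp add: tens_def)
  then show ?thesis
  proof (induction rule: span_induct_alt)
    case base
    show ?case by (rule exI[of _ "[]"]) simp
  next
    case (step c x y)
    then obtain v w ps where vw: "v \<in> carr V" "w \<in> carr W" "x = pure V W v w"
      and ps: "set ps \<subseteq> carr V \<times> carr W" "y = (\<Sum>(v, w)\<leftarrow>ps. pure V W v w)"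
      by auto
    have "tscl c x = pure V W (scl V c v) w"
      using bilin_pure[of V W] vw by (auto simp: bilin_def lin_def tens_def)
    then show ?case
      using vw ps is_vs_closed(3)[OF assms(1) vw(1)]
      by (intro exI[of _ "(scl V c v, w) # ps"]) auto
  qed
qed

lemma trep_props:
  assumes "is_vs V" "is_vs W" "t \<in> carr (V \<otimes> W)"
  shows "set (trep V W t) \<subseteq> carr V \<times> carr W"
    "(\<Sum>(v, w)\<leftarrow>trep V W t. pure V W v w) = t"
  using someI_ex[OF tens_rep_ex[OF assms]] by (auto simp: trep_def)

lemma separating_form:
  fixes s :: "'k::field \<Rightarrow> 'x::ab_group_add \<Rightarrow> 'x"
  assumes "vector_space s" "x \<noteq> 0"
  shows "\<exists>\<xi>. Vector_Spaces.linear s (*) \<xi> \<and> \<xi> x = 1"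
proof -
  interpret vector_space_pair s "(*) :: 'k \<Rightarrow> 'k \<Rightarrow> 'k"
    using assms(1) vector_space_field by (simp add: vector_space_pair_def)
  have "vs1.independent {x}" using assms(2) by simp
  from linear_independent_extend[OF this, of "\<lambda>_. 1"] show ?thesis by auto
qed

lemma teval_sum_list: "teval (\<Sum>p\<leftarrow>ps. f p) \<phi> = (\<Sum>p\<leftarrow>ps. teval (f p) \<phi>)"
  by (induction ps) auto

lemma tens_sum_eq:
  assumes X: "is_vs X" and b: "bilin V W X b"
    and ps: "set ps \<subseteq> carr V \<times> carr W" and qs: "set qs \<subseteq> carr V \<times> carr W"
    and eq: "(\<Sum>(v, w)\<leftarrow>ps. pure V W v w) = (\<Sum>(v, w)\<leftarrow>qs. pure V W v w)"
  shows "(\<Sum>(v, w)\<leftarrow>ps. b v w) = (\<Sum>(v, w)\<leftarrow>qs. b v w)"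
proof (rule ccontr)
  let ?d = "(\<Sum>(v, w)\<leftarrow>ps. b v w) - (\<Sum>(v, w)\<leftarrow>qs. b v w)"
  assume "\<not> ?thesis"
  then have "?d \<noteq> 0" by simp
  then obtain \<xi> where \<xi>: "Vector_Spaces.linear (scl X) (*) \<xi>" "\<xi> ?d = 1"
    using separating_form X unfolding is_vs_def by blast
  interpret \<xi>: Vector_Spaces.linear "scl X" "(*)" \<xi> by (rule \<xi>(1))
  let ?\<phi> = "\<lambda>v w. \<xi> (b v w)"
  have bil: "bilin V W kvs ?\<phi>"
    using b by (auto simp: bilin_def lin_def kvs_def \<xi>.add \<xi>.scale)
  have ev: "teval (\<Sum>(v, w)\<leftarrow>rs. pure V W v w) ?\<phi> = \<xi> (\<Sum>(v, w)\<leftarrow>rs. b v w)" for rs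
    by (induction rs) (auto simp: \<xi>.add \<xi>.zero pure_def bil)
  have "\<xi> ?d = 0"
    using ev[of ps] ev[of qs] eq by (simp add: \<xi>.diff)
  with \<xi>(2) show False by simp
qed

lemma tlift_eq:
  assumes "is_vs V" "is_vs W" "is_vs X" "bilin V W X b"
    and "set ps \<subseteq> carr V \<times> carr W"
  shows "tlift V W b (\<Sum>(v, w)\<leftarrow>ps. pure V W v w) = (\<Sum>(v, w)\<leftarrow>ps. b v w)"
proof -
  let ?t = "\<Sum>(v, w)\<leftarrow>ps. pure V W v w"
  have "?t \<in> carr (V \<otimes> W)"
    using assms(5) by (induction ps) (auto intro: is_vs_closed[OF is_vs_tens] pure_in_tens)
  note t = trep_props[OF assms(1,2) this]
  show ?thesis
    unfolding tlift_def by (rule tens_sum_eq[OF assms(3,4) t(1) assms(5) t(2)])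
qed

theorem tlift_pure:
  assumes "is_vs V" "is_vs W" "is_vs X" "bilin V W X b" "v \<in> carr V" "w \<in> carr W"
  shows "tlift V W b (pure V W v w) = b v w"
  using tlift_eq[OF assms(1-4), of "[(v, w)]"] assms(5,6) by simp

theorem lin_tlift:
  fixes V :: "('k::field, 'v::ab_group_add, 'a) vs_scheme" and W :: "('k, 'w::ab_group_add, 'b) vs_scheme"
  assumes V: "is_vs V" and W: "is_vs W" and X: "is_vs X" and b: "bilin V W X b"
  shows "lin (V \<otimes> W) X (tlift V W b)"
  unfolding lin_def
proof (intro conjI ballI allI)
  interpret X: vector_space "scl X" using X by (simp add: is_vs_def)
  interpret T: vector_space "tscl :: 'k \<Rightarrow> ('k, 'v, 'w) tensor \<Rightarrow> _"
    by (rule vector_space_tscl)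
  fix t assume "t \<in> carr (V \<otimes> W)"
  note t = trep_props[OF V W this]
  have "(\<Sum>(v, w)\<leftarrow>ps. b v w) \<in> carr X" if "set ps \<subseteq> carr V \<times> carr W" for ps
    using that b by (induction ps) (auto intro!: is_vs_closed[OF X] simp: bilin_def lin_def)
  with t(1) show "tlift V W b t \<in> carr X" by (simp add: tlift_def)
  {
    fix u assume "u \<in> carr (V \<otimes> W)"
    note u = trep_props[OF V W this]
    show "tlift V W b (t + u) = tlift V W b t + tlift V W b u"
      using tlift_eq[OF V W X b, of "trep V W t @ trep V W u"] t u by (simp add: tlift_def)
  next
    fix a
    let ?m = "\<lambda>(v, w). (scl V a v, w)"
    have ms: "set (map ?m ps) \<subseteq> carr V \<times> carr W"
      and m1: "(\<Sum>(v, w)\<leftarrow>map ?m ps. pure V W v w) = tscl a (\<Sum>(v, w)\<leftarrow>ps. pure V W v w)"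
      and m2: "(\<Sum>(v, w)\<leftarrow>map ?m ps. b v w) = scl X a (\<Sum>(v, w)\<leftarrow>ps. b v w)"
      if "set ps \<subseteq> carr V \<times> carr W" for ps
    proof -
      show "set (map ?m ps) \<subseteq> carr V \<times> carr W"
        using that by (auto intro: is_vs_closed(3)[OF V])
      show "(\<Sum>(v, w)\<leftarrow>map ?m ps. pure V W v w) = tscl a (\<Sum>(v, w)\<leftarrow>ps. pure V W v w)"
        using that bilin_pure[of V W]
        by (induction ps) (auto simp: T.scale_right_distrib bilin_def lin_def tens_def)
      show "(\<Sum>(v, w)\<leftarrow>map ?m ps. b v w) = scl X a (\<Sum>(v, w)\<leftarrow>ps. b v w)"
        using that b by (induction ps) (auto simp: X.scale_right_distrib bilin_def lin_def)
    qed
    show "tlift V W b (scl (V \<otimes> W) a t) = scl X a (tlift V W b t)"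
      using tlift_eq[OF V W X b ms[OF t(1)]] m1[OF t(1)] m2[OF t(1)] t(2)
      by (simp add: tlift_def tens_def)
  }
qed

lemma lin_sum_list:
  assumes "is_vs V" "is_vs X" "lin V X f" "set ps \<subseteq> carr V"
  shows "f (sum_list ps) = (\<Sum>p\<leftarrow>ps. f p)"
proof -
  interpret V: vector_space "scl V" using assms(1) by (simp add: is_vs_def)
  interpret X: vector_space "scl X" using assms(2) by (simp add: is_vs_def)
  have f0: "f 0 = 0"
    using assms(3) is_vs_closed(1)[OF assms(1)] V.scale_zero_left X.scale_zero_left
    unfolding lin_def by metis
  have "sum_list ps \<in> carr V \<and> f (sum_list ps) = (\<Sum>p\<leftarrow>ps. f p)"
    using assms(4,3) by (induction ps) (auto simp: f0 lin_def intro: is_vs_closed[OF assms(1)])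
  then show ?thesis ..
qed

theorem tens_ext:
  assumes V: "is_vs V" and W: "is_vs W" and X: "is_vs X"
    and f: "lin (V \<otimes> W) X f" and g: "lin (V \<otimes> W) X g"
    and eq: "\<And>v w. v \<in> carr V \<Longrightarrow> w \<in> carr W \<Longrightarrow> f (pure V W v w) = g (pure V W v w)"
    and t: "t \<in> carr (V \<otimes> W)"
  shows "f t = g t"
proof -
  let ?ps = "map (\<lambda>(v, w). pure V W v w) (trep V W t)"
  note tr = trep_props[OF V W t]
  have s: "set ?ps \<subseteq> carr (V \<otimes> W)" using tr(1) by (auto intro: pure_in_tens)
  have m: "map f ?ps = map g ?ps" using tr(1) eq by auto
  have "f (sum_list ?ps) = g (sum_list ?ps)"
    using lin_sum_list[OF is_vs_tens X f s] lin_sum_list[OF is_vs_tens X g s] m by metis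
  then show ?thesis using tr(2) by simp
qed

theorem tensor_universal:
  assumes "is_vs V" "is_vs W" "is_vs X" "bilin V W X b"
  shows "\<exists>f. lin (V \<otimes> W) X f \<and> (\<forall>v\<in>carr V. \<forall>w\<in>carr W. f (pure V W v w) = b v w) \<and>
    (\<forall>g. lin (V \<otimes> W) X g \<longrightarrow> (\<forall>v\<in>carr V. \<forall>w\<in>carr W. g (pure V W v w) = b v w) \<longrightarrow>
      (\<forall>t\<in>carr (V \<otimes> W). g t = f t))"
  using lin_tlift[OF assms] tlift_pure[OF assms] tens_ext[OF assms(1-3)]
  by (intro exI[of _ "tlift V W b"]) (smt (verit, best))

definition tmap ::
  "('k::field, 'v::ab_group_add, 'a) vs_scheme \<Rightarrow> ('k, 'w::ab_group_add, 'b) vs_scheme \<Rightarrow>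
   ('k, 'x::ab_group_add, 'c) vs_scheme \<Rightarrow> ('k, 'y::ab_group_add, 'd) vs_scheme \<Rightarrow>
   ('v \<Rightarrow> 'x) \<Rightarrow> ('w \<Rightarrow> 'y) \<Rightarrow> ('k, 'v, 'w) tensor \<Rightarrow> ('k, 'x, 'y) tensor"
  where
  "tmap V W X Y f g = tlift V W (\<lambda>v w. pure X Y (f v) (g w))"

definition flip ::
  "('k::field, 'v::ab_group_add, 'a) vs_scheme \<Rightarrow> ('k, 'w::ab_group_add, 'b) vs_scheme \<Rightarrow>
   ('k, 'v, 'w) tensor \<Rightarrow> ('k, 'w, 'v) tensor"
  where
  "flip V W = tlift V W (\<lambda>v w. pure W V w v)"

text \<open>Iterated tensor powers are bracketed to the right: \<open>V \<otimes> V \<otimes> V = V \<otimes> (V \<otimes> V)\<close>.\<close>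

definition pure3 where
  "pure3 V x y z = pure V (V \<otimes> V) x (pure V V y z)"

definition tlift3 where
  "tlift3 V b = tlift V (V \<otimes> V) (\<lambda>x. tlift V V (\<lambda>y z. b x y z))"

definition tlift4 where
  "tlift4 V b = tlift V (V \<otimes> V \<otimes> V) (\<lambda>x. tlift3 V (\<lambda>y z w. b x y z w))"


section \<open>Coalgebras, convolution and Hopf algebras\<close>

record ('k, 'v) coalg = "('k, 'v) vs" +
  comult :: "'v \<Rightarrow> ('k, 'v, 'v) tensor"
  counit :: "'v \<Rightarrow> 'k"

record ('k, 'v) bialg = "('k, 'v) coalg" +
  mult :: "('k, 'v, 'v) tensor \<Rightarrow> 'v"
  unity :: 'v

definition prd :: "('k::field, 'v::ab_group_add, 'a) bialg_scheme \<Rightarrow> 'v \<Rightarrow> 'v \<Rightarrow> 'v" where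
  "prd A x y = mult A (pure A A x y)"

definition is_coalgebra :: "('k::field, 'v::ab_group_add, 'a) coalg_scheme \<Rightarrow> bool" where
  "is_coalgebra C \<longleftrightarrow> is_vs C \<and> lin C (C \<otimes> C) (comult C) \<and> lin C kvs (counit C) \<and>
     (\<forall>x\<in>carr C.
        tlift C C (\<lambda>x1 x2. tlift C C (\<lambda>x11 x12. pure3 C x11 x12 x2) (comult C x1)) (comult C x) =
        tlift C C (\<lambda>x1 x2. tlift C C (\<lambda>x21 x22. pure3 C x1 x21 x22) (comult C x2)) (comult C x)) \<and>
     (\<forall>x\<in>carr C. tlift C C (\<lambda>x1 x2. scl C (counit C x1) x2) (comult C x) = x) \<and>
     (\<forall>x\<in>carr C. tlift C C (\<lambda>x1 x2. scl C (counit C x2) x1) (comult C x) = x)"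

definition coalg_morphism ::
  "('k::field, 'v::ab_group_add, 'a) coalg_scheme \<Rightarrow> ('k, 'w::ab_group_add, 'b) coalg_scheme \<Rightarrow>
   ('v \<Rightarrow> 'w) \<Rightarrow> bool"
  where
  "coalg_morphism C D f \<longleftrightarrow> lin C D f \<and>
     (\<forall>x\<in>carr C. comult D (f x) = tmap C C D D f f (comult C x) \<and> counit D (f x) = counit C x)"

definition kcoalg :: "('k::field, 'k) coalg" where
  "kcoalg = \<lparr>carr = UNIV, scl = (*), comult = (\<lambda>a. pure kvs kvs a 1), counit = (\<lambda>a. a)\<rparr>"

text \<open>\<open>C \<otimes> D\<close> with comultiplication \<open>(C \<otimes> c \<otimes> D) (\<Delta>\<^sub>C \<otimes> \<Delta>\<^sub>D)\<close>, for a given \<open>c : C \<otimes> D \<rightarrow> D \<otimes> C\<close>.\<close>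

definition cotens ::
  "(('k, 'v, 'w) tensor \<Rightarrow> ('k, 'w, 'v) tensor) \<Rightarrow>
   ('k::field, 'v::ab_group_add, 'a) coalg_scheme \<Rightarrow> ('k, 'w::ab_group_add, 'b) coalg_scheme \<Rightarrow>
   ('k, ('k, 'v, 'w) tensor) coalg"
  where
  "cotens c C D = \<lparr>carr = carr (C \<otimes> D), scl = scl (C \<otimes> D),
     comult = tlift C D (\<lambda>x y.
       tlift C C (\<lambda>x1 x2. tlift D D (\<lambda>y1 y2.
         tlift D C (\<lambda>y1' x2'. pure (C \<otimes> D) (C \<otimes> D) (pure C D x1 y1') (pure C D x2' y2))
           (c (pure C D x2 y1)))
         (comult D y)) (comult C x)),
     counit = tlift C D (\<lambda>x y. counit C x * counit D y)\<rparr>"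

text \<open>The convolution product of maps \<open>f\<close> and \<open>g\<close> on \<open>C\<close>, with values multiplied by \<open>p\<close>: the product
  of scalars, or the (left or right) scalar action on a vector space.\<close>

definition conv ::
  "('a \<Rightarrow> 'b \<Rightarrow> 'x::comm_monoid_add) \<Rightarrow> ('k::field, 'v::ab_group_add, 'z) coalg_scheme \<Rightarrow>
   ('v \<Rightarrow> 'a) \<Rightarrow> ('v \<Rightarrow> 'b) \<Rightarrow> 'v \<Rightarrow> 'x"
  where
  "conv p C f g x = tlift C C (\<lambda>x1 x2. p (f x1) (g x2)) (comult C x)"

definition is_conv_inverse ::
  "('k::field, 'v::ab_group_add, 'z) coalg_scheme \<Rightarrow> ('v \<Rightarrow> 'k) \<Rightarrow> ('v \<Rightarrow> 'k) \<Rightarrow> bool"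
  where
  "is_conv_inverse C f g \<longleftrightarrow>
     (\<forall>x\<in>carr C. conv (*) C f g x = counit C x \<and> conv (*) C g f x = counit C x)"

definition conv_inv ::
  "('k::field, 'v::ab_group_add, 'z) coalg_scheme \<Rightarrow> ('v \<Rightarrow> 'k) \<Rightarrow> ('v \<Rightarrow> 'k)"
  where
  "conv_inv C f = (SOME g. lin C kvs g \<and> is_conv_inverse C f g)"

record ('k, 'h) hopf = "('k, 'h) bialg" +
  antipode :: "'h \<Rightarrow> 'h"

definition is_bialgebra :: "('k::field, 'h::ab_group_add, 'z) bialg_scheme \<Rightarrow> bool" where
  "is_bialgebra H \<longleftrightarrow> is_coalgebra H \<and>
     lin (H \<otimes> H) H (mult H) \<and> unity H \<in> carr H \<and>
     (\<forall>x\<in>carr H. \<forall>y\<in>carr H. \<forall>z\<in>carr H. prd H (prd H x y) z = prd H x (prd H y z)) \<and>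
     (\<forall>x\<in>carr H. prd H (unity H) x = x \<and> prd H x (unity H) = x) \<and>
     coalg_morphism (cotens (flip H H) H H) H (mult H) \<and>
     coalg_morphism kcoalg H (\<lambda>a. scl H a (unity H))"

definition is_hopf_algebra :: "('k::field, 'h::ab_group_add) hopf \<Rightarrow> bool" where
  "is_hopf_algebra H \<longleftrightarrow> is_bialgebra H \<and> lin H H (antipode H) \<and>
     (\<forall>h\<in>carr H.
        tlift H H (\<lambda>h1 h2. prd H h1 (antipode H h2)) (comult H h) = scl H (counit H h) (unity H) \<and>
        tlift H H (\<lambda>h1 h2. prd H (antipode H h1) h2) (comult H h) = scl H (counit H h) (unity H))"


section \<open>Yetter-Drinfeld modules\<close>

record ('k, 'h, 'v) yd = "('k, 'v) vs" +
  act :: "'h \<Rightarrow> 'v \<Rightarrow> 'v"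
  coact :: "'v \<Rightarrow> ('k, 'h, 'v) tensor"

definition is_yd ::
  "('k::field, 'h::ab_group_add) hopf \<Rightarrow> ('k, 'h, 'v::ab_group_add) yd \<Rightarrow> bool"
  where
  "is_yd H V \<longleftrightarrow> is_vs V \<and>
     bilin H V V (act V) \<and>
     (\<forall>g\<in>carr H. \<forall>h\<in>carr H. \<forall>v\<in>carr V. act V (prd H g h) v = act V g (act V h v)) \<and>
     (\<forall>v\<in>carr V. act V (unity H) v = v) \<and>
     lin V (H \<otimes> V) (coact V) \<and>
     (\<forall>v\<in>carr V.
        tlift H V (\<lambda>g v0. tlift H H (\<lambda>g1 g2. pure H (H \<otimes> V) g1 (pure H V g2 v0)) (comult H g))
          (coact V v) =
        tlift H V (\<lambda>g v0. tlift H V (\<lambda>g' v00. pure H (H \<otimes> V) g (pure H V g' v00)) (coact V v0))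
          (coact V v)) \<and>
     (\<forall>v\<in>carr V. tlift H V (\<lambda>g v0. scl V (counit H g) v0) (coact V v) = v) \<and>
     (\<forall>h\<in>carr H. \<forall>v\<in>carr V.
        tlift H H (\<lambda>h1 h2. tlift H V (\<lambda>g w. pure H V (prd H g h2) w) (coact V (act V h1 v)))
          (comult H h) =
        tlift H H (\<lambda>h1 h2. tlift H V (\<lambda>g w. pure H V (prd H h1 g) (act V h2 w)) (coact V v))
          (comult H h))"

definition yd_morphism ::
  "('k::field, 'h::ab_group_add) hopf \<Rightarrow> ('k, 'h, 'v::ab_group_add) yd \<Rightarrow>
   ('k, 'h, 'w::ab_group_add) yd \<Rightarrow> ('v \<Rightarrow> 'w) \<Rightarrow> bool"
  where
  "yd_morphism H V W f \<longleftrightarrow> lin V W f \<and>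
     (\<forall>h\<in>carr H. \<forall>v\<in>carr V. f (act V h v) = act W h (f v)) \<and>
     (\<forall>v\<in>carr V. coact W (f v) = tmap H V H W (\<lambda>h. h) f (coact V v))"

definition yd_unit :: "('k::field, 'h::ab_group_add) hopf \<Rightarrow> ('k, 'h, 'k) yd" where
  "yd_unit H = \<lparr>carr = UNIV, scl = (*), act = (\<lambda>h a. counit H h * a),
     coact = (\<lambda>a. pure H kvs (unity H) a)\<rparr>"

definition yd_tens ::
  "('k::field, 'h::ab_group_add) hopf \<Rightarrow> ('k, 'h, 'v::ab_group_add) yd \<Rightarrow>
   ('k, 'h, 'w::ab_group_add) yd \<Rightarrow> ('k, 'h, ('k, 'v, 'w) tensor) yd"
  where
  "yd_tens H V W = \<lparr>carr = carr (V \<otimes> W), scl = scl (V \<otimes> W),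
     act = (\<lambda>h. tlift V W (\<lambda>v w.
       tlift H H (\<lambda>h1 h2. pure V W (act V h1 v) (act W h2 w)) (comult H h))),
     coact = tlift V W (\<lambda>v w.
       tlift H V (\<lambda>g v0. tlift H W (\<lambda>g' w0. pure H (V \<otimes> W) (prd H g g') (pure V W v0 w0))
         (coact W w)) (coact V v))\<rparr>"

definition yd_braid ::
  "('k::field, 'h::ab_group_add) hopf \<Rightarrow> ('k, 'h, 'v::ab_group_add) yd \<Rightarrow>
   ('k, 'h, 'w::ab_group_add) yd \<Rightarrow> ('k, 'v, 'w) tensor \<Rightarrow> ('k, 'w, 'v) tensor"
  where
  "yd_braid H V W =
     tlift V W (\<lambda>v w. tlift H V (\<lambda>g v0. pure W V (act W g w) v0) (coact V v))"


section \<open>Coquasi-bialgebras\<close>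

record ('k, 'v) cqb = "('k, 'v) bialg" +
  reassoc :: "('k, 'v, ('k, 'v, 'v) tensor) tensor \<Rightarrow> 'k"

record ('k, 'h, 'v) yd_cqb = "('k, 'v) cqb" +
  qact :: "'h \<Rightarrow> 'v \<Rightarrow> 'v"
  qcoact :: "'v \<Rightarrow> ('k, 'h, 'v) tensor"

definition ydob :: "('k, 'h, 'v) yd_cqb \<Rightarrow> ('k, 'h, 'v) yd" where
  "ydob Q = \<lparr>carr = carr Q, scl = scl Q, act = qact Q, coact = qcoact Q\<rparr>"

text \<open>The tensor powers of \<open>Q\<close> as objects and as coalgebras of the category of Yetter-Drinfeld
  modules.\<close>

definition yd_pow2 where
  "yd_pow2 H Q = yd_tens H (ydob Q) (ydob Q)"

definition yd_pow3 where
  "yd_pow3 H Q = yd_tens H (ydob Q) (yd_pow2 H Q)"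

definition yd_copow2 where
  "yd_copow2 H Q = cotens (yd_braid H (ydob Q) (ydob Q)) Q Q"

definition yd_copow3 where
  "yd_copow3 H Q = cotens (yd_braid H (ydob Q) (yd_pow2 H Q)) Q (yd_copow2 H Q)"

definition yd_copow4 where
  "yd_copow4 H Q = cotens (yd_braid H (ydob Q) (yd_pow3 H Q)) Q (yd_copow3 H Q)"

definition is_yd_coquasi_bialgebra ::
  "('k::field, 'h::ab_group_add) hopf \<Rightarrow> ('k, 'h, 'q::ab_group_add) yd_cqb \<Rightarrow> bool"
  where
  "is_yd_coquasi_bialgebra H Q \<longleftrightarrow>
     (let V = ydob Q; I = yd_unit H; m = prd Q; e = unity Q; \<epsilon> = counit Q;
          \<omega> = (\<lambda>x y z. reassoc Q (pure3 Q x y z));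
          Q2 = yd_copow2 H Q; Q3 = yd_copow3 H Q; Q4 = yd_copow4 H Q
      in is_yd H V \<and>
         is_coalgebra Q \<and> yd_morphism H V (yd_pow2 H Q) (comult Q) \<and> yd_morphism H V I \<epsilon> \<and>
         coalg_morphism Q2 Q (mult Q) \<and> yd_morphism H (yd_pow2 H Q) V (mult Q) \<and>
         e \<in> carr Q \<and>
         coalg_morphism kcoalg Q (\<lambda>a. scl Q a e) \<and> yd_morphism H I V (\<lambda>a. scl Q a e) \<and>
         yd_morphism H (yd_pow3 H Q) I (reassoc Q) \<and>
         (\<exists>\<omega>'. yd_morphism H (yd_pow3 H Q) I \<omega>' \<and> is_conv_inverse Q3 (reassoc Q) \<omega>') \<and>
         (\<forall>t\<in>carr Q4.
            conv (*) Q4 (tlift4 Q (\<lambda>x y z w. \<omega> x y (m z w))) (tlift4 Q (\<lambda>x y z w. \<omega> (m x y) z w)) t =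
            conv (*) Q4
              (conv (*) Q4 (tlift4 Q (\<lambda>x y z w. \<epsilon> x * \<omega> y z w)) (tlift4 Q (\<lambda>x y z w. \<omega> x (m y z) w)))
              (tlift4 Q (\<lambda>x y z w. \<omega> x y z * \<epsilon> w)) t) \<and>
         (\<forall>x\<in>carr Q. \<forall>y\<in>carr Q.
            \<omega> x e y = \<epsilon> x * \<epsilon> y \<and> \<omega> e x y = \<epsilon> x * \<epsilon> y \<and> \<omega> x y e = \<epsilon> x * \<epsilon> y) \<and>
         (\<forall>t\<in>carr Q3.
            conv (\<lambda>x a. scl Q a x) Q3 (tlift3 Q (\<lambda>x y z. m x (m y z))) (reassoc Q) t =
            conv (scl Q) Q3 (reassoc Q) (tlift3 Q (\<lambda>x y z. m (m x y) z)) t) \<and>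
         (\<forall>x\<in>carr Q. m e x = x \<and> m x e = x))"


section \<open>Gauge transformations\<close>

definition unitary ::
  "('k::field, 'q::ab_group_add, 'z) bialg_scheme \<Rightarrow> (('k, 'q, 'q) tensor \<Rightarrow> 'k) \<Rightarrow> bool"
  where
  "unitary Q \<gamma> \<longleftrightarrow>
     (\<forall>x\<in>carr Q. \<gamma> (pure Q Q (unity Q) x) = counit Q x \<and> \<gamma> (pure Q Q x (unity Q)) = counit Q x)"

definition is_yd_gauge ::
  "('k::field, 'h::ab_group_add) hopf \<Rightarrow> ('k, 'h, 'q::ab_group_add) yd_cqb \<Rightarrow>
   (('k, 'q, 'q) tensor \<Rightarrow> 'k) \<Rightarrow> bool"
  where
  "is_yd_gauge H Q \<gamma> \<longleftrightarrow>
     yd_morphism H (yd_pow2 H Q) (yd_unit H) \<gamma> \<and>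
     (\<exists>\<gamma>'. yd_morphism H (yd_pow2 H Q) (yd_unit H) \<gamma>' \<and> is_conv_inverse (yd_copow2 H Q) \<gamma> \<gamma>') \<and>
     unitary Q \<gamma>"

text \<open>Ordinary tensor powers of coalgebras, formed with the flip.\<close>

definition copow2 where
  "copow2 Q = cotens (flip Q Q) Q Q"

definition copow3 where
  "copow3 Q = cotens (flip Q (copow2 Q)) Q (copow2 Q)"

definition is_gauge ::
  "('k::field, 'q::ab_group_add) cqb \<Rightarrow> (('k, 'q, 'q) tensor \<Rightarrow> 'k) \<Rightarrow> bool"
  where
  "is_gauge Q \<gamma> \<longleftrightarrow>
     lin (Q \<otimes> Q) kvs \<gamma> \<and>
     (\<exists>\<gamma>'. lin (Q \<otimes> Q) kvs \<gamma>' \<and> is_conv_inverse (copow2 Q) \<gamma> \<gamma>') \<and>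
     unitary Q \<gamma>"

text \<open>The twist of \<open>Q\<close> by \<open>\<gamma>\<close>; \<open>Q2\<close> and \<open>Q3\<close> are the second and third tensor powers of the
  coalgebra \<open>Q\<close> in the category under consideration.\<close>

definition twist_by ::
  "('k::field, ('k, 'q, 'q) tensor) coalg \<Rightarrow> ('k, ('k, 'q, ('k, 'q, 'q) tensor) tensor) coalg \<Rightarrow>
   (('k, 'q, 'q) tensor \<Rightarrow> 'k) \<Rightarrow> ('k, 'q::ab_group_add, 'z) cqb_scheme \<Rightarrow> ('k, 'q, 'z) cqb_scheme"
  where
  "twist_by Q2 Q3 \<gamma> Q =
     (let \<gamma>' = conv_inv Q2 \<gamma>; m = prd Q; \<epsilon> = counit Q;
          f1 = tlift3 Q (\<lambda>x y z. \<epsilon> x * \<gamma> (pure Q Q y z));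
          f2 = tlift3 Q (\<lambda>x y z. \<gamma> (pure Q Q x (m y z)));
          f3 = reassoc Q;
          f4 = tlift3 Q (\<lambda>x y z. \<gamma>' (pure Q Q (m x y) z));
          f5 = tlift3 Q (\<lambda>x y z. \<gamma>' (pure Q Q x y) * \<epsilon> z)
      in Q\<lparr>mult := conv (\<lambda>x a. scl Q a x) Q2 (conv (scl Q) Q2 \<gamma> (mult Q)) \<gamma>',
           reassoc := conv (*) Q3 (conv (*) Q3 (conv (*) Q3 (conv (*) Q3 f1 f2) f3) f4) f5\<rparr>)"

definition yd_twist ::
  "('k::field, 'h::ab_group_add) hopf \<Rightarrow> (('k, 'q, 'q) tensor \<Rightarrow> 'k) \<Rightarrow>
   ('k, 'h, 'q::ab_group_add) yd_cqb \<Rightarrow> ('k, 'h, 'q) yd_cqb"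
  where
  "yd_twist H \<gamma> Q = twist_by (yd_copow2 H Q) (yd_copow3 H Q) \<gamma> Q"

definition twist ::
  "(('k::field, 'q, 'q) tensor \<Rightarrow> 'k) \<Rightarrow> ('k, 'q::ab_group_add) cqb \<Rightarrow> ('k, 'q) cqb"
  where
  "twist \<gamma> Q = twist_by (copow2 Q) (copow3 Q) \<gamma> Q"


section \<open>Bosonization\<close>

definition bosonization ::
  "('k::field, 'h::ab_group_add) hopf \<Rightarrow> ('k, 'h, 'e::ab_group_add) yd_cqb \<Rightarrow>
   ('k, ('k, 'e, 'h) tensor) cqb"
  where
  "bosonization H E =
     (let B = E \<otimes> H in
      \<lparr>carr = carr B, scl = scl B,
       comult = tlift E H (\<lambda>x h.
         tlift E E (\<lambda>x1 x2. tlift H H (\<lambda>h1 h2. tlift H E (\<lambda>g y.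
           pure B B (pure E H x1 (prd H g h1)) (pure E H y h2))
           (qcoact E x2)) (comult H h)) (comult E x)),
       counit = tlift E H (\<lambda>x h. counit E x * counit H h),
       mult = tlift B B (\<lambda>s s'. tlift E H (\<lambda>x h. tlift E H (\<lambda>x' h'.
         tlift H H (\<lambda>h1 h2. pure E H (prd E x (qact E h1 x')) (prd H h2 h')) (comult H h)) s') s),
       unity = pure E H (unity E) (unity H),
       reassoc = tlift3 B (\<lambda>u v w.
         tlift E H (\<lambda>r h. tlift E H (\<lambda>s l. tlift E H (\<lambda>t k.
           tlift H H (\<lambda>h1 h2. reassoc E (pure3 E r (qact E h1 s) (qact E (prd H h2 l) t)))
             (comult H h) * counit H k) w) v) u)\<rparr>)"

definition bosonized_gauge ::
  "('k::field, 'h::ab_group_add) hopf \<Rightarrow> ('k, 'h, 'e::ab_group_add) yd_cqb \<Rightarrow>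
   (('k, 'e, 'e) tensor \<Rightarrow> 'k) \<Rightarrow> ('k, ('k, 'e, 'h) tensor, ('k, 'e, 'h) tensor) tensor \<Rightarrow> 'k"
  where
  "bosonized_gauge H E \<gamma> =
     tlift (E \<otimes> H) (E \<otimes> H) (\<lambda>s s'. tlift E H (\<lambda>x h. tlift E H (\<lambda>x' h'.
       \<gamma> (pure E E x (qact E h x')) * counit H h') s') s)"

text \<open>Equality of all structure, maps being compared on carriers only.\<close>

definition cqb_eq ::
  "('k::field, 'q::ab_group_add) cqb \<Rightarrow> ('k, 'q) cqb \<Rightarrow> bool"
  where
  "cqb_eq A B \<longleftrightarrow>
     carr A = carr B \<and> scl A = scl B \<and> unity A = unity B \<and>
     (\<forall>x\<in>carr A. comult A x = comult B x \<and> counit A x = counit B x) \<and>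
     (\<forall>t\<in>carr (A \<otimes> A). mult A t = mult B t) \<and>
     (\<forall>t\<in>carr (A \<otimes> A \<otimes> A). reassoc A t = reassoc B t)"

end

theory Submission
  imports Defs
begin

text \<open>
  Write \<open>A = E#H\<close> and consider the linear maps
  \<open>\<pi>\<^sub>2 : A \<otimes> A \<rightarrow> E \<otimes> E\<close>, \<open>(x#h) \<otimes> (y#l) \<mapsto> x \<otimes> h y \<epsilon>(l)\<close>, and
  \<open>\<pi>\<^sub>3 : A \<otimes> A \<otimes> A \<rightarrow> E \<otimes> E \<otimes> E\<close>,
  \<open>(r#h) \<otimes> (s#l) \<otimes> (t#k) \<mapsto> r \<otimes> h\<^sub>1 s \<otimes> h\<^sub>2 l t \<epsilon>(k)\<close>.  By definition \<open>\<Gamma> = \<gamma> \<circ> \<pi>\<^sub>2\<close> and the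
  reassociator of \<open>A\<close> is \<open>\<omega> \<circ> \<pi>\<^sub>3\<close>.  The theorem rests on the fact that both maps are coalgebra maps
  from the ordinary tensor powers of \<open>A\<close> to the braided tensor powers of \<open>E\<close>: the factor
  \<open>x\<^sub>-\<^sub>1\<close> that the smash coproduct puts into the first leg acts on the next tensor factor exactly as
  the braiding does.  Both are instances of one statement, \<open>coalg_map_spread\<close>: if \<open>\<pi> : D \<rightarrow> F\<close> is a
  coalgebra map from an ordinary coalgebra to an \<open>H\<close>-module coalgebra, then so is
  \<open>(x#h) \<otimes> d \<mapsto> x \<otimes> h \<pi>(d)\<close>, from \<open>A \<otimes> D\<close> to the braided \<open>E \<otimes> F\<close>.  For \<open>\<pi>\<^sub>3\<close> it needs that the
  braided \<open>E \<otimes> E\<close> is a module coalgebra (\<open>comult_act2\<close>), which is where the Yetter-Drinfeld condition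
  enters.

  Convolution pulls back along coalgebra maps.  Hence \<open>\<Gamma>\<close> is invertible with inverse
  \<open>\<gamma>\<^sup>-\<^sup>1 \<circ> \<pi>\<^sub>2\<close>.  Each of the five factors of \<open>\<omega>\<^sub>A\<^sup>\<Gamma>\<close> is the corresponding factor for \<open>E\<close> composed
  with \<open>\<pi>\<^sub>3\<close> (\<open>reassoc_factors\<close>, from the \<open>H\<close>-linearity of \<open>\<gamma>\<close> and of the product), so
  \<open>\<omega>\<^sub>A\<^sup>\<Gamma> = \<omega>\<^sup>\<gamma> \<circ> \<pi>\<^sub>3\<close>, which is the reassociator of \<open>E\<^sup>\<gamma>#H\<close>.

  For the product, extend \<open>f : E \<otimes> E \<rightarrow> E\<close> to \<open>ext f : A \<otimes> A \<rightarrow> A\<close> by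
  \<open>(x#h) \<otimes> (y#l) \<mapsto> f(x \<otimes> h\<^sub>1 y) # h\<^sub>2 l\<close>; the product of \<open>A\<close> is the extension of \<open>m\<close>.  Extension turns
  \<open>\<gamma> * f\<close> into \<open>\<Gamma> * ext f\<close> for every form \<open>\<gamma>\<close> (\<open>conv_boson_ext_left\<close>) and \<open>f * \<gamma>\<^sup>-\<^sup>1\<close> into
  \<open>ext f * \<Gamma>\<^sup>-\<^sup>1\<close>, because \<open>\<gamma>\<^sup>-\<^sup>1\<close> is colinear (\<open>conv_boson_ext_right\<close>).

  Since convolution inverses are chosen by Hilbert's operator, their uniqueness is required, both on
  \<open>A \<otimes> A\<close> and on the braided \<open>E \<otimes> E\<close>.  It is a consequence of coassociativity on \<open>A \<otimes> A\<close>
  (\<open>scalar_coalgebra_A\<close>), and it descends to \<open>E \<otimes> E\<close> because \<open>\<pi>\<^sub>2\<close> is surjective.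

  All identities between tensors are verified after evaluation at an arbitrary bilinear form, so that
  the computations take place between iterated Sweedler sums with scalar values.
\<close>

section \<open>Sweedler sums\<close>

definition reps where
  "reps V W t = (if is_vs V \<and> is_vs W \<and> t \<in> carr (V \<otimes> W) then trep V W t else [])"

text \<open>The Sweedler sum of \<open>b\<close> over \<open>t\<close>, extended by \<open>0\<close> to arguments outside the tensor product.  It
  agrees with \<^const>\<open>tlift\<close> on the tensor product, but the summation variables now always range
  over the carriers.  This makes the congruence rule and the interchange of two sums below
  unconditional, so that they can be used for rewriting under the binders of an enclosing sum.\<close>
definition sw ::
  "('k::field, 'v::ab_group_add, 'a) vs_scheme \<Rightarrow> ('k, 'w::ab_group_add, 'b) vs_scheme \<Rightarrow>
   ('v \<Rightarrow> 'w \<Rightarrow> 'x::comm_monoid_add) \<Rightarrow> ('k, 'v, 'w) tensor \<Rightarrow> 'x"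
  where
  "sw V W b t = (\<Sum>(v, w)\<leftarrow>reps V W t. b v w)"

lemma set_reps: "set (reps V W t) \<subseteq> carr V \<times> carr W"
  using trep_props(1)[of V W t] by (auto simp: reps_def)

lemma tlift_sw:
  assumes "is_vs V" "is_vs W" "t \<in> carr (V \<otimes> W)"
    and "\<And>v w. v \<in> carr V \<Longrightarrow> w \<in> carr W \<Longrightarrow> b v w = b' v w"
  shows "tlift V W b t = sw V W b' t"
proof -
  have "(\<Sum>(v, w)\<leftarrow>trep V W t. b v w) = (\<Sum>(v, w)\<leftarrow>trep V W t. b' v w)"
    using trep_props(1)[OF assms(1-3)] assms(4)
    by (intro arg_cong[where f = sum_list] map_cong refl) auto
  then show ?thesis using assms(1-3) by (simp add: tlift_def sw_def reps_def)
qed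

lemma tlift_to_sw: "is_vs V \<Longrightarrow> is_vs W \<Longrightarrow> t \<in> carr (V \<otimes> W) \<Longrightarrow> tlift V W b t = sw V W b t"
  by (rule tlift_sw) auto

lemma sw_cong [cong]:
  assumes "V = V'" "W = W'" "t = t'"
    and "\<And>v w. v \<in> carr V' \<Longrightarrow> w \<in> carr W' \<Longrightarrow> b v w = b' v w"
  shows "sw V W b t = sw V' W' b' t'"
  unfolding sw_def assms(1-3) using set_reps[of V' W' t'] assms(4)
  by (intro arg_cong[where f = sum_list] map_cong refl) auto

lemmas sw_cong1 = sw_cong[OF refl refl refl]

text \<open>Nested finite sums over fixed lists of representatives may be interchanged, whether or not the
  summand is bilinear.\<close>
lemma sw_swap:
  "sw V W (\<lambda>v w. sw X Y (\<lambda>x y. F v w x y) s) t = sw X Y (\<lambda>x y. sw V W (\<lambda>v w. F v w x y) t) s"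
proof -
  have add: "sum_list (map (\<lambda>p. f p + g p) ps) = sum_list (map f ps) + sum_list (map g ps)"
    for ps and f g :: "_ \<Rightarrow> 'z::comm_monoid_add"
    by (induction ps) (auto simp: ac_simps)
  have "(\<Sum>(v, w)\<leftarrow>ps. \<Sum>(x, y)\<leftarrow>qs. F v w x y) = (\<Sum>(x, y)\<leftarrow>qs. \<Sum>(v, w)\<leftarrow>ps. F v w x y)" for ps qs
  proof (induction ps)
    case Nil
    show ?case by (induction qs) auto
  next
    case (Cons p ps)
    then show ?case using add[of "\<lambda>(x, y). F (fst p) (snd p) x y" "\<lambda>(x, y). \<Sum>(v, w)\<leftarrow>ps. F v w x y" qs]
      by (simp add: case_prod_unfold)
  qed
  then show ?thesis by (simp add: sw_def)
qed

lemma sw_mult_left: "c * sw V W b t = sw V W (\<lambda>v w. c * b v w) t" for c :: "'k::field"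
  by (simp add: sw_def case_prod_unfold sum_list_const_mult)

lemma sw_mult_right: "sw V W b t * c = sw V W (\<lambda>v w. b v w * c) t" for c :: "'k::field"
  by (simp add: sw_def case_prod_unfold sum_list_mult_const)

section \<open>Linear maps\<close>

lemma lin_in: "lin V W f \<Longrightarrow> v \<in> carr V \<Longrightarrow> f v \<in> carr W"
  by (simp add: lin_def)

lemma lin_comp: "lin V W f \<Longrightarrow> lin Z V g \<Longrightarrow> lin Z W (\<lambda>z. f (g z))"
  by (simp add: lin_def)

lemma lin_eq_on: "lin V W f \<Longrightarrow> (\<And>v. v \<in> carr V \<Longrightarrow> g v = f v) \<Longrightarrow> is_vs V \<Longrightarrow> lin V W g"
  by (auto simp: lin_def is_vs_closed)

lemma carr_kvs [simp]: "a \<in> carr kvs" and scl_kvs [simp]: "scl kvs a b = a * b"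
  by (simp_all add: kvs_def)

declare is_vs_kvs [simp] is_vs_tens [simp] pure_in_tens [simp]

lemma sum_list_in: "is_vs X \<Longrightarrow> (\<And>p. p \<in> set ps \<Longrightarrow> f p \<in> carr X) \<Longrightarrow> sum_list (map f ps) \<in> carr X"
  by (induction ps) (auto intro: is_vs_closed)

lemma sw_in [simp]:
  assumes "is_vs X" "\<And>v w. v \<in> carr V \<Longrightarrow> w \<in> carr W \<Longrightarrow> b v w \<in> carr X"
  shows "sw V W b t \<in> carr X"
  unfolding sw_def using set_reps[of V W t] assms by (auto intro!: sum_list_in)

lemma lin_sw:
  assumes "lin X Z f" "is_vs X" "is_vs Z" "\<And>v w. v \<in> carr V \<Longrightarrow> w \<in> carr W \<Longrightarrow> g v w \<in> carr X"
  shows "f (sw V W g t) = sw V W (\<lambda>v w. f (g v w)) t"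
proof -
  have "set (map (\<lambda>(v, w). g v w) (reps V W t)) \<subseteq> carr X"
    using set_reps[of V W t] assms(4) by auto
  from lin_sum_list[OF assms(2,3,1) this] show ?thesis
    by (simp add: sw_def case_prod_unfold comp_def)
qed

lemma sw_pure_self:
  assumes "is_vs V" "is_vs W" "t \<in> carr (V \<otimes> W)"
  shows "sw V W (pure V W) t = t"
  using trep_props(2)[OF assms] assms by (simp add: sw_def reps_def)

lemma lin_sw_map:
  assumes "is_vs V" "is_vs W" "is_vs X" "bilin V W X b"
  shows "lin (V \<otimes> W) X (sw V W b)"
  by (rule lin_eq_on[OF lin_tlift[OF assms]])
    (use assms in \<open>auto simp: is_vs_tens intro!: tlift_sw[symmetric]\<close>)

lemma sw_pure:
  assumes "is_vs V" "is_vs W" "is_vs X" "bilin V W X b" "v \<in> carr V" "w \<in> carr W"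
  shows "sw V W b (pure V W v w) = b v w"
proof -
  have "tlift V W b (pure V W v w) = sw V W b (pure V W v w)"
    using assms by (intro tlift_sw pure_in_tens) auto
  then show ?thesis using tlift_pure[OF assms] by simp
qed

lemma sw_sw:
  assumes "is_vs V" "is_vs W" "is_vs X" "bilin V W X b"
    and "\<And>y z. y \<in> carr Y \<Longrightarrow> z \<in> carr Z \<Longrightarrow> g y z \<in> carr (V \<otimes> W)"
  shows "sw V W b (sw Y Z g t) = sw Y Z (\<lambda>y z. sw V W b (g y z)) t"
  by (rule lin_sw[OF lin_sw_map[OF assms(1-4)] is_vs_tens assms(3) assms(5)])

text \<open>By construction, an element of \<open>V \<otimes> W\<close> is a functional that is determined by its values at
  bilinear forms.\<close>
lemma tensor_eq_test:
  assumes "is_vs V" "is_vs W" "s \<in> carr (V \<otimes> W)" "t \<in> carr (V \<otimes> W)"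
    and "\<And>\<phi>. bilin V W kvs \<phi> \<Longrightarrow> sw V W \<phi> s = sw V W \<phi> t"
  shows "s = t"
proof (rule tensor_eqI)
  have *: "teval u \<phi> = (if bilin V W kvs \<phi> then sw V W \<phi> u else 0)" if "u \<in> carr (V \<otimes> W)" for u \<phi>
  proof -
    have "teval u \<phi> = teval (sw V W (pure V W) u) \<phi>" using sw_pure_self[OF assms(1,2) that] by simp
    also have "\<dots> = (if bilin V W kvs \<phi> then sw V W \<phi> u else 0)"
      by (auto simp: sw_def teval_sum_list case_prod_unfold pure_def)
    finally show ?thesis .
  qed
  show "teval s \<phi> = teval t \<phi>" for \<phi>
    using assms(3-5) by (simp add: *)
qed

text \<open>The following rules have premises of the same kind as their conclusions, so that the
  simplifier can prove that an iterated Sweedler sum is linear in any of its parameters by descending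
  through its structure.\<close>

lemma bilinI [simp]:
  assumes "\<And>v. v \<in> carr V \<Longrightarrow> lin W X (\<lambda>w. b v w)" "\<And>w. w \<in> carr W \<Longrightarrow> lin V X (\<lambda>v. b v w)"
  shows "bilin V W X b"
  using assms by (auto simp: bilin_def)

lemma bilinD1: "bilin V W X b \<Longrightarrow> v \<in> carr V \<Longrightarrow> lin Z W f \<Longrightarrow> lin Z X (\<lambda>z. b v (f z))"
  and bilinD2: "bilin V W X b \<Longrightarrow> w \<in> carr W \<Longrightarrow> lin Z V g \<Longrightarrow> lin Z X (\<lambda>z. b (g z) w)"
  and bilin_in: "bilin V W X b \<Longrightarrow> v \<in> carr V \<Longrightarrow> w \<in> carr W \<Longrightarrow> b v w \<in> carr X"
  by (auto simp: bilin_def lin_def)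

lemma lin_id [simp]: "lin V V (\<lambda>v. v)" by (simp add: lin_def)

lemma lin_pure1 [simp]: "lin Z V f \<Longrightarrow> w \<in> carr W \<Longrightarrow> lin Z (V \<otimes> W) (\<lambda>z. pure V W (f z) w)"
  and lin_pure2 [simp]: "v \<in> carr V \<Longrightarrow> lin Z W g \<Longrightarrow> lin Z (V \<otimes> W) (\<lambda>z. pure V W v (g z))"
  by (rule bilinD2[OF bilin_pure], assumption+) (rule bilinD1[OF bilin_pure], assumption+)

lemma lin_times1 [simp]: "lin Z kvs f \<Longrightarrow> lin Z kvs (\<lambda>z. f z * c)"
  and lin_times2 [simp]: "lin Z kvs f \<Longrightarrow> lin Z kvs (\<lambda>z. c * f z)"
  by (auto simp: lin_def algebra_simps)

lemma is_vs_simps: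
  assumes "is_vs V"
  shows "scl V a (scl V b x) = scl V (a * b) x" "scl V (a + b) x = scl V a x + scl V b x"
    "scl V a (x + y) = scl V a x + scl V a y" "scl V 1 x = x"
proof -
  interpret vector_space "scl V" using assms by (simp add: is_vs_def)
  show "scl V a (scl V b x) = scl V (a * b) x" "scl V (a + b) x = scl V a x + scl V b x"
    "scl V a (x + y) = scl V a x + scl V a y" "scl V 1 x = x"
    by (simp_all add: algebra_simps)
qed

lemma scl_in [simp]: "is_vs V \<Longrightarrow> v \<in> carr V \<Longrightarrow> scl V a v \<in> carr V"
  by (rule is_vs_closed)

lemma lin_scl1 [simp]: "lin Z kvs f \<Longrightarrow> is_vs X \<Longrightarrow> x \<in> carr X \<Longrightarrow> lin Z X (\<lambda>z. scl X (f z) x)"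
  by (auto simp: lin_def is_vs_simps)

lemma lin_scl2 [simp]: "lin Z X f \<Longrightarrow> is_vs X \<Longrightarrow> lin Z X (\<lambda>z. scl X c (f z))"
  by (auto simp: lin_def is_vs_simps mult.commute)

lemma lin_scl_apply: "lin V kvs f \<Longrightarrow> v \<in> carr V \<Longrightarrow> f (scl V a v) = a * f v"
  by (simp add: lin_def)

lemma lin_sw_arg [simp]:
  assumes "is_vs V" "is_vs W" "is_vs X" "bilin V W X b" "lin Z (V \<otimes> W) t"
  shows "lin Z X (\<lambda>z. sw V W b (t z))"
  using lin_comp[OF lin_sw_map[OF assms(1-4)] assms(5)] .

lemma lin_sw_body [simp]:
  assumes X: "is_vs X" and b: "\<And>v w. v \<in> carr V \<Longrightarrow> w \<in> carr W \<Longrightarrow> lin Z X (\<lambda>z. b z v w)"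
  shows "lin Z X (\<lambda>z. sw V W (b z) t)"
proof -
  have "lin Z X (\<lambda>z. \<Sum>(v, w)\<leftarrow>ps. b z v w)" if "set ps \<subseteq> carr V \<times> carr W" for ps
    using that
  proof (induction ps)
    case Nil
    interpret vector_space "scl X" using X by (simp add: is_vs_def)
    show ?case using is_vs_closed(1)[OF X] by (simp add: lin_def)
  next
    case (Cons p ps)
    then have *: "lin Z X (\<lambda>z. b z (fst p) (snd p))" "lin Z X (\<lambda>z. \<Sum>(v, w)\<leftarrow>ps. b z v w)"
      using b by auto
    have "lin Z X (\<lambda>z. b z (fst p) (snd p) + (\<Sum>(v, w)\<leftarrow>ps. b z v w))"
      using *
      by (auto simp: lin_def is_vs_simps[OF X] is_vs_closed[OF X] algebra_simps)
    then show ?case by (simp add: case_prod_unfold)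
  qed
  then show ?thesis using set_reps[of V W t] by (simp add: sw_def)
qed

text \<open>For scalar values the target space is determined by the type, so that the next two rules can be
  applied by the simplifier; in \<open>sw_pure\<close> and \<open>sw_sw\<close> it occurs in the premises only.\<close>
lemma sw_pure_k [simp]:
  fixes b :: "'v::ab_group_add \<Rightarrow> 'w::ab_group_add \<Rightarrow> 'k::field"
  assumes "is_vs V" "is_vs W" "v \<in> carr V" "w \<in> carr W" "bilin V W kvs b"
  shows "sw V W b (pure V W v w) = b v w"
  using sw_pure[of V W kvs b] assms by simp

lemma sw_sw_k [simp]:
  fixes b :: "'v::ab_group_add \<Rightarrow> 'w::ab_group_add \<Rightarrow> 'k::field"
  assumes "is_vs V" "is_vs W"
    and "\<And>y z. y \<in> carr Y \<Longrightarrow> z \<in> carr Z \<Longrightarrow> g y z \<in> carr (V \<otimes> W)" "bilin V W kvs b"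
  shows "sw V W b (sw Y Z g t) = sw Y Z (\<lambda>y z. sw V W b (g y z)) t"
  by (rule sw_sw[OF assms(1,2) is_vs_kvs assms(4,3)])

lemma sw_scl:
  fixes \<phi> :: "_ \<Rightarrow> _ \<Rightarrow> 'k::field"
  assumes "is_vs V" "is_vs W" "t \<in> carr (V \<otimes> W)" "bilin V W kvs \<phi>"
  shows "sw V W \<phi> (scl (V \<otimes> W) a t) = a * sw V W \<phi> t"
  using lin_sw_map[OF assms(1,2) is_vs_kvs assms(4)] assms(3) by (simp add: lin_def)

lemma lin_as_sw:
  fixes \<phi> :: "_ \<Rightarrow> 'k::field"
  assumes "is_vs V" "is_vs W" "lin (V \<otimes> W) kvs \<phi>" "t \<in> carr (V \<otimes> W)"
  shows "\<phi> t = sw V W (\<lambda>v w. \<phi> (pure V W v w)) t"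
  using lin_sw[OF assms(3) is_vs_tens is_vs_kvs, of V W "pure V W" t] sw_pure_self[OF assms(1,2,4)]
  by simp

text \<open>The notions at hand depend on a record only through its carrier and its scalar multiplication.
  Instances of this lemma identify the spaces that underlie the various coalgebras and
  Yetter-Drinfeld modules with plain tensor products.\<close>
lemma same_space:
  assumes "carr V = carr V'" "scl V = scl V'"
  shows "is_vs V = is_vs V'" "V \<otimes> W = V' \<otimes> W" "W \<otimes> V = W \<otimes> V'"
    "pure V W = pure V' W" "pure W V = pure W V'"
    "sw V W b t = sw V' W b t" "sw W V c u = sw W V' c u"
    "tlift V W b t = tlift V' W b t" "tlift W V c u = tlift W V' c u"
    "lin V W f = lin V' W f" "lin W V g = lin W V' g"
    "bilin V W X p = bilin V' W X p" "bilin W V X q = bilin W V' X q" "bilin X W V r = bilin X W V' r"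
proof -
  show l: "lin V W f = lin V' W f" "lin W V g = lin W V' g" for W f g
    using assms by (simp_all add: lin_def)
  show b: "bilin V W X p = bilin V' W X p" "bilin W V X q = bilin W V' X q"
    "bilin X W V r = bilin X W V' r" for W X p q r
    by (auto simp: bilin_def l assms)
  show "is_vs V = is_vs V'" using assms by (simp add: is_vs_def)
  note v = this
  show p: "pure V W = pure V' W" "pure W V = pure W V'" for W
    by (auto simp: pure_def fun_eq_iff b)
  show t: "V \<otimes> W = V' \<otimes> W" "W \<otimes> V = W \<otimes> V'" for W
    by (simp_all add: tens_def p assms)
  have r: "trep V W t = trep V' W t" "trep W V u = trep W V' u"
    by (simp_all add: trep_def assms p)
  then have "reps V W t = reps V' W t" "reps W V u = reps W V' u"
    by (simp_all add: reps_def t v)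
  then show "sw V W b t = sw V' W b t" "sw W V c u = sw W V' c u"
    by (simp_all add: sw_def)
  show "tlift V W b t = tlift V' W b t" "tlift W V c u = tlift W V' c u"
    by (simp_all add: tlift_def r)
qed

definition trilin where
  "trilin U V W X F \<longleftrightarrow>
     (\<forall>v\<in>carr V. \<forall>w\<in>carr W. lin U X (\<lambda>u. F u v w)) \<and> (\<forall>u\<in>carr U. bilin V W X (F u))"

lemma trilinI [simp]:
  assumes "\<And>v w. v \<in> carr V \<Longrightarrow> w \<in> carr W \<Longrightarrow> lin U X (\<lambda>u. F u v w)"
    and "\<And>u w. u \<in> carr U \<Longrightarrow> w \<in> carr W \<Longrightarrow> lin V X (\<lambda>v. F u v w)"
    and "\<And>u v. u \<in> carr U \<Longrightarrow> v \<in> carr V \<Longrightarrow> lin W X (\<lambda>w. F u v w)"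
  shows "trilin U V W X F"
  using assms by (simp add: trilin_def)

lemma trilinD:
  assumes "trilin U V W X F"
  shows "v \<in> carr V \<Longrightarrow> w \<in> carr W \<Longrightarrow> lin U X (\<lambda>u. F u v w)"
    and "u \<in> carr U \<Longrightarrow> w \<in> carr W \<Longrightarrow> lin V X (\<lambda>v. F u v w)"
    and "u \<in> carr U \<Longrightarrow> v \<in> carr V \<Longrightarrow> lin W X (\<lambda>w. F u v w)"
    and "v \<in> carr V \<Longrightarrow> w \<in> carr W \<Longrightarrow> lin Z U f \<Longrightarrow> lin Z X (\<lambda>z. F (f z) v w)"
    and "u \<in> carr U \<Longrightarrow> w \<in> carr W \<Longrightarrow> lin Z V g \<Longrightarrow> lin Z X (\<lambda>z. F u (g z) w)"
    and "u \<in> carr U \<Longrightarrow> v \<in> carr V \<Longrightarrow> lin Z W h \<Longrightarrow> lin Z X (\<lambda>z. F u v (h z))"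
proof -
  show 1: "v \<in> carr V \<Longrightarrow> w \<in> carr W \<Longrightarrow> lin U X (\<lambda>u. F u v w)"
    and 2: "u \<in> carr U \<Longrightarrow> w \<in> carr W \<Longrightarrow> lin V X (\<lambda>v. F u v w)"
    and 3: "u \<in> carr U \<Longrightarrow> v \<in> carr V \<Longrightarrow> lin W X (\<lambda>w. F u v w)"
    for u v w
    using assms by (simp_all add: trilin_def bilin_def)
  show "v \<in> carr V \<Longrightarrow> w \<in> carr W \<Longrightarrow> lin Z U f \<Longrightarrow> lin Z X (\<lambda>z. F (f z) v w)"
    using lin_comp[OF 1] .
  show "u \<in> carr U \<Longrightarrow> w \<in> carr W \<Longrightarrow> lin Z V g \<Longrightarrow> lin Z X (\<lambda>z. F u (g z) w)"
    using lin_comp[OF 2] .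
  show "u \<in> carr U \<Longrightarrow> v \<in> carr V \<Longrightarrow> lin Z W h \<Longrightarrow> lin Z X (\<lambda>z. F u v (h z))"
    using lin_comp[OF 3] .
qed

lemma trilin_space:
  assumes "carr V = carr V'" "scl V = scl V'"
  shows "trilin V U W X F1 = trilin V' U W X F1" "trilin U V W X F2 = trilin U V' W X F2"
    "trilin U W V X F3 = trilin U W V' X F3"
  by (simp_all add: trilin_def same_space[OF assms] assms)

lemma tlift3_space: "carr V = carr V' \<Longrightarrow> scl V = scl V' \<Longrightarrow> tlift3 V b = tlift3 V' b"
proof -
  assume *: "carr V = carr V'" "scl V = scl V'"
  have "tlift V V (b x) = tlift V' V' (b x)" for x
    by (rule ext) (simp add: same_space(8,9)[OF *])
  then show ?thesis by (intro ext) (simp add: tlift3_def same_space(2,3,8,9)[OF *])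
qed

lemma tlift3:
  fixes b :: "_ \<Rightarrow> _ \<Rightarrow> _ \<Rightarrow> 'k::field"
  assumes [simp]: "is_vs V" and b: "trilin V V V kvs b"
  shows tlift3_lin: "lin (V \<otimes> V \<otimes> V) kvs (tlift3 V b)"
    and tlift3_pure: "x \<in> carr V \<Longrightarrow> y \<in> carr V \<Longrightarrow> z \<in> carr V \<Longrightarrow>
      tlift3 V b (pure V (V \<otimes> V) x (pure V V y z)) = b x y z"
proof -
  note [simp] = trilinD[OF b]
  have *: "tlift3 V b t = sw V (V \<otimes> V) (\<lambda>x. sw V V (b x)) t" if "t \<in> carr (V \<otimes> V \<otimes> V)" for t
    using that by (simp add: tlift3_def tlift_to_sw)
  show "lin (V \<otimes> V \<otimes> V) kvs (tlift3 V b)"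
    by (rule lin_eq_on[OF lin_sw_map[of V "V \<otimes> V" kvs "\<lambda>x. sw V V (b x)"]]) (simp_all add: *)
  show "x \<in> carr V \<Longrightarrow> y \<in> carr V \<Longrightarrow> z \<in> carr V \<Longrightarrow>
      tlift3 V b (pure V (V \<otimes> V) x (pure V V y z)) = b x y z"
    by (simp add: *)
qed

lemma lin_ext3:
  assumes "is_vs U" "is_vs V" "is_vs W" "is_vs X"
    and "lin ((U \<otimes> V) \<otimes> W) X f" "lin ((U \<otimes> V) \<otimes> W) X g"
    and eq: "\<And>u v w. u \<in> carr U \<Longrightarrow> v \<in> carr V \<Longrightarrow> w \<in> carr W \<Longrightarrow>
      f (pure (U \<otimes> V) W (pure U V u v) w) = g (pure (U \<otimes> V) W (pure U V u v) w)"
    and t: "t \<in> carr ((U \<otimes> V) \<otimes> W)"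
  shows "f t = g t"
proof (rule tens_ext[OF _ assms(3,4,5,6) _ t])
  fix s w assume s: "s \<in> carr (U \<otimes> V)" and w: "w \<in> carr W"
  show "f (pure (U \<otimes> V) W s w) = g (pure (U \<otimes> V) W s w)"
    by (rule tens_ext[OF assms(1,2,4) lin_comp[OF assms(5)] lin_comp[OF assms(6)] _ s])
      (use w eq in auto)
qed simp

lemma lin_ext4:
  assumes "is_vs U" "is_vs V" "is_vs W" "is_vs X" "is_vs Z"
    and "lin ((U \<otimes> V) \<otimes> (W \<otimes> X)) Z f" "lin ((U \<otimes> V) \<otimes> (W \<otimes> X)) Z g"
    and eq: "\<And>u v w x. u \<in> carr U \<Longrightarrow> v \<in> carr V \<Longrightarrow> w \<in> carr W \<Longrightarrow> x \<in> carr X \<Longrightarrow>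
      f (pure (U \<otimes> V) (W \<otimes> X) (pure U V u v) (pure W X w x)) = g (pure (U \<otimes> V) (W \<otimes> X) (pure U V u v) (pure W X w x))"
    and t: "t \<in> carr ((U \<otimes> V) \<otimes> (W \<otimes> X))"
  shows "f t = g t"
proof (rule lin_ext3[OF assms(1,2) is_vs_tens assms(5-7) _ t])
  fix u v s assume u: "u \<in> carr U" "v \<in> carr V" and s: "s \<in> carr (W \<otimes> X)"
  show "f (pure (U \<otimes> V) (W \<otimes> X) (pure U V u v) s) = g (pure (U \<otimes> V) (W \<otimes> X) (pure U V u v) s)"
    by (rule tens_ext[OF assms(3,4,5) lin_comp[OF assms(6)] lin_comp[OF assms(7)] _ s])
      (use u eq in auto)
qed

lemma lin_ext6:
  assumes [simp]: "is_vs U" "is_vs V" "is_vs Z"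
    and f: "lin ((U \<otimes> V) \<otimes> (U \<otimes> V) \<otimes> (U \<otimes> V)) Z f" and g: "lin ((U \<otimes> V) \<otimes> (U \<otimes> V) \<otimes> (U \<otimes> V)) Z g"
    and eq: "\<And>r h s l t k. r \<in> carr U \<Longrightarrow> s \<in> carr U \<Longrightarrow> t \<in> carr U \<Longrightarrow>
       h \<in> carr V \<Longrightarrow> l \<in> carr V \<Longrightarrow> k \<in> carr V \<Longrightarrow>
      f (pure3 (U \<otimes> V) (pure U V r h) (pure U V s l) (pure U V t k)) =
      g (pure3 (U \<otimes> V) (pure U V r h) (pure U V s l) (pure U V t k))"
    and t: "t \<in> carr ((U \<otimes> V) \<otimes> (U \<otimes> V) \<otimes> (U \<otimes> V))"
  shows "f t = g t"
proof (rule lin_ext3[OF assms(1,2) is_vs_tens assms(3) f g _ t])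
  fix u v s assume [simp]: "u \<in> carr U" "v \<in> carr V" and s: "s \<in> carr ((U \<otimes> V) \<otimes> (U \<otimes> V))"
  show "f (pure (U \<otimes> V) ((U \<otimes> V) \<otimes> (U \<otimes> V)) (pure U V u v) s) = g (pure (U \<otimes> V) ((U \<otimes> V) \<otimes> (U \<otimes> V)) (pure U V u v) s)"
    by (rule lin_ext4[OF assms(1,2,1,2,3) lin_comp[OF f] lin_comp[OF g] _ s])
      (use eq in \<open>auto simp: pure3_def\<close>)
qed

section \<open>Coalgebras and convolution\<close>

lemma coalgD:
  assumes "is_coalgebra C"
  shows "is_vs C" "x \<in> carr C \<Longrightarrow> comult C x \<in> carr (C \<otimes> C)"
    "lin Z C f \<Longrightarrow> lin Z (C \<otimes> C) (\<lambda>z. comult C (f z))" "lin Z C f \<Longrightarrow> lin Z kvs (\<lambda>z. counit C (f z))"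
  using assms by (auto simp: is_coalgebra_def intro: lin_in lin_comp)

text \<open>The coassociativity axiom, an identity in \<open>C \<otimes> C \<otimes> C\<close>, evaluated at a trilinear form.\<close>
lemma coalg_coassoc:
  assumes C: "is_coalgebra C" and x: "x \<in> carr C" and F: "trilin C C C kvs F"
  shows "sw C C (\<lambda>a b. sw C C (\<lambda>a1 a2. F a1 a2 b) (comult C a)) (comult C x) =
    sw C C (\<lambda>a b. sw C C (\<lambda>b1 b2. F a b1 b2) (comult C b)) (comult C x)"
proof -
  note [simp] = coalgD[OF C] trilinD[OF F] x
  let ?L = "sw C (C \<otimes> C) (\<lambda>a. sw C C (F a))"
  have "?L (sw C C (\<lambda>a b. sw C C (\<lambda>a1 a2. pure3 C a1 a2 b) (comult C a)) (comult C x)) =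
    ?L (sw C C (\<lambda>a b. sw C C (\<lambda>b1 b2. pure3 C a b1 b2) (comult C b)) (comult C x))"
    using C x by (simp add: is_coalgebra_def tlift_to_sw)
  then show ?thesis by (simp add: pure3_def)
qed

lemma coalg_counit:
  assumes C: "is_coalgebra C" and x: "x \<in> carr C" and f: "lin C kvs f"
  shows "sw C C (\<lambda>a b. counit C a * f b) (comult C x) = f x"
    "sw C C (\<lambda>a b. f a * counit C b) (comult C x) = f x"
proof -
  note [simp] = coalgD[OF C] x lin_comp[OF f]
  have s: "f (scl C c y) = c * f y" if "y \<in> carr C" for c y using f that by (simp add: lin_def)
  have "f (sw C C (\<lambda>a b. scl C (counit C a) b) (comult C x)) = f x"
    "f (sw C C (\<lambda>a b. scl C (counit C b) a) (comult C x)) = f x"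
    using C x by (simp_all add: is_coalgebra_def tlift_to_sw)
  then show "sw C C (\<lambda>a b. counit C a * f b) (comult C x) = f x"
    "sw C C (\<lambda>a b. f a * counit C b) (comult C x) = f x"
    by (simp_all add: lin_sw[OF f] s mult.commute)
qed

text \<open>The consequences of the coalgebra axioms for scalar-valued sums.  They are all that uniqueness of
  convolution inverses needs, and in this form they are stable under tensor products by direct
  computation.\<close>
definition scalar_coalgebra where
  "scalar_coalgebra C \<longleftrightarrow> is_vs C \<and> lin C (C \<otimes> C) (comult C) \<and> lin C kvs (counit C) \<and>
    (\<forall>x\<in>carr C. \<forall>F. trilin C C C kvs F \<longrightarrow>
      sw C C (\<lambda>a b. sw C C (\<lambda>a1 a2. F a1 a2 b) (comult C a)) (comult C x) =
      sw C C (\<lambda>a b. sw C C (\<lambda>b1 b2. F a b1 b2) (comult C b)) (comult C x)) \<and>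
    (\<forall>x\<in>carr C. \<forall>f. lin C kvs f \<longrightarrow>
      sw C C (\<lambda>a b. counit C a * f b) (comult C x) = f x \<and>
      sw C C (\<lambda>a b. f a * counit C b) (comult C x) = f x)"

lemma scalar_coalgebraD:
  assumes "scalar_coalgebra C"
  shows "is_vs C" "lin C (C \<otimes> C) (comult C)" "lin C kvs (counit C)"
    "x \<in> carr C \<Longrightarrow> trilin C C C kvs F \<Longrightarrow>
      sw C C (\<lambda>a b. sw C C (\<lambda>a1 a2. F a1 a2 b) (comult C a)) (comult C x) =
      sw C C (\<lambda>a b. sw C C (\<lambda>b1 b2. F a b1 b2) (comult C b)) (comult C x)"
    "x \<in> carr C \<Longrightarrow> lin C kvs f \<Longrightarrow> sw C C (\<lambda>a b. counit C a * f b) (comult C x) = f x"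
    "x \<in> carr C \<Longrightarrow> lin C kvs f \<Longrightarrow> sw C C (\<lambda>a b. f a * counit C b) (comult C x) = f x"
  using assms by (simp_all add: scalar_coalgebra_def)

lemma conv_sw:
  assumes "is_vs C" "lin C (C \<otimes> C) (comult C)" "t \<in> carr C"
    and "\<And>u. u \<in> carr C \<Longrightarrow> f u = f' u" "\<And>u. u \<in> carr C \<Longrightarrow> g u = g' u"
  shows "conv p C f g t = sw C C (\<lambda>u v. p (f' u) (g' v)) (comult C t)"
  unfolding conv_def by (rule tlift_sw) (use assms in \<open>auto intro: lin_in\<close>)

lemma conv_cong:
  assumes "is_vs C" "lin C (C \<otimes> C) (comult C)" "t \<in> carr C"
    and "\<And>u. u \<in> carr C \<Longrightarrow> f u = f' u" "\<And>u. u \<in> carr C \<Longrightarrow> g u = g' u"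
  shows "conv p C f g t = conv p C f' g' t"
  using conv_sw[OF assms(1-3), of f f' g g' p] conv_sw[OF assms(1-3), of f' f' g' g' p] assms(4,5) by simp

lemma lin_conv:
  assumes [simp]: "is_vs C" and c: "lin C (C \<otimes> C) (comult C)" and [simp]: "is_vs X"
    and p: "bilin Y Z X p" and f: "lin C Y f" and g: "lin C Z g"
  shows "lin C X (conv p C f g)"
proof -
  have "bilin C C X (\<lambda>u v. p (f u) (g v))"
    by (rule bilinI, rule bilinD1[OF p lin_in[OF f] g], assumption, rule bilinD2[OF p lin_in[OF g] f])
  then have "lin C X (\<lambda>t. sw C C (\<lambda>u v. p (f u) (g v)) (comult C t))"
    using c by simp
  then show ?thesis by (rule lin_eq_on) (auto intro: conv_sw[OF _ c])
qed

lemma bilin_times: "bilin kvs kvs kvs ((*) :: 'k::field \<Rightarrow> _)"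
  by (rule bilinI) (simp_all add: lin_def algebra_simps)

lemma bilin_scl: "is_vs V \<Longrightarrow> bilin kvs V V (scl V)" "is_vs V \<Longrightarrow> bilin V kvs V (\<lambda>x a. scl V a x)"
  by (auto simp: bilin_def)

text \<open>As in any monoid, \<open>g = g * (f * g') = (g * f) * g' = g'\<close>.\<close>
lemma conv_inverse_unique:
  assumes C: "scalar_coalgebra C" and f: "lin C kvs f" and g: "lin C kvs g" and g': "lin C kvs g'"
    and i: "is_conv_inverse C f g" and i': "is_conv_inverse C f g'" and x: "x \<in> carr C"
  shows "g x = g' x"
proof -
  note C' = scalar_coalgebraD[OF C]
  note [simp] = C'(1) lin_comp[OF C'(2)] lin_in[OF C'(2)] lin_comp[OF C'(3)] lin_comp[OF f] lin_comp[OF g] lin_comp[OF g']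
  have gf: "sw C C (\<lambda>a b. g a * f b) (comult C u) = counit C u"
    and fg': "sw C C (\<lambda>a b. f a * g' b) (comult C u) = counit C u" if "u \<in> carr C" for u
    using i i' that conv_sw[OF C'(1,2) that, of g g f f "(*)"] conv_sw[OF C'(1,2) that, of f f g' g' "(*)"]
    by (simp_all add: is_conv_inverse_def)
  have "g' x = sw C C (\<lambda>a b. counit C a * g' b) (comult C x)" using C'(5)[OF x g'] by simp
  also have "\<dots> = sw C C (\<lambda>a b. sw C C (\<lambda>a1 a2. g a1 * f a2 * g' b) (comult C a)) (comult C x)"
    by (rule sw_cong1) (simp add: gf[symmetric] sw_mult_right)
  also have "\<dots> = sw C C (\<lambda>a b. sw C C (\<lambda>b1 b2. g a * f b1 * g' b2) (comult C b)) (comult C x)"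
    by (rule C'(4)[OF x]) simp
  also have "\<dots> = sw C C (\<lambda>a b. g a * counit C b) (comult C x)"
    by (rule sw_cong1) (simp add: fg'[symmetric] sw_mult_left mult.assoc)
  also have "\<dots> = g x" by (rule C'(6)[OF x g])
  finally show ?thesis ..
qed

lemma conv_inv:
  assumes "lin C kvs g" "is_conv_inverse C f g"
  shows "lin C kvs (conv_inv C f)" "is_conv_inverse C f (conv_inv C f)"
  using someI_ex[of "\<lambda>g. lin C kvs g \<and> is_conv_inverse C f g"] assms unfolding conv_inv_def by auto

text \<open>Coalgebra maps, with the compatibility of comultiplications stated for all bilinear forms.\<close>
definition coalg_map where
  "coalg_map C D P \<longleftrightarrow> lin C D P \<and> (\<forall>t\<in>carr C. counit D (P t) = counit C t) \<and>
    (\<forall>t\<in>carr C. \<forall>\<Phi>. bilin D D kvs \<Phi> \<longrightarrow>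
      sw D D \<Phi> (comult D (P t)) = sw C C (\<lambda>u v. \<Phi> (P u) (P v)) (comult C t))"

lemma conv_coalg_map:
  fixes f g :: "_ \<Rightarrow> 'k::field"
  assumes P: "coalg_map C D P" and [simp]: "is_vs C" "is_vs D"
    and C: "lin C (C \<otimes> C) (comult C)" and D: "lin D (D \<otimes> D) (comult D)"
    and f: "lin D kvs f" and g: "lin D kvs g"
    and f': "\<And>u. u \<in> carr C \<Longrightarrow> f' u = f (P u)" and g': "\<And>u. u \<in> carr C \<Longrightarrow> g' u = g (P u)"
    and t: "t \<in> carr C"
  shows "conv (*) C f' g' t = conv (*) D f g (P t)"
proof -
  have "conv (*) C f' g' t = sw C C (\<lambda>u v. f (P u) * g (P v)) (comult C t)"
    by (rule conv_sw[OF _ C t]) (auto simp: f' g')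
  also have "bilin D D kvs (\<lambda>u v. f u * g v)" using f g by simp
  then have "sw C C (\<lambda>u v. f (P u) * g (P v)) (comult C t) = sw D D (\<lambda>u v. f u * g v) (comult D (P t))"
    using P t by (simp add: coalg_map_def)
  also have "\<dots> = conv (*) D f g (P t)"
    using P t by (intro conv_sw[symmetric, OF _ D]) (auto simp: coalg_map_def intro: lin_in)
  finally show ?thesis .
qed

text \<open>The bracketing is that of the reassociator of a twist.\<close>
lemma conv5_coalg_map:
  fixes f1 :: "_ \<Rightarrow> 'k::field"
  assumes P: "coalg_map C D P" and [simp]: "is_vs C" "is_vs D"
    and C: "lin C (C \<otimes> C) (comult C)" and D: "lin D (D \<otimes> D) (comult D)"
    and l: "lin D kvs f1" "lin D kvs f2" "lin D kvs f3" "lin D kvs f4" "lin D kvs f5"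
    and e: "\<And>u. u \<in> carr C \<Longrightarrow> g1 u = f1 (P u)" "\<And>u. u \<in> carr C \<Longrightarrow> g2 u = f2 (P u)"
      "\<And>u. u \<in> carr C \<Longrightarrow> g3 u = f3 (P u)" "\<And>u. u \<in> carr C \<Longrightarrow> g4 u = f4 (P u)"
      "\<And>u. u \<in> carr C \<Longrightarrow> g5 u = f5 (P u)"
    and t: "t \<in> carr C"
  shows "conv (*) C (conv (*) C (conv (*) C (conv (*) C g1 g2) g3) g4) g5 t =
    conv (*) D (conv (*) D (conv (*) D (conv (*) D f1 f2) f3) f4) f5 (P t)"
  by (intro conv_coalg_map[OF P _ _ C D] lin_conv[OF _ D _ bilin_times] l e t) auto

section \<open>Tensor products of coalgebras\<close>

lemma carr_scl [simp]:
  "carr (ydob Q) = carr Q" "scl (ydob Q) = scl Q"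
  "carr (yd_unit H) = carr kvs" "scl (yd_unit H) = scl kvs"
  "carr (yd_tens H V W) = carr (V \<otimes> W)" "scl (yd_tens H V W) = scl (V \<otimes> W)"
  "carr (cotens c C D) = carr (C \<otimes> D)" "scl (cotens c C D) = scl (C \<otimes> D)"
  by (simp_all add: ydob_def yd_unit_def kvs_def yd_tens_def cotens_def)

lemmas ydob_space [simp] = same_space[OF carr_scl(1,2)]

lemmas yd_unit_space [simp] = same_space[OF carr_scl(3,4)]

lemmas yd_tens_space [simp] = same_space[OF carr_scl(5,6)]

lemmas cotens_space [simp] = same_space[OF carr_scl(7,8)] trilin_space[OF carr_scl(7,8)]

lemma kcoalg_space [simp]: "carr kcoalg = carr kvs" "scl kcoalg = scl kvs"
  by (simp_all add: kcoalg_def kvs_def)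

lemma kcoalg_ops [simp]: "comult kcoalg a = pure kvs kvs a 1" "counit kcoalg a = a"
  by (simp_all add: kcoalg_def)

lemmas kcoalg_space' [simp] = same_space[OF kcoalg_space]

lemma yd_pow_space [simp]:
  "carr (yd_pow2 H Q) = carr (Q \<otimes> Q)" "scl (yd_pow2 H Q) = scl (Q \<otimes> Q)"
  "carr (yd_pow3 H Q) = carr (Q \<otimes> Q \<otimes> Q)" "scl (yd_pow3 H Q) = scl (Q \<otimes> Q \<otimes> Q)"
  "carr (yd_copow2 H Q) = carr (Q \<otimes> Q)" "scl (yd_copow2 H Q) = scl (Q \<otimes> Q)"
  "carr (yd_copow3 H Q) = carr (Q \<otimes> Q \<otimes> Q)" "scl (yd_copow3 H Q) = scl (Q \<otimes> Q \<otimes> Q)"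
  by (simp_all add: yd_pow2_def yd_pow3_def yd_copow2_def yd_copow3_def)

lemma yd_ops:
  "act (yd_unit H) h a = counit H h * a" "coact (yd_unit H) a = pure H kvs (unity H) a"
  "act (yd_tens H V W) h = tlift V W (\<lambda>v w.
       tlift H H (\<lambda>h1 h2. pure V W (act V h1 v) (act W h2 w)) (comult H h))"
  "coact (yd_tens H V W) = tlift V W (\<lambda>v w.
       tlift H V (\<lambda>g v0. tlift H W (\<lambda>g' w0. pure H (V \<otimes> W) (prd H g g') (pure V W v0 w0))
         (coact W w)) (coact V v))"
  "act (yd_pow2 H Q) = act (yd_tens H (ydob Q) (ydob Q))"
  "coact (yd_pow2 H Q) = coact (yd_tens H (ydob Q) (ydob Q))"
  by (simp_all add: yd_unit_def yd_tens_def yd_pow2_def)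

lemmas yd_pow_space' [simp] =
  same_space[OF yd_pow_space(1,2)] same_space[OF yd_pow_space(3,4)]
  same_space[OF yd_pow_space(5,6)] same_space[OF yd_pow_space(7,8)]

lemma copow_space [simp]:
  "carr (copow2 Q) = carr (Q \<otimes> Q)" "scl (copow2 Q) = scl (Q \<otimes> Q)"
  "carr (copow3 Q) = carr (Q \<otimes> Q \<otimes> Q)" "scl (copow3 Q) = scl (Q \<otimes> Q \<otimes> Q)"
  by (simp_all add: copow2_def copow3_def)

lemmas copow_space' [simp] = same_space[OF copow_space(1,2)] same_space[OF copow_space(3,4)]

lemma prd_lin:
  assumes "lin (A \<otimes> A) A (mult A)"
  shows "x \<in> carr A \<Longrightarrow> y \<in> carr A \<Longrightarrow> prd A x y \<in> carr A"
    "lin Z A f \<Longrightarrow> y \<in> carr A \<Longrightarrow> lin Z A (\<lambda>z. prd A (f z) y)"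
    "lin Z A f \<Longrightarrow> x \<in> carr A \<Longrightarrow> lin Z A (\<lambda>z. prd A x (f z))"
  using assms by (auto simp: prd_def intro!: lin_in[OF assms] lin_comp[OF assms])

lemma cotens_comult:
  fixes \<Phi> :: "_ \<Rightarrow> _ \<Rightarrow> 'k::field"
  assumes C: "is_vs C" "lin C (C \<otimes> C) (comult C)" and D: "is_vs D" "lin D (D \<otimes> D) (comult D)"
    and c: "lin (C \<otimes> D) (D \<otimes> C) c"
  shows "lin (C \<otimes> D) ((C \<otimes> D) \<otimes> (C \<otimes> D)) (comult (cotens c C D))"
    "x \<in> carr C \<Longrightarrow> y \<in> carr D \<Longrightarrow> bilin (C \<otimes> D) (C \<otimes> D) kvs \<Phi> \<Longrightarrow>
      sw (C \<otimes> D) (C \<otimes> D) \<Phi> (comult (cotens c C D) (pure C D x y)) =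
      sw C C (\<lambda>x1 x2. sw D D (\<lambda>y1 y2. sw D C (\<lambda>y1' x2'. \<Phi> (pure C D x1 y1') (pure C D x2' y2))
        (c (pure C D x2 y1))) (comult D y)) (comult C x)"
proof -
  note [simp] = C D lin_comp[OF C(2)] lin_comp[OF D(2)] lin_in[OF C(2)] lin_in[OF D(2)] lin_in[OF c] lin_comp[OF c]
  let ?b = "\<lambda>x y. sw C C (\<lambda>x1 x2. sw D D (\<lambda>y1 y2.
         sw D C (\<lambda>y1' x2'. pure (C \<otimes> D) (C \<otimes> D) (pure C D x1 y1') (pure C D x2' y2))
           (c (pure C D x2 y1)))
         (comult D y)) (comult C x)"
  have b: "bilin C D ((C \<otimes> D) \<otimes> (C \<otimes> D)) ?b" by simp
  have *: "comult (cotens c C D) t = sw C D ?b t" if "t \<in> carr (C \<otimes> D)" for t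
    using that by (simp add: cotens_def tlift_to_sw)
  show "lin (C \<otimes> D) ((C \<otimes> D) \<otimes> (C \<otimes> D)) (comult (cotens c C D))"
    by (rule lin_eq_on[OF lin_sw_map[OF _ _ _ b]]) (simp_all add: *)
  assume [simp]: "x \<in> carr C" "y \<in> carr D" and \<Phi>: "bilin (C \<otimes> D) (C \<otimes> D) kvs \<Phi>"
  note [simp] = bilinD1[OF \<Phi>] bilinD2[OF \<Phi>]
  have "comult (cotens c C D) (pure C D x y) = ?b x y"
    by (simp add: *) (rule sw_pure[OF _ _ _ b], simp_all)
  then show "sw (C \<otimes> D) (C \<otimes> D) \<Phi> (comult (cotens c C D) (pure C D x y)) =
      sw C C (\<lambda>x1 x2. sw D D (\<lambda>y1 y2. sw D C (\<lambda>y1' x2'. \<Phi> (pure C D x1 y1') (pure C D x2' y2))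
        (c (pure C D x2 y1))) (comult D y)) (comult C x)"
    by simp
qed

lemma cotens_counit:
  assumes C: "is_vs C" "lin C kvs (counit C)" and D: "is_vs D" "lin D kvs (counit D)"
  shows "lin (C \<otimes> D) kvs (counit (cotens c C D))"
    "x \<in> carr C \<Longrightarrow> y \<in> carr D \<Longrightarrow> counit (cotens c C D) (pure C D x y) = counit C x * counit D y"
proof -
  note [simp] = C D lin_comp[OF C(2)] lin_comp[OF D(2)]
  have *: "counit (cotens c C D) t = sw C D (\<lambda>x y. counit C x * counit D y) t" if "t \<in> carr (C \<otimes> D)" for t
    using that by (simp add: cotens_def tlift_to_sw)
  show "lin (C \<otimes> D) kvs (counit (cotens c C D))"
    by (rule lin_eq_on[OF lin_sw_map[of C D kvs "\<lambda>x y. counit C x * counit D y"]]) (simp_all add: *)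
  show "x \<in> carr C \<Longrightarrow> y \<in> carr D \<Longrightarrow> counit (cotens c C D) (pure C D x y) = counit C x * counit D y"
    by (simp add: *)
qed

lemma flip_lin:
  assumes [simp]: "is_vs V" "is_vs W"
  shows "lin (V \<otimes> W) (W \<otimes> V) (flip V W)"
    "v \<in> carr V \<Longrightarrow> w \<in> carr W \<Longrightarrow> flip V W (pure V W v w) = pure W V w v"
  by (simp_all add: flip_def lin_tlift tlift_pure[of V W "W \<otimes> V"])

lemma cotens_flip_comult:
  fixes \<Phi> :: "_ \<Rightarrow> _ \<Rightarrow> 'k::field"
  assumes C: "is_vs C" "lin C (C \<otimes> C) (comult C)" and D: "is_vs D" "lin D (D \<otimes> D) (comult D)"
    and xy: "x \<in> carr C" "y \<in> carr D" and \<Phi>: "bilin (C \<otimes> D) (C \<otimes> D) kvs \<Phi>"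
  shows "sw (C \<otimes> D) (C \<otimes> D) \<Phi> (comult (cotens (flip C D) C D) (pure C D x y)) =
      sw C C (\<lambda>x1 x2. sw D D (\<lambda>y1 y2. \<Phi> (pure C D x1 y1) (pure C D x2 y2)) (comult D y)) (comult C x)"
proof -
  note [simp] = C(1) D(1) bilinD1[OF \<Phi>] bilinD2[OF \<Phi>]
  show ?thesis
    by (simp add: cotens_comult(2)[OF C D flip_lin(1)[OF C(1) D(1)] xy \<Phi>] flip_lin(2))
qed

text \<open>With the flip, the two components of an iterated coproduct do not interact: coassociativity is
  applied to one component at a time, after interchanging sums.\<close>
lemma scalar_coalgebra_cotens_flip:
  assumes C: "scalar_coalgebra C" and D: "scalar_coalgebra D"
  shows "scalar_coalgebra (cotens (flip C D) C D)"
proof -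
  note C' = scalar_coalgebraD[OF C] and D' = scalar_coalgebraD[OF D]
  note [simp] = C'(1) lin_comp[OF C'(2)] lin_in[OF C'(2)] lin_comp[OF C'(3)]
    D'(1) lin_comp[OF D'(2)] lin_in[OF D'(2)] lin_comp[OF D'(3)]
  let ?P = "cotens (flip C D) C D"
  have l: "lin (C \<otimes> D) ((C \<otimes> D) \<otimes> (C \<otimes> D)) (comult ?P)"
    by (rule cotens_comult(1)[OF C'(1,2) D'(1,2)]) (simp add: flip_lin)
  have e: "lin (C \<otimes> D) kvs (counit ?P)"
    by (rule cotens_counit(1)[OF C'(1,3) D'(1,3)])
  note cu = cotens_counit(2)[OF C'(1,3) D'(1,3)] and cm = cotens_flip_comult[OF C'(1,2) D'(1,2)]
  note [simp] = lin_comp[OF l] lin_in[OF l] lin_comp[OF e]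
  have "sw (C \<otimes> D) (C \<otimes> D) (\<lambda>a b. sw (C \<otimes> D) (C \<otimes> D) (\<lambda>a1 a2. F a1 a2 b) (comult ?P a)) (comult ?P t) =
      sw (C \<otimes> D) (C \<otimes> D) (\<lambda>a b. sw (C \<otimes> D) (C \<otimes> D) (\<lambda>b1 b2. F a b1 b2) (comult ?P b)) (comult ?P t)"
    if F: "trilin (C \<otimes> D) (C \<otimes> D) (C \<otimes> D) kvs F" and t: "t \<in> carr (C \<otimes> D)" for t F
  proof (rule tens_ext[OF _ _ is_vs_kvs _ _ _ t])
    note [simp] = trilinD[OF F]
    show "lin (C \<otimes> D) kvs (\<lambda>t. sw (C \<otimes> D) (C \<otimes> D) (\<lambda>a b. sw (C \<otimes> D) (C \<otimes> D) (\<lambda>a1 a2. F a1 a2 b) (comult ?P a)) (comult ?P t))"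
     "lin (C \<otimes> D) kvs (\<lambda>t. sw (C \<otimes> D) (C \<otimes> D) (\<lambda>a b. sw (C \<otimes> D) (C \<otimes> D) (\<lambda>b1 b2. F a b1 b2) (comult ?P b)) (comult ?P t))"
      by simp_all
    fix x y assume [simp]: "x \<in> carr C" "y \<in> carr D"
    let ?F = "\<lambda>x1 y1 x2 y2 x3 y3. F (pure C D x1 y1) (pure C D x2 y2) (pure C D x3 y3)"
    have "sw (C \<otimes> D) (C \<otimes> D) (\<lambda>a b. sw (C \<otimes> D) (C \<otimes> D) (\<lambda>a1 a2. F a1 a2 b) (comult ?P a)) (comult ?P (pure C D x y)) =
      sw C C (\<lambda>x1 x2. sw D D (\<lambda>y1 y2. sw C C (\<lambda>x11 x12. sw D D (\<lambda>y11 y12. ?F x11 y11 x12 y12 x2 y2) (comult D y1)) (comult C x1)) (comult D y)) (comult C x)"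
      by (simp add: cm)
    also have "\<dots> = sw D D (\<lambda>y1 y2. sw C C (\<lambda>x1 x2. sw C C (\<lambda>x11 x12. sw D D (\<lambda>y11 y12. ?F x11 y11 x12 y12 x2 y2) (comult D y1)) (comult C x1)) (comult C x)) (comult D y)"
      by (rule sw_swap)
    also have "\<dots> = sw D D (\<lambda>y1 y2. sw C C (\<lambda>x1 x2. sw C C (\<lambda>x21 x22. sw D D (\<lambda>y11 y12. ?F x1 y11 x21 y12 x22 y2) (comult D y1)) (comult C x2)) (comult C x)) (comult D y)"
      by (rule sw_cong1, rule C'(4)) simp_all
    also have "\<dots> = sw C C (\<lambda>x1 x2. sw C C (\<lambda>x21 x22. sw D D (\<lambda>y1 y2. sw D D (\<lambda>y11 y12. ?F x1 y11 x21 y12 x22 y2) (comult D y1)) (comult D y)) (comult C x2)) (comult C x)"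
      by (simp only: sw_swap[of D D C C])
    also have "\<dots> = sw C C (\<lambda>x1 x2. sw C C (\<lambda>x21 x22. sw D D (\<lambda>y1 y2. sw D D (\<lambda>y21 y22. ?F x1 y1 x21 y21 x22 y22) (comult D y2)) (comult D y)) (comult C x2)) (comult C x)"
      by (rule sw_cong1, rule sw_cong1, rule D'(4)) simp_all
    also have "\<dots> = sw C C (\<lambda>x1 x2. sw D D (\<lambda>y1 y2. sw C C (\<lambda>x21 x22. sw D D (\<lambda>y21 y22. ?F x1 y1 x21 y21 x22 y22) (comult D y2)) (comult C x2)) (comult D y)) (comult C x)"
      by (rule sw_cong1, rule sw_swap)
    also have "\<dots> = sw (C \<otimes> D) (C \<otimes> D) (\<lambda>a b. sw (C \<otimes> D) (C \<otimes> D) (\<lambda>b1 b2. F a b1 b2) (comult ?P b)) (comult ?P (pure C D x y))"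
      by (simp add: cm)
    finally show "sw (C \<otimes> D) (C \<otimes> D) (\<lambda>a b. sw (C \<otimes> D) (C \<otimes> D) (\<lambda>a1 a2. F a1 a2 b) (comult ?P a)) (comult ?P (pure C D x y)) =
      sw (C \<otimes> D) (C \<otimes> D) (\<lambda>a b. sw (C \<otimes> D) (C \<otimes> D) (\<lambda>b1 b2. F a b1 b2) (comult ?P b)) (comult ?P (pure C D x y))" .
  qed simp_all
  moreover have "sw (C \<otimes> D) (C \<otimes> D) (\<lambda>a b. counit ?P a * f b) (comult ?P t) = f t \<and>
      sw (C \<otimes> D) (C \<otimes> D) (\<lambda>a b. f a * counit ?P b) (comult ?P t) = f t"
    if f: "lin (C \<otimes> D) kvs f" and t: "t \<in> carr (C \<otimes> D)" for f t
  proof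
    note [simp] = lin_comp[OF f]
    show "sw (C \<otimes> D) (C \<otimes> D) (\<lambda>a b. counit ?P a * f b) (comult ?P t) = f t"
    proof (rule tens_ext[OF _ _ is_vs_kvs _ f _ t])
      fix x y assume [simp]: "x \<in> carr C" "y \<in> carr D"
      have "sw (C \<otimes> D) (C \<otimes> D) (\<lambda>a b. counit ?P a * f b) (comult ?P (pure C D x y)) =
        sw C C (\<lambda>x1 x2. counit C x1 * sw D D (\<lambda>y1 y2. counit D y1 * f (pure C D x2 y2)) (comult D y)) (comult C x)"
        by (simp add: cm cu sw_mult_left mult.assoc)
      then show "sw (C \<otimes> D) (C \<otimes> D) (\<lambda>a b. counit ?P a * f b) (comult ?P (pure C D x y)) = f (pure C D x y)"
        by (simp add: D'(5) C'(5)[of x "\<lambda>x. f (pure C D x y)"])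
    qed simp_all
    show "sw (C \<otimes> D) (C \<otimes> D) (\<lambda>a b. f a * counit ?P b) (comult ?P t) = f t"
    proof (rule tens_ext[OF _ _ is_vs_kvs _ f _ t])
      fix x y assume [simp]: "x \<in> carr C" "y \<in> carr D"
      have "sw (C \<otimes> D) (C \<otimes> D) (\<lambda>a b. f a * counit ?P b) (comult ?P (pure C D x y)) =
        sw C C (\<lambda>x1 x2. sw D D (\<lambda>y1 y2. f (pure C D x1 y1) * counit D y2) (comult D y) * counit C x2) (comult C x)"
        by (simp add: cm cu sw_mult_left sw_mult_right ac_simps)
      then show "sw (C \<otimes> D) (C \<otimes> D) (\<lambda>a b. f a * counit ?P b) (comult ?P (pure C D x y)) = f (pure C D x y)"
        by (simp add: D'(6) C'(6)[of x "\<lambda>x. f (pure C D x y)"])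
    qed simp_all
  qed
  ultimately show ?thesis using l e by (simp add: scalar_coalgebra_def)
qed

section \<open>Yetter-Drinfeld modules\<close>

locale bialgebra =
  fixes H :: "('k::field, 'h::ab_group_add) hopf"
  assumes H: "is_bialgebra H"
begin

lemma coalg_H: "is_coalgebra H" and lin_mult_H: "lin (H \<otimes> H) H (mult H)"
  and prd_assoc: "x \<in> carr H \<Longrightarrow> y \<in> carr H \<Longrightarrow> z \<in> carr H \<Longrightarrow> prd H (prd H x y) z = prd H x (prd H y z)"
  and prd_unity [simp]: "x \<in> carr H \<Longrightarrow> prd H (unity H) x = x" "x \<in> carr H \<Longrightarrow> prd H x (unity H) = x"
  and unity_in [simp]: "unity H \<in> carr H"
  and mor_mult: "coalg_morphism (cotens (flip H H) H H) H (mult H)"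
  and mor_unity: "coalg_morphism kcoalg H (\<lambda>a. scl H a (unity H))"
  using H by (auto simp: is_bialgebra_def)

lemmas H_simps [simp] = coalgD[OF coalg_H] prd_lin[OF lin_mult_H]

lemma counit_unity_H [simp]: "counit H (unity H) = 1"
  using mor_unity is_vs_simps(4)[of H "unity H"]
  by (auto simp: coalg_morphism_def kcoalg_def dest: spec[of _ 1])

lemma counit_prd_H [simp]: "g \<in> carr H \<Longrightarrow> h \<in> carr H \<Longrightarrow> counit H (prd H g h) = counit H g * counit H h"
  using mor_mult by (simp add: coalg_morphism_def prd_def cotens_counit lin_comp)

lemma comult_prd_H:
  assumes [simp]: "g \<in> carr H" "h \<in> carr H" and \<phi>: "bilin H H kvs \<phi>"
  shows "sw H H \<phi> (comult H (prd H g h)) =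
    sw H H (\<lambda>g1 g2. sw H H (\<lambda>h1 h2. \<phi> (prd H g1 h1) (prd H g2 h2)) (comult H h)) (comult H g)"
proof -
  note [simp] = bilinD1[OF \<phi>] bilinD2[OF \<phi>]
  let ?P = "cotens (flip H H) H H"
  have lin: "lin (H \<otimes> H) ((H \<otimes> H) \<otimes> (H \<otimes> H)) (comult ?P)"
    by (rule cotens_comult) (simp_all add: flip_lin)
  have "comult H (prd H g h) = sw (H \<otimes> H) (H \<otimes> H) (\<lambda>v w. pure H H (mult H v) (mult H w)) (comult ?P (pure H H g h))"
    using mor_mult lin_in[OF lin]
    by (simp add: coalg_morphism_def tmap_def prd_def tlift_to_sw lin_comp[OF lin_mult_H])
  then have "sw H H \<phi> (comult H (prd H g h)) =
     sw (H \<otimes> H) (H \<otimes> H) (\<lambda>v w. \<phi> (mult H v) (mult H w)) (comult ?P (pure H H g h))"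
    by (simp add: lin_comp[OF lin_mult_H] lin_in[OF lin_mult_H])
  also have "\<dots> = sw H H (\<lambda>g1 g2. sw H H (\<lambda>h1 h2. \<phi> (prd H g1 h1) (prd H g2 h2)) (comult H h)) (comult H g)"
    by (subst cotens_flip_comult) (simp_all add: prd_def lin_comp[OF lin_mult_H] lin_in[OF lin_mult_H])
  finally show ?thesis .
qed

text \<open>Both sides are sums over \<open>h\<^sub>1 \<otimes> h\<^sub>2 \<otimes> h\<^sub>3 \<otimes> h\<^sub>4\<close>.  The right-hand side exposes the two middle
  components as the coproduct of a single element, which is the form that the Yetter-Drinfeld
  condition applies to.\<close>
lemma coassoc_middle_H:
  assumes h [simp]: "h \<in> carr H"
    and G1: "\<And>b c d. b \<in> carr H \<Longrightarrow> c \<in> carr H \<Longrightarrow> d \<in> carr H \<Longrightarrow> lin H kvs (\<lambda>a. G a b c d)"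
    and G2: "\<And>a c d. a \<in> carr H \<Longrightarrow> c \<in> carr H \<Longrightarrow> d \<in> carr H \<Longrightarrow> lin H kvs (\<lambda>b. G a b c d)"
    and G3: "\<And>a b d. a \<in> carr H \<Longrightarrow> b \<in> carr H \<Longrightarrow> d \<in> carr H \<Longrightarrow> lin H kvs (\<lambda>c. G a b c d)"
    and G4: "\<And>a b c. a \<in> carr H \<Longrightarrow> b \<in> carr H \<Longrightarrow> c \<in> carr H \<Longrightarrow> lin H kvs (\<lambda>d. G a b c d)"
  shows "sw H H (\<lambda>u w. sw H H (\<lambda>a b. sw H H (\<lambda>c d. G a b c d) (comult H w)) (comult H u)) (comult H h) =
    sw H H (\<lambda>a r. sw H H (\<lambda>m d. sw H H (\<lambda>b c. G a b c d) (comult H m)) (comult H r)) (comult H h)"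
proof -
  note [simp] = G1 G2 G3 G4
  have "sw H H (\<lambda>u w. sw H H (\<lambda>a b. sw H H (\<lambda>c d. G a b c d) (comult H w)) (comult H u)) (comult H h) =
    sw H H (\<lambda>a r. sw H H (\<lambda>b w. sw H H (\<lambda>c d. G a b c d) (comult H w)) (comult H r)) (comult H h)"
    by (rule coalg_coassoc[OF coalg_H]) simp_all
  also have "\<dots> = sw H H (\<lambda>a r. sw H H (\<lambda>m d. sw H H (\<lambda>b c. G a b c d) (comult H m)) (comult H r)) (comult H h)"
    by (rule sw_cong1, rule coalg_coassoc[OF coalg_H, symmetric]) simp_all
  finally show ?thesis .
qed

end

locale yd_setting = bialgebra H for H :: "('k::field, 'h::ab_group_add) hopf" +
  fixes E :: "('k, 'h, 'e::ab_group_add) yd_cqb"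
  assumes E: "is_yd_coquasi_bialgebra H E"

begin

lemma E_parts:
  shows "is_yd H (ydob E)" and coalg_E: "is_coalgebra E"
    and "yd_morphism H (ydob E) (yd_pow2 H E) (comult E)"
    and "yd_morphism H (ydob E) (yd_unit H) (counit E)"
    and "yd_morphism H (yd_pow2 H E) (ydob E) (mult E)"
    and unity_in_E [simp]: "unity E \<in> carr E"
    and "yd_morphism H (yd_unit H) (ydob E) (\<lambda>a. scl E a (unity E))"
    and "yd_morphism H (yd_pow3 H E) (yd_unit H) (reassoc E)"
  using E by (simp_all add: is_yd_coquasi_bialgebra_def Let_def)

lemma ops_ydob [simp]: "act (ydob Q) = qact Q" "coact (ydob Q) = qcoact Q"
  by (simp_all add: ydob_def)

lemma lin_mult_E: "lin (E \<otimes> E) E (mult E)" and lin_reassoc: "lin (E \<otimes> E \<otimes> E) kvs (reassoc E)"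
  using E_parts(5,8) by (simp_all add: yd_morphism_def)

lemma yd_E:
  shows act_bilin: "bilin H E E (qact E)"
    and act_prd: "g \<in> carr H \<Longrightarrow> h \<in> carr H \<Longrightarrow> v \<in> carr E \<Longrightarrow> qact E (prd H g h) v = qact E g (qact E h v)"
    and act_unity [simp]: "v \<in> carr E \<Longrightarrow> qact E (unity H) v = v"
    and coact_linear: "lin E (H \<otimes> E) (qcoact E)"
  using E_parts(1) by (simp_all add: is_yd_def)

lemma E_simps [simp]:
  "h \<in> carr H \<Longrightarrow> v \<in> carr E \<Longrightarrow> qact E h v \<in> carr E"
  "lin Z H f \<Longrightarrow> v \<in> carr E \<Longrightarrow> lin Z E (\<lambda>z. qact E (f z) v)"
  "h \<in> carr H \<Longrightarrow> lin Z E f' \<Longrightarrow> lin Z E (\<lambda>z. qact E h (f' z))"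
  "v \<in> carr E \<Longrightarrow> qcoact E v \<in> carr (H \<otimes> E)"
  "lin Z E f' \<Longrightarrow> lin Z (H \<otimes> E) (\<lambda>z. qcoact E (f' z))"
  "lin Z (E \<otimes> E) f2 \<Longrightarrow> lin Z E (\<lambda>z. mult E (f2 z))"
  using bilinD1[OF act_bilin] bilinD2[OF act_bilin] bilin_in[OF act_bilin]
    lin_comp[OF coact_linear] lin_in[OF coact_linear] lin_comp[OF lin_mult_E] by auto

lemmas E_simps' [simp] = coalgD[OF coalg_E] prd_lin[OF lin_mult_E]

text \<open>The axiom evaluated at a form.  The other axioms for \<open>E\<close> are brought into the same shape below, in
  which they apply inside iterated sums.\<close>
lemma coact_coassoc:
  assumes x [simp]: "x \<in> carr E" and F: "trilin H H E kvs F"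
  shows "sw H E (\<lambda>g v. sw H H (\<lambda>g1 g2. F g1 g2 v) (comult H g)) (qcoact E x) =
    sw H E (\<lambda>g v. sw H E (\<lambda>g' w. F g g' w) (qcoact E v)) (qcoact E x)"
proof -
  note [simp] = trilinD[OF F]
  let ?L = "sw H (H \<otimes> E) (\<lambda>a. sw H E (F a))"
  have "?L (sw H E (\<lambda>g v. sw H H (\<lambda>g1 g2. pure H (H \<otimes> E) g1 (pure H E g2 v)) (comult H g)) (qcoact E x)) =
    ?L (sw H E (\<lambda>g v. sw H E (\<lambda>g' w. pure H (H \<otimes> E) g (pure H E g' w)) (qcoact E v)) (qcoact E x))"
    using E_parts(1) by (simp add: is_yd_def tlift_to_sw)
  then show ?thesis by simp
qed

lemma coact_counit:
  assumes x [simp]: "x \<in> carr E" and f: "lin E kvs f"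
  shows "sw H E (\<lambda>g v. counit H g * f v) (qcoact E x) = f x"
proof -
  note [simp] = lin_comp[OF f]
  have s: "f (scl E c y) = c * f y" if "y \<in> carr E" for c y using f that by (simp add: lin_def)
  have "f (sw H E (\<lambda>g v. scl E (counit H g) v) (qcoact E x)) = f x"
    using E_parts(1) by (simp add: is_yd_def tlift_to_sw)
  then show ?thesis
    by (simp add: lin_sw[OF f] s)
qed

lemma yd_compat:
  assumes [simp]: "h \<in> carr H" "x \<in> carr E" and \<phi>: "bilin H E kvs \<phi>"
  shows "sw H H (\<lambda>h1 h2. sw H E (\<lambda>g w. \<phi> (prd H g h2) w) (qcoact E (qact E h1 x))) (comult H h) =
    sw H H (\<lambda>h1 h2. sw H E (\<lambda>g w. \<phi> (prd H h1 g) (qact E h2 w)) (qcoact E x)) (comult H h)"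
proof -
  note [simp] = bilinD1[OF \<phi>] bilinD2[OF \<phi>]
  have "sw H E \<phi> (sw H H (\<lambda>h1 h2. sw H E (\<lambda>g w. pure H E (prd H g h2) w) (qcoact E (qact E h1 x))) (comult H h)) =
    sw H E \<phi> (sw H H (\<lambda>h1 h2. sw H E (\<lambda>g w. pure H E (prd H h1 g) (qact E h2 w)) (qcoact E x)) (comult H h))"
    using E_parts(1) by (simp add: is_yd_def tlift_to_sw)
  then show ?thesis by simp
qed

text \<open>The diagonal action on \<open>E \<otimes> E\<close>.\<close>
definition act2 where "act2 = act (yd_pow2 H E)"

lemma act2_sw: "h \<in> carr H \<Longrightarrow> t \<in> carr (E \<otimes> E) \<Longrightarrow> act2 h t =
  sw E E (\<lambda>v w. sw H H (\<lambda>h1 h2. pure E E (qact E h1 v) (qact E h2 w)) (comult H h)) t"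
  by (simp add: act2_def yd_ops tlift_to_sw)

lemma act2_bilin: "bilin H (E \<otimes> E) (E \<otimes> E) act2"
  unfolding bilin_def
proof (intro conjI ballI)
  show "lin (E \<otimes> E) (E \<otimes> E) (act2 h)" if [simp]: "h \<in> carr H" for h
    by (rule lin_eq_on[of _ _ "\<lambda>t. sw E E (\<lambda>v w. sw H H (\<lambda>h1 h2. pure E E (qact E h1 v) (qact E h2 w)) (comult H h)) t"])
     (simp_all add: act2_sw)
  show "lin H (E \<otimes> E) (\<lambda>h. act2 h t)" if [simp]: "t \<in> carr (E \<otimes> E)" for t
    by (rule lin_eq_on[of _ _ "\<lambda>h. sw E E (\<lambda>v w. sw H H (\<lambda>h1 h2. pure E E (qact E h1 v) (qact E h2 w)) (comult H h)) t"])
     (simp_all add: act2_sw)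
qed

lemmas act2_simps [simp] = bilinD1[OF act2_bilin] bilinD2[OF act2_bilin] bilin_in[OF act2_bilin]

lemma act2_pure: "h \<in> carr H \<Longrightarrow> x \<in> carr E \<Longrightarrow> y \<in> carr E \<Longrightarrow>
   act2 h (pure E E x y) = sw H H (\<lambda>h1 h2. pure E E (qact E h1 x) (qact E h2 y)) (comult H h)"
  by (simp add: act2_sw sw_pure[of E E "E \<otimes> E"])

lemma act2_test:
  assumes [simp]: "h \<in> carr H" "t \<in> carr (E \<otimes> E)" and \<phi>: "bilin E E kvs \<phi>"
  shows "sw E E \<phi> (act2 h t) = sw H H (\<lambda>h1 h2. sw E E (\<lambda>v w. \<phi> (qact E h1 v) (qact E h2 w)) t) (comult H h)"
proof -
  note [simp] = bilinD1[OF \<phi>] bilinD2[OF \<phi>]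
  have "sw E E \<phi> (act2 h t) = sw E E (\<lambda>v w. sw H H (\<lambda>h1 h2. \<phi> (qact E h1 v) (qact E h2 w)) (comult H h)) t"
    by (simp add: act2_sw)
  then show ?thesis by (subst sw_swap)
qed

lemma act2_prd:
  assumes [simp]: "g \<in> carr H" "h \<in> carr H" "t \<in> carr (E \<otimes> E)"
  shows "act2 (prd H g h) t = act2 g (act2 h t)"
proof (rule tensor_eq_test)
  fix \<phi> :: "'e \<Rightarrow> 'e \<Rightarrow> 'k" assume \<phi>: "bilin E E kvs \<phi>"
  note [simp] = bilinD1[OF \<phi>] bilinD2[OF \<phi>]
  show "sw E E \<phi> (act2 (prd H g h) t) = sw E E \<phi> (act2 g (act2 h t))"
    using \<phi> by (simp add: act2_test comult_prd_H act_prd)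
qed simp_all

lemma comult_act_E:
  assumes [simp]: "h \<in> carr H" "x \<in> carr E" and \<phi>: "bilin E E kvs \<phi>"
  shows "sw E E \<phi> (comult E (qact E h x)) =
    sw H H (\<lambda>h1 h2. sw E E (\<lambda>x1 x2. \<phi> (qact E h1 x1) (qact E h2 x2)) (comult E x)) (comult H h)"
  using E_parts(3) act2_test[OF assms(1) _ \<phi>, of "comult E x"] by (simp add: yd_morphism_def act2_def)

lemma comult_coact_E:
  assumes [simp]: "x \<in> carr E" and F: "trilin H E E kvs F"
  shows "sw H E (\<lambda>g w. sw E E (\<lambda>w1 w2. F g w1 w2) (comult E w)) (qcoact E x) =
    sw E E (\<lambda>x1 x2. sw H E (\<lambda>g1 y1. sw H E (\<lambda>g2 y2. F (prd H g1 g2) y1 y2) (qcoact E x2)) (qcoact E x1)) (comult E x)"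
proof -
  note [simp] = trilinD[OF F]
  let ?L = "sw H (E \<otimes> E) (\<lambda>a. sw E E (F a))"
  have "sw E E (\<lambda>v w. sw H E (\<lambda>g v0. sw H E (\<lambda>g' w0. pure H (E \<otimes> E) (prd H g g') (pure E E v0 w0))
         (qcoact E w)) (qcoact E v)) (comult E x) =
     sw H E (\<lambda>g w. pure H (E \<otimes> E) g (comult E w)) (qcoact E x)"
    using E_parts(3) by (simp add: yd_morphism_def yd_ops tmap_def tlift_to_sw)
  from arg_cong[OF this, of ?L] show ?thesis by simp
qed

lemma counit_act_E [simp]: "h \<in> carr H \<Longrightarrow> x \<in> carr E \<Longrightarrow> counit E (qact E h x) = counit H h * counit E x"
  using E_parts(4) by (simp add: yd_morphism_def yd_ops)

lemma counit_coact_E: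
  assumes [simp]: "x \<in> carr E" and f: "lin H kvs f"
  shows "sw H E (\<lambda>g w. f g * counit E w) (qcoact E x) = f (unity H) * counit E x"
proof -
  note [simp] = lin_comp[OF f]
  have "pure H kvs (unity H) (counit E x) = sw H E (\<lambda>v w. pure H kvs v (counit E w)) (qcoact E x)"
    using E_parts(4) by (simp add: yd_morphism_def yd_ops tmap_def tlift_to_sw)
  from arg_cong[OF this, of "sw H kvs (\<lambda>g a. f g * a)"] show ?thesis by simp
qed

lemma act_prd_E:
  assumes [simp]: "h \<in> carr H" "x \<in> carr E" "y \<in> carr E" and f: "lin E kvs f"
  shows "f (qact E h (prd E x y)) = sw H H (\<lambda>h1 h2. f (prd E (qact E h1 x) (qact E h2 y))) (comult H h)"
proof -
  note [simp] = lin_comp[OF f]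
  have "qact E h (mult E (pure E E x y)) = mult E (act2 h (pure E E x y))"
    using E_parts(5) by (simp add: yd_morphism_def act2_def)
  also have "\<dots> = mult E (sw H H (\<lambda>h1 h2. pure E E (qact E h1 x) (qact E h2 y)) (comult H h))"
    by (simp add: act2_sw sw_pure[of E E "E \<otimes> E"])
  also have "\<dots> = sw H H (\<lambda>h1 h2. prd E (qact E h1 x) (qact E h2 y)) (comult H h)"
    by (simp add: lin_sw[OF lin_mult_E] prd_def)
  finally show ?thesis by (simp add: prd_def[symmetric] lin_sw[OF f])
qed

lemma act_unity_E:
  assumes [simp]: "h \<in> carr H"
  shows "qact E h (unity E) = scl E (counit H h) (unity E)"
proof -
  have "scl E (act (yd_unit H) h 1) (unity E) = qact E h (scl E 1 (unity E))"
    using E_parts(7) by (simp add: yd_morphism_def)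
  then show ?thesis by (simp add: yd_ops is_vs_simps(4)[OF E_simps'(1)])
qed

text \<open>A form is a morphism from \<open>E \<otimes> E\<close> to the unit object if it is invariant under the diagonal
  action and satisfies \<open>x\<^sub>-\<^sub>1 y\<^sub>-\<^sub>1 \<gamma>(x\<^sub>0 \<otimes> y\<^sub>0) = \<gamma>(x \<otimes> y) 1\<close>; the latter identity in \<open>H\<close> is
  stated after evaluation at a linear form \<open>\<alpha>\<close>.\<close>
lemma yd_form:
  assumes \<gamma>: "yd_morphism H (yd_pow2 H E) (yd_unit H) \<gamma>"
  shows "lin (E \<otimes> E) kvs \<gamma>"
    and "h \<in> carr H \<Longrightarrow> t \<in> carr (E \<otimes> E) \<Longrightarrow> \<gamma> (act2 h t) = counit H h * \<gamma> t"
    and "x \<in> carr E \<Longrightarrow> y \<in> carr E \<Longrightarrow> lin H kvs \<alpha> \<Longrightarrow>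
      sw H E (\<lambda>g v. sw H E (\<lambda>e w. \<alpha> (prd H g e) * \<gamma> (pure E E v w)) (qcoact E y)) (qcoact E x) = \<alpha> (unity H) * \<gamma> (pure E E x y)"
proof -
  show l: "lin (E \<otimes> E) kvs \<gamma>" and "h \<in> carr H \<Longrightarrow> t \<in> carr (E \<otimes> E) \<Longrightarrow> \<gamma> (act2 h t) = counit H h * \<gamma> t"
    using \<gamma> by (simp_all add: yd_morphism_def yd_ops(1) act2_def)
  note [simp] = lin_comp[OF l]
  assume [simp]: "x \<in> carr E" "y \<in> carr E" and \<alpha>: "lin H kvs \<alpha>"
  note [simp] = lin_comp[OF \<alpha>]
  let ?b = "\<lambda>v w. sw H E (\<lambda>g v0. sw H E (\<lambda>g' w0. pure H (E \<otimes> E) (prd H g g') (pure E E v0 w0)) (qcoact E w)) (qcoact E v)"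
  have b: "bilin E E (H \<otimes> (E \<otimes> E)) ?b" by simp
  have c: "coact (yd_pow2 H E) (pure E E x y) = ?b x y"
    by (simp add: yd_ops tlift_to_sw) (rule sw_pure[OF _ _ _ b], simp_all)
  have "pure H kvs (unity H) (\<gamma> (pure E E x y)) = tmap H (yd_pow2 H E) H (yd_unit H) (\<lambda>h. h) \<gamma> (?b x y)"
    using \<gamma> by (simp add: yd_morphism_def yd_ops(2) c[symmetric])
  also have "\<dots> = sw H (E \<otimes> E) (\<lambda>g u. pure H kvs g (\<gamma> u)) (?b x y)"
    by (simp add: tmap_def tlift_to_sw)
  finally have "sw H kvs (\<lambda>g a. \<alpha> g * a) (pure H kvs (unity H) (\<gamma> (pure E E x y))) =
     sw H kvs (\<lambda>g a. \<alpha> g * a) (sw H (E \<otimes> E) (\<lambda>g u. pure H kvs g (\<gamma> u)) (?b x y))" by simp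
  then show "sw H E (\<lambda>g v. sw H E (\<lambda>e w. \<alpha> (prd H g e) * \<gamma> (pure E E v w)) (qcoact E y)) (qcoact E x) = \<alpha> (unity H) * \<gamma> (pure E E x y)"
    by simp
qed

end

section \<open>The coalgebra underlying the bosonization\<close>

lemma carr_bos [simp]: "carr (bosonization H E) = carr (E \<otimes> H)" "scl (bosonization H E) = scl (E \<otimes> H)"
  by (simp_all add: bosonization_def Let_def)

lemmas bos_space [simp] = same_space[OF carr_bos] trilin_space[OF carr_bos]

context yd_setting
begin

abbreviation "A \<equiv> bosonization H E"

abbreviation "B \<equiv> E \<otimes> H"

lemma A_comult:
  shows A_comult_lin: "lin B (B \<otimes> B) (comult A)"
    and A_comult_pure: "x \<in> carr E \<Longrightarrow> h \<in> carr H \<Longrightarrow> bilin B B kvs \<Phi> \<Longrightarrow>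
      sw B B \<Phi> (comult A (pure E H x h)) =
      sw E E (\<lambda>x1 x2. sw H H (\<lambda>h1 h2. sw H E (\<lambda>g y. \<Phi> (pure E H x1 (prd H g h1)) (pure E H y h2))
        (qcoact E x2)) (comult H h)) (comult E x)"
proof -
  let ?b = "\<lambda>x h. sw E E (\<lambda>x1 x2. sw H H (\<lambda>h1 h2. sw H E (\<lambda>g y.
           pure B B (pure E H x1 (prd H g h1)) (pure E H y h2))
           (qcoact E x2)) (comult H h)) (comult E x)"
  have b: "bilin E H (B \<otimes> B) ?b" by simp
  have *: "comult A t = sw E H ?b t" if "t \<in> carr B" for t
    using that by (simp add: bosonization_def Let_def tlift_to_sw)
  show "lin B (B \<otimes> B) (comult A)"
    by (rule lin_eq_on[OF lin_sw_map[OF _ _ _ b]]) (simp_all add: *)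
  assume [simp]: "x \<in> carr E" "h \<in> carr H" and \<Phi>: "bilin B B kvs \<Phi>"
  note [simp] = bilinD1[OF \<Phi>] bilinD2[OF \<Phi>]
  have "comult A (pure E H x h) = ?b x h"
    by (simp add: *) (rule sw_pure[OF _ _ _ b], simp_all)
  then show "sw B B \<Phi> (comult A (pure E H x h)) =
      sw E E (\<lambda>x1 x2. sw H H (\<lambda>h1 h2. sw H E (\<lambda>g y. \<Phi> (pure E H x1 (prd H g h1)) (pure E H y h2))
        (qcoact E x2)) (comult H h)) (comult E x)"
    by simp
qed

lemma A_counit:
  shows A_counit_lin: "lin B kvs (counit A)"
    and A_counit_pure [simp]: "x \<in> carr E \<Longrightarrow> h \<in> carr H \<Longrightarrow> counit A (pure E H x h) = counit E x * counit H h"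
proof -
  have *: "counit A t = sw E H (\<lambda>x h. counit E x * counit H h) t" if "t \<in> carr B" for t
    using that by (simp add: bosonization_def Let_def tlift_to_sw)
  show "lin B kvs (counit A)"
    by (rule lin_eq_on[OF lin_sw_map[of E H kvs "\<lambda>x h. counit E x * counit H h"]]) (simp_all add: *)
  show "x \<in> carr E \<Longrightarrow> h \<in> carr H \<Longrightarrow> counit A (pure E H x h) = counit E x * counit H h"
    by (simp add: *)
qed

lemmas A_simps [simp] = lin_in[OF A_comult_lin] lin_comp[OF A_comult_lin] lin_comp[OF A_counit_lin]

text \<open>Both iterated coproducts of \<open>x#h\<close> equal
  \<open>(x\<^sup>1 # (x\<^sup>2)\<^sub>-\<^sub>1 (x\<^sup>3)\<^sub>-\<^sub>2 h\<^sub>1) \<otimes> ((x\<^sup>2)\<^sub>0 # (x\<^sup>3)\<^sub>-\<^sub>1 h\<^sub>2) \<otimes> ((x\<^sup>3)\<^sub>0 # h\<^sub>3)\<close>.  For the left one this follows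
  from the coassociativity of \<open>E\<close>, of the coaction and of \<open>H\<close>; for the right one from the colinearity of
  the coproduct of \<open>E\<close>.\<close>
lemma scalar_coalgebra_A: "scalar_coalgebra A"
proof -
  have "sw B B (\<lambda>a b. sw B B (\<lambda>a1 a2. F a1 a2 b) (comult A a)) (comult A t) =
      sw B B (\<lambda>a b. sw B B (\<lambda>b1 b2. F a b1 b2) (comult A b)) (comult A t)"
    if F: "trilin B B B kvs F" and t: "t \<in> carr B" for t F
  proof (rule tens_ext[OF _ _ is_vs_kvs _ _ _ t])
    note [simp] = trilinD[OF F]
    show "lin B kvs (\<lambda>t. sw B B (\<lambda>a b. sw B B (\<lambda>a1 a2. F a1 a2 b) (comult A a)) (comult A t))"
     "lin B kvs (\<lambda>t. sw B B (\<lambda>a b. sw B B (\<lambda>b1 b2. F a b1 b2) (comult A b)) (comult A t))"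
      by simp_all
    fix x h assume [simp]: "x \<in> carr E" "h \<in> carr H"
    let ?F = "\<lambda>x1 h1 x2 h2 x3 h3. F (pure E H x1 h1) (pure E H x2 h2) (pure E H x3 h3)"
    have "sw B B (\<lambda>a b. sw B B (\<lambda>a1 a2. F a1 a2 b) (comult A a)) (comult A (pure E H x h)) =
      sw E E (\<lambda>r t. sw H H (\<lambda>n m. sw H E (\<lambda>g v. sw E E (\<lambda>p q. sw H H (\<lambda>g1 g2. sw H H (\<lambda>k1 k2. sw H E (\<lambda>e w.
        ?F p (prd H e (prd H g1 k1)) w (prd H g2 k2) v m) (qcoact E q)) (comult H n)) (comult H g)) (comult E r)) (qcoact E t)) (comult H h)) (comult E x)"
      by (simp add: A_comult_pure comult_prd_H)
    also have "\<dots> = sw E E (\<lambda>r t. sw E E (\<lambda>p q. sw H E (\<lambda>g v. sw H H (\<lambda>g1 g2. sw H H (\<lambda>n m. sw H H (\<lambda>k1 k2. sw H E (\<lambda>e w.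
        ?F p (prd H e (prd H g1 k1)) w (prd H g2 k2) v m) (qcoact E q)) (comult H n)) (comult H h)) (comult H g)) (qcoact E t)) (comult E r)) (comult E x)"
      by (simp only: sw_swap[of H H E E] sw_swap[of H E E E] sw_swap[where V = H and W = H and X = H and Y = E and t = "comult H h"])
         (rule sw_cong1, rule sw_cong1, rule sw_cong1, rule sw_swap)
    also have "\<dots> = sw E E (\<lambda>p s. sw E E (\<lambda>q t. sw H E (\<lambda>g v. sw H H (\<lambda>g1 g2. sw H H (\<lambda>n m. sw H H (\<lambda>k1 k2. sw H E (\<lambda>e w.
        ?F p (prd H e (prd H g1 k1)) w (prd H g2 k2) v m) (qcoact E q)) (comult H n)) (comult H h)) (comult H g)) (qcoact E t)) (comult E s)) (comult E x)"
      by (rule coalg_coassoc[OF coalg_E]) simp_all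
    also have "\<dots> = sw E E (\<lambda>p s. sw E E (\<lambda>q t. sw H E (\<lambda>g1 v'. sw H E (\<lambda>g2 v. sw H H (\<lambda>n m. sw H H (\<lambda>k1 k2. sw H E (\<lambda>e w.
        ?F p (prd H e (prd H g1 k1)) w (prd H g2 k2) v m) (qcoact E q)) (comult H n)) (comult H h)) (qcoact E v')) (qcoact E t)) (comult E s)) (comult E x)"
      by (rule sw_cong1, rule sw_cong1, rule coact_coassoc) simp_all
    also have "\<dots> = sw E E (\<lambda>p s. sw E E (\<lambda>q t. sw H E (\<lambda>g1 v'. sw H E (\<lambda>g2 v. sw H H (\<lambda>k1 n. sw H H (\<lambda>k2 m. sw H E (\<lambda>e w.
        ?F p (prd H e (prd H g1 k1)) w (prd H g2 k2) v m) (qcoact E q)) (comult H n)) (comult H h)) (qcoact E v')) (qcoact E t)) (comult E s)) (comult E x)"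
      by (rule sw_cong1, rule sw_cong1, rule sw_cong1, rule sw_cong1, rule coalg_coassoc[OF coalg_H]) simp_all
    also have "\<dots> = sw E E (\<lambda>p s. sw E E (\<lambda>q t. sw H E (\<lambda>e w. sw H E (\<lambda>g1 v'.
       sw H H (\<lambda>k1 n. sw H H (\<lambda>k2 m. sw H E (\<lambda>g2 v.
        ?F p (prd H (prd H e g1) k1) w (prd H g2 k2) v m) (qcoact E v')) (comult H n)) (comult H h)) (qcoact E t)) (qcoact E q)) (comult E s)) (comult E x)"
      (is "_ = sw E E (\<lambda>p s. ?R p s) _")
    proof (rule sw_cong1)
      fix p s assume [simp]: "p \<in> carr E" "s \<in> carr E"
      show "sw E E (\<lambda>q t. sw H E (\<lambda>g1 v'. sw H E (\<lambda>g2 v. sw H H (\<lambda>k1 n. sw H H (\<lambda>k2 m. sw H E (\<lambda>e w.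
        ?F p (prd H e (prd H g1 k1)) w (prd H g2 k2) v m) (qcoact E q)) (comult H n)) (comult H h)) (qcoact E v')) (qcoact E t)) (comult E s) = ?R p s"
      proof (rule sw_cong1)
        fix q t assume [simp]: "q \<in> carr E" "t \<in> carr E"
        have "sw H E (\<lambda>g1 v'. sw H E (\<lambda>g2 v. sw H H (\<lambda>k1 n. sw H H (\<lambda>k2 m. sw H E (\<lambda>e w.
          ?F p (prd H e (prd H g1 k1)) w (prd H g2 k2) v m) (qcoact E q)) (comult H n)) (comult H h)) (qcoact E v')) (qcoact E t) =
          sw H E (\<lambda>g1 v'. sw H E (\<lambda>e w. sw H E (\<lambda>g2 v. sw H H (\<lambda>k1 n. sw H H (\<lambda>k2 m.
          ?F p (prd H e (prd H g1 k1)) w (prd H g2 k2) v m) (comult H n)) (comult H h)) (qcoact E v')) (qcoact E q)) (qcoact E t)"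
          by (simp only: sw_swap[of H H H E]) (rule sw_cong1, rule sw_swap)
        also have "\<dots> = sw H E (\<lambda>e w. sw H E (\<lambda>g1 v'. sw H E (\<lambda>g2 v. sw H H (\<lambda>k1 n. sw H H (\<lambda>k2 m.
          ?F p (prd H e (prd H g1 k1)) w (prd H g2 k2) v m) (comult H n)) (comult H h)) (qcoact E v')) (qcoact E t)) (qcoact E q)"
          by (rule sw_swap)
        finally show "sw H E (\<lambda>g1 v'. sw H E (\<lambda>g2 v. sw H H (\<lambda>k1 n. sw H H (\<lambda>k2 m. sw H E (\<lambda>e w.
          ?F p (prd H e (prd H g1 k1)) w (prd H g2 k2) v m) (qcoact E q)) (comult H n)) (comult H h)) (qcoact E v')) (qcoact E t) =
          sw H E (\<lambda>e w. sw H E (\<lambda>g1 v'.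
       sw H H (\<lambda>k1 n. sw H H (\<lambda>k2 m. sw H E (\<lambda>g2 v.
        ?F p (prd H (prd H e g1) k1) w (prd H g2 k2) v m) (qcoact E v')) (comult H n)) (comult H h)) (qcoact E t)) (qcoact E q)"
          by (simp add: sw_swap[of H H H E] prd_assoc)
      qed
    qed
    also have "\<dots> = sw E E (\<lambda>p s. sw H E (\<lambda>g v. sw E E (\<lambda>w v'. sw H H (\<lambda>k1 n. sw H H (\<lambda>k2 m. sw H E (\<lambda>g2 v.
        ?F p (prd H g k1) w (prd H g2 k2) v m) (qcoact E v')) (comult H n)) (comult H h)) (comult E v)) (qcoact E s)) (comult E x)"
      by (rule sw_cong1, rule comult_coact_E[symmetric]) simp_all
    also have "\<dots> = sw B B (\<lambda>a b. sw B B (\<lambda>b1 b2. F a b1 b2) (comult A b)) (comult A (pure E H x h))"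
      by (simp add: A_comult_pure sw_swap[of H H H E] sw_swap[of H H E E])
    finally show "sw B B (\<lambda>a b. sw B B (\<lambda>a1 a2. F a1 a2 b) (comult A a)) (comult A (pure E H x h)) =
      sw B B (\<lambda>a b. sw B B (\<lambda>b1 b2. F a b1 b2) (comult A b)) (comult A (pure E H x h))" .
  qed simp_all
  moreover have "sw B B (\<lambda>a b. counit A a * f b) (comult A t) = f t \<and>
      sw B B (\<lambda>a b. f a * counit A b) (comult A t) = f t"
    if f: "lin B kvs f" and t: "t \<in> carr B" for f t
  proof
    note [simp] = lin_comp[OF f]
    show "sw B B (\<lambda>a b. counit A a * f b) (comult A t) = f t"
    proof (rule tens_ext[OF _ _ is_vs_kvs _ f _ t])
      fix x h assume [simp]: "x \<in> carr E" "h \<in> carr H"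
      have "sw B B (\<lambda>a b. counit A a * f b) (comult A (pure E H x h)) =
        sw E E (\<lambda>x1 x2. counit E x1 * sw H H (\<lambda>h1 h2. counit H h1 * sw H E (\<lambda>g v. counit H g * f (pure E H v h2)) (qcoact E x2)) (comult H h)) (comult E x)"
        by (simp add: A_comult_pure sw_mult_left ac_simps)
      also have "\<dots> = f (pure E H x h)"
        by (simp add: coact_counit[of _ "\<lambda>v. f (pure E H v h)" for h] coalg_counit[OF coalg_H] coalg_counit[OF coalg_E, of _ "\<lambda>x. f (pure E H x h)"])
      finally show "sw B B (\<lambda>a b. counit A a * f b) (comult A (pure E H x h)) = f (pure E H x h)" .
    qed simp_all
    show "sw B B (\<lambda>a b. f a * counit A b) (comult A t) = f t"
    proof (rule tens_ext[OF _ _ is_vs_kvs _ f _ t])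
      fix x h assume [simp]: "x \<in> carr E" "h \<in> carr H"
      have "sw B B (\<lambda>a b. f a * counit A b) (comult A (pure E H x h)) =
        sw E E (\<lambda>x1 x2. sw H H (\<lambda>h1 h2. sw H E (\<lambda>g v. f (pure E H x1 (prd H g h1)) * counit E v) (qcoact E x2) * counit H h2) (comult H h)) (comult E x)"
        by (simp add: A_comult_pure sw_mult_right mult.assoc)
      also have "\<dots> = sw E E (\<lambda>x1 x2. sw H H (\<lambda>h1 h2. f (pure E H x1 h1) * counit H h2) (comult H h) * counit E x2) (comult E x)"
        by (simp add: counit_coact_E[of _ "\<lambda>g. f (pure E H x (prd H g h))" for x h]) (simp add: sw_mult_left sw_mult_right ac_simps)
      also have "\<dots> = f (pure E H x h)"
        by (simp add: coalg_counit[OF coalg_H] coalg_counit[OF coalg_E, of _ "\<lambda>x. f (pure E H x h)"])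
      finally show "sw B B (\<lambda>a b. f a * counit A b) (comult A (pure E H x h)) = f (pure E H x h)" .
    qed simp_all
  qed
  ultimately show ?thesis using A_comult_lin A_counit_lin by (simp add: scalar_coalgebra_def)
qed

end

section \<open>Coalgebra maps onto braided tensor products\<close>

text \<open>The record \<open>W\<close>, on the same space as \<open>F\<close>, supplies the action that the braiding of \<open>E\<close> with
  \<open>F\<close> is built from.\<close>
locale yd_module_coalgebra = yd_setting H E
  for H :: "('k::field, 'h::ab_group_add) hopf" and E :: "('k, 'h, 'e::ab_group_add) yd_cqb" +
  fixes W :: "('k, 'h, 'w::ab_group_add) yd" and F :: "('k, 'w, 'z) coalg_scheme"
  assumes W_space [simp]: "carr W = carr F" "scl W = scl F"
    and F_vs [simp]: "is_vs F"
    and comult_F_lin: "lin F (F \<otimes> F) (comult F)"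
    and counit_F_lin: "lin F kvs (counit F)"
    and act_F_bilin: "bilin H F F (act W)"
    and act_F_prd: "\<And>g h y. g \<in> carr H \<Longrightarrow> h \<in> carr H \<Longrightarrow> y \<in> carr F \<Longrightarrow>
      act W (prd H g h) y = act W g (act W h y)"
    and comult_act_F: "\<And>h y \<phi>. h \<in> carr H \<Longrightarrow> y \<in> carr F \<Longrightarrow> bilin F F kvs \<phi> \<Longrightarrow>
      sw F F \<phi> (comult F (act W h y)) =
      sw H H (\<lambda>h1 h2. sw F F (\<lambda>y1 y2. \<phi> (act W h1 y1) (act W h2 y2)) (comult F y)) (comult H h)"
    and counit_act_F [simp]: "\<And>h y. h \<in> carr H \<Longrightarrow> y \<in> carr F \<Longrightarrow> counit F (act W h y) = counit H h * counit F y"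

begin

lemmas F_simps [simp] = same_space[OF W_space] lin_in[OF comult_F_lin] lin_comp[OF comult_F_lin] lin_comp[OF counit_F_lin]
  bilinD1[OF act_F_bilin] bilinD2[OF act_F_bilin] bilin_in[OF act_F_bilin]

abbreviation "EF \<equiv> cotens (yd_braid H (ydob E) W) E F"

lemma braid:
  shows braid_lin: "lin (E \<otimes> F) (F \<otimes> E) (yd_braid H (ydob E) W)"
    and braid_pure: "x \<in> carr E \<Longrightarrow> y \<in> carr F \<Longrightarrow> bilin F E kvs \<phi> \<Longrightarrow>
      sw F E \<phi> (yd_braid H (ydob E) W (pure E F x y)) = sw H E (\<lambda>g v. \<phi> (act W g y) v) (qcoact E x)"
proof -
  let ?b = "\<lambda>v w. sw H E (\<lambda>g v0. pure F E (act W g w) v0) (qcoact E v)"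
  have b: "bilin E F (F \<otimes> E) ?b" by simp
  have *: "yd_braid H (ydob E) W t = sw E F ?b t" if "t \<in> carr (E \<otimes> F)" for t
    using that by (simp add: yd_braid_def tlift_to_sw)
  show "lin (E \<otimes> F) (F \<otimes> E) (yd_braid H (ydob E) W)"
    by (rule lin_eq_on[OF lin_sw_map[OF _ _ _ b]]) (simp_all add: *)
  assume [simp]: "x \<in> carr E" "y \<in> carr F" and \<Phi>: "bilin F E kvs \<phi>"
  note [simp] = bilinD1[OF \<Phi>] bilinD2[OF \<Phi>]
  have "yd_braid H (ydob E) W (pure E F x y) = ?b x y"
    by (simp add: *) (rule sw_pure[OF _ _ _ b], simp_all)
  then show "sw F E \<phi> (yd_braid H (ydob E) W (pure E F x y)) = sw H E (\<lambda>g v. \<phi> (act W g y) v) (qcoact E x)"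
    by simp
qed

lemma EF_comult_lin: "lin (E \<otimes> F) ((E \<otimes> F) \<otimes> (E \<otimes> F)) (comult EF)"
  using lin_id[of E] by (intro cotens_comult(1) braid_lin comult_F_lin) (auto intro: E_simps' H_simps)

lemma EF_comult:
  assumes [simp]: "x \<in> carr E" "y \<in> carr F" and \<Phi>: "bilin (E \<otimes> F) (E \<otimes> F) kvs \<Phi>"
  shows "sw (E \<otimes> F) (E \<otimes> F) \<Phi> (comult EF (pure E F x y)) =
    sw E E (\<lambda>x1 x2. sw F F (\<lambda>y1 y2. sw H E (\<lambda>g v. \<Phi> (pure E F x1 (act W g y1)) (pure E F v y2)) (qcoact E x2)) (comult F y)) (comult E x)"
proof -
  note [simp] = bilinD1[OF \<Phi>] bilinD2[OF \<Phi>]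
  show ?thesis
    by (subst cotens_comult(2)[OF _ _ F_vs comult_F_lin braid_lin])
      (use coalg_E \<Phi> in \<open>simp_all add: is_coalgebra_def braid_pure\<close>)
qed

lemma EF_counit:
  shows EF_counit_lin: "lin (E \<otimes> F) kvs (counit EF)"
    and EF_counit_pure: "x \<in> carr E \<Longrightarrow> y \<in> carr F \<Longrightarrow> counit EF (pure E F x y) = counit E x * counit F y"
  using cotens_counit[of E F, OF _ _ F_vs counit_F_lin] coalg_E by (auto simp: is_coalgebra_def)

text \<open>The map \<open>(x#h) \<otimes> d \<mapsto> x \<otimes> h \<pi>(d)\<close>.\<close>
definition spread where
  "spread D \<pi> = sw B D (\<lambda>s d. sw E H (\<lambda>x h. pure E F x (act W h (\<pi> d))) s)"

lemma spread:
  assumes [simp]: "is_vs D" and \<pi>: "lin D F \<pi>"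
  shows spread_lin: "lin (B \<otimes> D) (E \<otimes> F) (spread D \<pi>)"
    and spread_pure: "x \<in> carr E \<Longrightarrow> h \<in> carr H \<Longrightarrow> d \<in> carr D \<Longrightarrow>
      spread D \<pi> (pure B D (pure E H x h) d) = pure E F x (act W h (\<pi> d))"
proof -
  note [simp] = lin_comp[OF \<pi>] lin_in[OF \<pi>]
  have b: "bilin B D (E \<otimes> F) (\<lambda>s d. sw E H (\<lambda>x h. pure E F x (act W h (\<pi> d))) s)" by simp
  show "lin (B \<otimes> D) (E \<otimes> F) (spread D \<pi>)"
    unfolding spread_def by (rule lin_sw_map[OF _ _ _ b]) simp_all
  assume [simp]: "x \<in> carr E" "h \<in> carr H" "d \<in> carr D"
  show "spread D \<pi> (pure B D (pure E H x h) d) = pure E F x (act W h (\<pi> d))"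
    unfolding spread_def by (simp add: sw_pure[OF _ _ _ b] sw_pure[of E H "E \<otimes> F"])
qed

text \<open>Both sides evaluate to the sum of
  \<open>\<Phi>(x\<^sup>1 \<otimes> (x\<^sup>2)\<^sub>-\<^sub>1 h\<^sub>1 \<pi>(d\<^sub>1), (x\<^sup>2)\<^sub>0 \<otimes> h\<^sub>2 \<pi>(d\<^sub>2))\<close>.  On the side of \<open>E \<otimes> F\<close> the factor
  \<open>(x\<^sup>2)\<^sub>-\<^sub>1\<close> comes from the braiding, and \<open>h\<^sub>1\<close>, \<open>h\<^sub>2\<close> from the \<open>H\<close>-linearity of the coproduct
  of \<open>F\<close>; on the side of \<open>A \<otimes> D\<close> both come from the smash coproduct.\<close>
theorem coalg_map_spread:
  assumes D [simp]: "is_vs D" and D_comult: "lin D (D \<otimes> D) (comult D)" and D_counit: "lin D kvs (counit D)"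
    and \<pi>: "coalg_map D F \<pi>"
  shows "coalg_map (cotens (flip A D) A D) EF (spread D \<pi>)"
proof -
  have \<pi>_lin: "lin D F \<pi>" using \<pi> by (simp add: coalg_map_def)
  note [simp] = lin_comp[OF \<pi>_lin] lin_in[OF \<pi>_lin] lin_comp[OF D_comult] lin_in[OF D_comult] lin_comp[OF D_counit]
  note P = spread[OF D \<pi>_lin]
  note [simp] = lin_comp[OF P(1)] lin_in[OF P(1)] P(2)
  let ?C = "cotens (flip A D) A D" and ?P = "spread D \<pi>"
  have flip: "lin (A \<otimes> D) (D \<otimes> A) (flip A D)" by (rule flip_lin) simp_all
  have C_lin: "lin (B \<otimes> D) ((B \<otimes> D) \<otimes> (B \<otimes> D)) (comult ?C)"
    using cotens_comult(1)[OF _ _ D D_comult flip] A_comult_lin by simp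
  have "counit EF (?P t) = counit ?C t" if t: "t \<in> carr (B \<otimes> D)" for t
    using that
  proof (rule lin_ext3[rotated 7])
    show "lin (B \<otimes> D) kvs (\<lambda>t. counit EF (?P t))" by (rule lin_comp[OF EF_counit_lin P(1)])
    show "lin (B \<otimes> D) kvs (counit ?C)"
      using cotens_counit(1)[OF _ _ D D_counit, of A "flip A D"] A_counit_lin by simp
    fix x h d assume [simp]: "x \<in> carr E" "h \<in> carr H" "d \<in> carr D"
    have "counit F (\<pi> d) = counit D d" using \<pi> by (simp add: coalg_map_def)
    then show "counit EF (?P (pure B D (pure E H x h) d)) = counit ?C (pure B D (pure E H x h) d)"
      using cotens_counit(2)[OF _ _ D D_counit, of A "pure E H x h" d "flip A D"] A_counit_lin
      by (simp add: EF_counit_pure)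
  qed simp_all
  moreover have "sw (E \<otimes> F) (E \<otimes> F) \<Phi> (comult EF (?P t)) = sw (B \<otimes> D) (B \<otimes> D) (\<lambda>u v. \<Phi> (?P u) (?P v)) (comult ?C t)"
    if t: "t \<in> carr (B \<otimes> D)" and \<Phi>: "bilin (E \<otimes> F) (E \<otimes> F) kvs \<Phi>" for t \<Phi>
    using t
  proof (rule lin_ext3[rotated 7])
    note [simp] = bilinD1[OF \<Phi>] bilinD2[OF \<Phi>]
    show "lin (B \<otimes> D) kvs (\<lambda>t. sw (E \<otimes> F) (E \<otimes> F) \<Phi> (comult EF (?P t)))"
      by (simp add: lin_comp[OF EF_comult_lin])
    show "lin (B \<otimes> D) kvs (\<lambda>t. sw (B \<otimes> D) (B \<otimes> D) (\<lambda>u v. \<Phi> (?P u) (?P v)) (comult ?C t))"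
      by (simp add: lin_comp[OF C_lin])
    fix x h d assume [simp]: "x \<in> carr E" "h \<in> carr H" "d \<in> carr D"
    have \<pi>d: "sw F F \<phi> (comult F (\<pi> d)) = sw D D (\<lambda>u v. \<phi> (\<pi> u) (\<pi> v)) (comult D d)" if "bilin F F kvs \<phi>" for \<phi>
      using \<pi> that by (simp add: coalg_map_def)
    have "sw (E \<otimes> F) (E \<otimes> F) \<Phi> (comult EF (?P (pure B D (pure E H x h) d))) =
      sw E E (\<lambda>x1 x2. sw H H (\<lambda>h1 h2. sw D D (\<lambda>d1 d2. sw H E (\<lambda>g v.
        \<Phi> (pure E F x1 (act W g (act W h1 (\<pi> d1)))) (pure E F v (act W h2 (\<pi> d2)))) (qcoact E x2)) (comult D d)) (comult H h)) (comult E x)"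
      by (simp add: EF_comult \<Phi> comult_act_F \<pi>d)
    moreover have "sw (B \<otimes> D) (B \<otimes> D) (\<lambda>u v. \<Phi> (?P u) (?P v)) (comult ?C (pure B D (pure E H x h) d)) =
      sw E E (\<lambda>x1 x2. sw H H (\<lambda>h1 h2. sw H E (\<lambda>g v. sw D D (\<lambda>d1 d2.
        \<Phi> (pure E F x1 (act W g (act W h1 (\<pi> d1)))) (pure E F v (act W h2 (\<pi> d2)))) (comult D d)) (qcoact E x2)) (comult H h)) (comult E x)"
      using cotens_flip_comult[of A D "pure E H x h" d "\<lambda>u v. \<Phi> (?P u) (?P v)"] A_comult_lin D_comult
      by (simp add: A_comult_pure act_F_prd)
    ultimately show "sw (E \<otimes> F) (E \<otimes> F) \<Phi> (comult EF (?P (pure B D (pure E H x h) d))) =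
      sw (B \<otimes> D) (B \<otimes> D) (\<lambda>u v. \<Phi> (?P u) (?P v)) (comult ?C (pure B D (pure E H x h) d))"
      by (simp add: sw_swap[of H E D D])
  qed simp_all
  ultimately show ?thesis using P(1) by (simp add: coalg_map_def)
qed

end

context yd_setting
begin

lemma module_coalgebra_E: "yd_module_coalgebra H E (ydob E) E"
  by unfold_locales (use coalg_E in \<open>auto simp: act_prd comult_act_E is_coalgebra_def act_bilin\<close>)

sublocale E1: yd_module_coalgebra H E "ydob E" E
  rewrites "cotens (yd_braid H (ydob E) (ydob E)) E E = yd_copow2 H E"
    and "act (ydob E) = qact E"
  using module_coalgebra_E by (simp_all add: yd_copow2_def)

lemmas E1_ext [simp] = lin_in[OF E1.EF_comult_lin] lin_comp[OF E1.EF_comult_lin] lin_comp[OF E1.EF_counit_lin]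

text \<open>The coproduct of \<open>h\<^sub>1 x \<otimes> h\<^sub>2 y\<close> contains the coaction of \<open>h\<^sub>2 x\<^sup>2\<close> multiplied by \<open>h\<^sub>3\<close> on the
  right.  The Yetter-Drinfeld condition moves these two components of \<open>h\<close> to the other side,
  \<open>(h\<^sub>2 v)\<^sub>-\<^sub>1 h\<^sub>3 \<otimes> (h\<^sub>2 v)\<^sub>0 = h\<^sub>2 v\<^sub>-\<^sub>1 \<otimes> h\<^sub>3 v\<^sub>0\<close>, after which the diagonal action is visible.\<close>
lemma comult_act2:
  assumes h [simp]: "h \<in> carr H" and t: "t \<in> carr (E \<otimes> E)" and \<Phi>: "bilin (E \<otimes> E) (E \<otimes> E) kvs \<Phi>"
  shows "sw (E \<otimes> E) (E \<otimes> E) \<Phi> (comult (yd_copow2 H E) (act2 h t)) =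
    sw H H (\<lambda>h1 h2. sw (E \<otimes> E) (E \<otimes> E) (\<lambda>u v. \<Phi> (act2 h1 u) (act2 h2 v)) (comult (yd_copow2 H E) t)) (comult H h)"
proof (rule tens_ext[OF _ _ _ _ _ _ t])
  note [simp] = bilinD1[OF \<Phi>] bilinD2[OF \<Phi>]
  show "lin (E \<otimes> E) kvs (\<lambda>t. sw (E \<otimes> E) (E \<otimes> E) \<Phi> (comult (yd_copow2 H E) (act2 h t)))"
   "lin (E \<otimes> E) kvs (\<lambda>t. sw H H (\<lambda>h1 h2. sw (E \<otimes> E) (E \<otimes> E) (\<lambda>u v. \<Phi> (act2 h1 u) (act2 h2 v)) (comult (yd_copow2 H E) t)) (comult H h))"
    by simp_all
  fix x y assume [simp]: "x \<in> carr E" "y \<in> carr E"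
  have "sw (E \<otimes> E) (E \<otimes> E) \<Phi> (comult (yd_copow2 H E) (act2 h (pure E E x y))) =
    sw H H (\<lambda>u w. sw (E \<otimes> E) (E \<otimes> E) \<Phi> (comult (yd_copow2 H E) (pure E E (qact E u x) (qact E w y)))) (comult H h)"
    by (simp add: act2_pure lin_sw[OF E1.EF_comult_lin])
  also have "\<dots> = sw H H (\<lambda>u w. sw H H (\<lambda>a b. sw E E (\<lambda>x1 x2. sw H H (\<lambda>c d.
       sw E E (\<lambda>y1 y2. sw H E (\<lambda>g v. \<Phi> (pure E E (qact E a x1) (qact E (prd H g c) y1)) (pure E E v (qact E d y2))) (qcoact E (qact E b x2)))
        (comult E y)) (comult H w)) (comult E x)) (comult H u)) (comult H h)"
    by (simp add: E1.EF_comult \<Phi> comult_act_E act_prd)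
  also have "\<dots> = sw H H (\<lambda>u w. sw H H (\<lambda>a b. sw H H (\<lambda>c d. sw E E (\<lambda>x1 x2.
       sw E E (\<lambda>y1 y2. sw H E (\<lambda>g v. \<Phi> (pure E E (qact E a x1) (qact E (prd H g c) y1)) (pure E E v (qact E d y2))) (qcoact E (qact E b x2)))
        (comult E y)) (comult E x)) (comult H w)) (comult H u)) (comult H h)"
    by (simp only: sw_swap[of E E H H])
  also have "\<dots> = sw H H (\<lambda>a r. sw H H (\<lambda>m d. sw H H (\<lambda>b c. sw E E (\<lambda>x1 x2.
       sw E E (\<lambda>y1 y2. sw H E (\<lambda>g v. \<Phi> (pure E E (qact E a x1) (qact E (prd H g c) y1)) (pure E E v (qact E d y2))) (qcoact E (qact E b x2)))
        (comult E y)) (comult E x)) (comult H m)) (comult H r)) (comult H h)"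
    by (rule coassoc_middle_H) simp_all
  also have "\<dots> = sw H H (\<lambda>a r. sw H H (\<lambda>m d. sw E E (\<lambda>x1 x2. sw E E (\<lambda>y1 y2. sw H H (\<lambda>b c.
       sw H E (\<lambda>g v. \<Phi> (pure E E (qact E a x1) (qact E (prd H g c) y1)) (pure E E v (qact E d y2))) (qcoact E (qact E b x2)))
         (comult H m)) (comult E y)) (comult E x)) (comult H r)) (comult H h)"
    by (simp only: sw_swap[of H H E E])
  also have "\<dots> = sw H H (\<lambda>a r. sw H H (\<lambda>m d. sw E E (\<lambda>x1 x2. sw E E (\<lambda>y1 y2. sw H H (\<lambda>b c.
       sw H E (\<lambda>g v. \<Phi> (pure E E (qact E a x1) (qact E (prd H b g) y1)) (pure E E (qact E c v) (qact E d y2))) (qcoact E x2))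
         (comult H m)) (comult E y)) (comult E x)) (comult H r)) (comult H h)"
    by (rule sw_cong1, rule sw_cong1, rule sw_cong1, rule sw_cong1, rule yd_compat) simp_all
  also have "\<dots> = sw H H (\<lambda>a r. sw H H (\<lambda>m d. sw H H (\<lambda>b c. sw E E (\<lambda>x1 x2. sw E E (\<lambda>y1 y2.
       sw H E (\<lambda>g v. \<Phi> (pure E E (qact E a x1) (qact E (prd H b g) y1)) (pure E E (qact E c v) (qact E d y2))) (qcoact E x2))
         (comult E y)) (comult E x)) (comult H m)) (comult H r)) (comult H h)"
    by (simp only: sw_swap[of H H E E])
  also have "\<dots> = sw H H (\<lambda>u w. sw H H (\<lambda>a b. sw H H (\<lambda>c d. sw E E (\<lambda>x1 x2. sw E E (\<lambda>y1 y2.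
       sw H E (\<lambda>g v. \<Phi> (pure E E (qact E a x1) (qact E (prd H b g) y1)) (pure E E (qact E c v) (qact E d y2))) (qcoact E x2))
         (comult E y)) (comult E x)) (comult H w)) (comult H u)) (comult H h)"
    by (rule coassoc_middle_H[symmetric]) simp_all
  also have "\<dots> = sw H H (\<lambda>h1 h2. sw E E (\<lambda>x1 x2. sw E E (\<lambda>y1 y2. sw H E (\<lambda>g v. sw H H (\<lambda>a b. sw H H (\<lambda>c d.
       \<Phi> (pure E E (qact E a x1) (qact E b (qact E g y1))) (pure E E (qact E c v) (qact E d y2))) (comult H h2)) (comult H h1))
        (qcoact E x2)) (comult E y)) (comult E x)) (comult H h)"
    by (simp add: sw_swap[of H H E E] sw_swap[of H H H E] act_prd)
  also have "\<dots> = sw H H (\<lambda>h1 h2. sw E E (\<lambda>x1 x2. sw E E (\<lambda>y1 y2. sw H E (\<lambda>g v. sw H H (\<lambda>c d. sw H H (\<lambda>a b.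
       \<Phi> (pure E E (qact E a x1) (qact E b (qact E g y1))) (pure E E (qact E c v) (qact E d y2))) (comult H h1)) (comult H h2))
        (qcoact E x2)) (comult E y)) (comult E x)) (comult H h)"
    by (rule sw_cong1, rule sw_cong1, rule sw_cong1, rule sw_cong1, rule sw_swap)
  also have "\<dots> = sw H H (\<lambda>h1 h2. sw (E \<otimes> E) (E \<otimes> E) (\<lambda>u v. \<Phi> (act2 h1 u) (act2 h2 v)) (comult (yd_copow2 H E) (pure E E x y))) (comult H h)"
    by (simp add: E1.EF_comult act2_pure lin_sw[of "E \<otimes> E" kvs "\<lambda>u. \<Phi> u v" for v] lin_sw[of "E \<otimes> E" kvs "\<lambda>v. \<Phi> u v" for u])
  finally show "sw (E \<otimes> E) (E \<otimes> E) \<Phi> (comult (yd_copow2 H E) (act2 h (pure E E x y))) =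
     sw H H (\<lambda>h1 h2. sw (E \<otimes> E) (E \<otimes> E) (\<lambda>u v. \<Phi> (act2 h1 u) (act2 h2 v)) (comult (yd_copow2 H E) (pure E E x y))) (comult H h)" .
qed simp_all

lemma counit_act2:
  assumes h [simp]: "h \<in> carr H" and t: "t \<in> carr (E \<otimes> E)"
  shows "counit (yd_copow2 H E) (act2 h t) = counit H h * counit (yd_copow2 H E) t"
proof (rule tens_ext[OF _ _ is_vs_kvs _ _ _ t])
  fix x y assume [simp]: "x \<in> carr E" "y \<in> carr E"
  have "counit (yd_copow2 H E) (act2 h (pure E E x y)) = sw H H (\<lambda>h1 h2. counit H h1 * (counit H h2 * (counit E x * counit E y))) (comult H h)"
    by (simp add: act2_pure lin_sw[OF E1.EF_counit_lin] E1.EF_counit_pure ac_simps)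
  also have "\<dots> = counit H h * (counit E x * counit E y)"
    by (rule coalg_counit(1)[OF coalg_H h]) simp
  finally show "counit (yd_copow2 H E) (act2 h (pure E E x y)) = counit H h * counit (yd_copow2 H E) (pure E E x y)"
    by (simp add: E1.EF_counit_pure)
qed simp_all

lemma module_coalgebra_E2: "yd_module_coalgebra H E (yd_pow2 H E) (yd_copow2 H E)"
  by unfold_locales (simp_all add: act2_def[symmetric] act2_bilin act2_prd comult_act2 counit_act2
    E1.EF_comult_lin E1.EF_counit_lin)

sublocale E2: yd_module_coalgebra H E "yd_pow2 H E" "yd_copow2 H E"
  rewrites "cotens (yd_braid H (ydob E) (yd_pow2 H E)) E (yd_copow2 H E) = yd_copow3 H E"
    and "act (yd_pow2 H E) = act2"
  using module_coalgebra_E2 by (simp_all add: yd_copow3_def act2_def)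

text \<open>The map \<open>x#h \<mapsto> x \<epsilon>(h)\<close>, from which \<open>\<pi>\<^sub>2\<close> and \<open>\<pi>\<^sub>3\<close> arise by successive
  applications of \<^const>\<open>E1.spread\<close> and \<^const>\<open>E2.spread\<close>.\<close>
definition pi1 where "pi1 = sw E H (\<lambda>x h. scl E (counit H h) x)"

lemma pi1:
  shows pi1_lin: "lin B E pi1"
    and pi1_pure: "x \<in> carr E \<Longrightarrow> h \<in> carr H \<Longrightarrow> pi1 (pure E H x h) = scl E (counit H h) x"
proof -
  have b: "bilin E H E (\<lambda>x h. scl E (counit H h) x)" by simp
  show "lin B E pi1"
    unfolding pi1_def by (rule lin_sw_map[OF _ _ _ b]) simp_all
  show "x \<in> carr E \<Longrightarrow> h \<in> carr H \<Longrightarrow> pi1 (pure E H x h) = scl E (counit H h) x"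
    unfolding pi1_def by (simp add: sw_pure[OF _ _ _ b])
qed

lemmas pi1_simps [simp] = lin_in[OF pi1_lin] lin_comp[OF pi1_lin]

lemma coalg_map_pi1: "coalg_map A E pi1"
proof -
  have cc: "lin E kvs (counit E)" by simp
  have "counit E (pi1 t) = counit A t" if t: "t \<in> carr B" for t
    by (rule tens_ext[OF _ _ _ _ _ _ t, of kvs])
      (simp_all add: A_counit_lin pi1_pure lin_scl_apply[OF cc])
  moreover have "sw E E \<Phi> (comult E (pi1 t)) = sw B B (\<lambda>u v. \<Phi> (pi1 u) (pi1 v)) (comult A t)"
    if t: "t \<in> carr B" and \<Phi>: "bilin E E kvs \<Phi>" for t \<Phi>
  proof (rule tens_ext[OF _ _ _ _ _ _ t])
    note [simp] = bilinD1[OF \<Phi>] bilinD2[OF \<Phi>]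
    have s1: "\<Phi> (scl E a x) y = a * \<Phi> x y" if "x \<in> carr E" "y \<in> carr E" for a x y
      using that by (intro lin_scl_apply) auto
    have s2: "\<Phi> y (scl E a x) = a * \<Phi> y x" if "x \<in> carr E" "y \<in> carr E" for a x y
      using that by (intro lin_scl_apply) auto
    show "lin B kvs (\<lambda>t. sw E E \<Phi> (comult E (pi1 t)))"
      "lin B kvs (\<lambda>t. sw B B (\<lambda>u v. \<Phi> (pi1 u) (pi1 v)) (comult A t))"
      by simp_all
    fix x h assume [simp]: "x \<in> carr E" "h \<in> carr H"
    have "sw E E \<Phi> (comult E (pi1 (pure E H x h))) = counit H h * sw E E \<Phi> (comult E x)"
      by (subst pi1_pure) (simp_all add: lin_scl_apply[of E "\<lambda>x. sw E E \<Phi> (comult E x)"])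
    moreover have "sw B B (\<lambda>u v. \<Phi> (pi1 u) (pi1 v)) (comult A (pure E H x h)) =
      sw H H (\<lambda>h1 h2. counit H h1 * (counit H h2 * sw E E (\<lambda>x1 x2. sw H E (\<lambda>g v. counit H g * \<Phi> x1 v) (qcoact E x2)) (comult E x))) (comult H h)"
      by (simp add: A_comult_pure pi1_pure s1 s2 sw_swap[of E E H H] sw_mult_left ac_simps)
    ultimately show "sw E E \<Phi> (comult E (pi1 (pure E H x h))) = sw B B (\<lambda>u v. \<Phi> (pi1 u) (pi1 v)) (comult A (pure E H x h))"
      by (simp add: coact_counit coalg_counit[OF coalg_H])
  qed simp_all
  ultimately show ?thesis by (simp add: coalg_map_def pi1_lin)
qed

definition "pi2 = E1.spread A pi1"

definition "pi3 = E2.spread (copow2 A) pi2"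

lemma A_copow_lin: "lin (B \<otimes> B) ((B \<otimes> B) \<otimes> (B \<otimes> B)) (comult (copow2 A))"
    "lin (B \<otimes> B) kvs (counit (copow2 A))"
    "lin (B \<otimes> B \<otimes> B) ((B \<otimes> B \<otimes> B) \<otimes> (B \<otimes> B \<otimes> B)) (comult (copow3 A))"
  and scalar_coalgebra_copow2_A: "scalar_coalgebra (copow2 A)"
proof -
  show 1: "scalar_coalgebra (copow2 A)" unfolding copow2_def by (intro scalar_coalgebra_cotens_flip scalar_coalgebra_A)
  have "scalar_coalgebra (copow3 A)" unfolding copow3_def by (intro scalar_coalgebra_cotens_flip scalar_coalgebra_A 1)
  then show "lin (B \<otimes> B) ((B \<otimes> B) \<otimes> (B \<otimes> B)) (comult (copow2 A))"
    "lin (B \<otimes> B) kvs (counit (copow2 A))"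
    "lin (B \<otimes> B \<otimes> B) ((B \<otimes> B \<otimes> B) \<otimes> (B \<otimes> B \<otimes> B)) (comult (copow3 A))"
    using scalar_coalgebraD(2,3)[OF 1] scalar_coalgebraD(2)[of "copow3 A"] by simp_all
qed

lemmas A_copow_simps [simp] = lin_in[OF A_copow_lin(1)] lin_comp[OF A_copow_lin(1)] lin_comp[OF A_copow_lin(2)]
  lin_in[OF A_copow_lin(3)] lin_comp[OF A_copow_lin(3)]

lemma pi2_lin: "lin (B \<otimes> B) (E \<otimes> E) pi2"
  using E1.spread_lin[of A pi1] pi1_lin by (simp add: pi2_def)

lemmas pi2_simps [simp] = lin_in[OF pi2_lin] lin_comp[OF pi2_lin]

lemma coalg_map_pi2: "coalg_map (copow2 A) (yd_copow2 H E) pi2"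
  unfolding pi2_def copow2_def by (rule E1.coalg_map_spread) (simp_all add: A_comult_lin A_counit_lin coalg_map_pi1)

lemma pi2_pure:
  assumes [simp]: "x \<in> carr E" "h \<in> carr H" "y \<in> carr E" "l \<in> carr H"
  shows "pi2 (pure B B (pure E H x h) (pure E H y l)) = pure E E x (qact E h (scl E (counit H l) y))"
  using E1.spread_pure[of A pi1] pi1_lin by (simp add: pi2_def pi1_pure)

lemma form_pi2:
  assumes \<psi>: "lin (E \<otimes> E) kvs \<psi>" and [simp]: "x \<in> carr E" "h \<in> carr H" "y \<in> carr E" "l \<in> carr H"
  shows "\<psi> (pi2 (pure B B (pure E H x h) (pure E H y l))) = \<psi> (pure E E x (qact E h y)) * counit H l"
proof -
  have "lin E kvs (\<lambda>y. \<psi> (pure E E x (qact E h y)))" by (rule lin_comp[OF \<psi>]) simp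
  from lin_scl_apply[OF this] show ?thesis by (simp add: pi2_pure)
qed

lemma pi3_lin: "lin (B \<otimes> B \<otimes> B) (E \<otimes> E \<otimes> E) pi3"
  using E2.spread_lin[of "copow2 A" pi2] pi2_lin by (simp add: pi3_def)

lemmas pi3_simps [simp] = lin_in[OF pi3_lin] lin_comp[OF pi3_lin]

lemma coalg_map_pi3: "coalg_map (copow3 A) (yd_copow3 H E) pi3"
  unfolding pi3_def copow3_def by (rule E2.coalg_map_spread) (simp_all add: A_copow_lin coalg_map_pi2)

lemma form_pi3:
  assumes \<psi>: "lin (E \<otimes> E \<otimes> E) kvs \<psi>" and [simp]: "r \<in> carr E" "h \<in> carr H" "s \<in> carr E" "l \<in> carr H" "t \<in> carr E" "k \<in> carr H"
  shows "\<psi> (pi3 (pure3 B (pure E H r h) (pure E H s l) (pure E H t k))) =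
    sw H H (\<lambda>h1 h2. \<psi> (pure3 E r (qact E h1 s) (qact E h2 (qact E l t)))) (comult H h) * counit H k"
proof -
  have *: "lin (E \<otimes> E) kvs (\<lambda>u. \<psi> (pure E (E \<otimes> E) r (act2 h u)))" by (rule lin_comp[OF \<psi>]) simp
  have **: "lin (E \<otimes> E) kvs (\<lambda>u. \<psi> (pure E (E \<otimes> E) r u))" by (rule lin_comp[OF \<psi>]) simp
  have "\<psi> (pi3 (pure3 B (pure E H r h) (pure E H s l) (pure E H t k))) =
     \<psi> (pure E (E \<otimes> E) r (act2 h (pi2 (pure B B (pure E H s l) (pure E H t k)))))"
    using E2.spread_pure[of "copow2 A" pi2] pi2_lin by (simp add: pi3_def pure3_def)
  also have "\<dots> = \<psi> (pure E (E \<otimes> E) r (act2 h (pure E E s (qact E l t)))) * counit H k"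
    using form_pi2[OF *, of s l t k] by simp
  also have "\<psi> (pure E (E \<otimes> E) r (act2 h (pure E E s (qact E l t)))) =
     sw H H (\<lambda>h1 h2. \<psi> (pure3 E r (qact E h1 s) (qact E h2 (qact E l t)))) (comult H h)"
    by (simp add: act2_pure lin_sw[OF **] pure3_def)
  finally show ?thesis .
qed

lemma EF_lins: "lin (E \<otimes> E) ((E \<otimes> E) \<otimes> (E \<otimes> E)) (comult (yd_copow2 H E))"
  "lin (E \<otimes> E \<otimes> E) ((E \<otimes> E \<otimes> E) \<otimes> (E \<otimes> E \<otimes> E)) (comult (yd_copow3 H E))"
  using E1.EF_comult_lin E2.EF_comult_lin by simp_all

section \<open>The product of a modified bosonization\<close>

text \<open>The extension \<open>(x#h) \<otimes> (y#l) \<mapsto> f(x \<otimes> h\<^sub>1 y) # h\<^sub>2 l\<close>, which is the product of \<open>E#H\<close> if \<open>f\<close> is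
  the product of \<open>E\<close>.\<close>
definition boson_ext where
  "boson_ext f = sw B B (\<lambda>s s'. sw E H (\<lambda>x h. sw E H (\<lambda>x' h'.
     sw H H (\<lambda>h1 h2. pure E H (f (pure E E x (qact E h1 x'))) (prd H h2 h')) (comult H h)) s') s)"

lemma boson_ext:
  assumes f: "lin (E \<otimes> E) E f"
  shows boson_ext_lin: "lin (B \<otimes> B) B (boson_ext f)"
    and boson_ext_test: "x \<in> carr E \<Longrightarrow> h \<in> carr H \<Longrightarrow> y \<in> carr E \<Longrightarrow> l \<in> carr H \<Longrightarrow> bilin E H kvs \<phi> \<Longrightarrow>
     sw E H \<phi> (boson_ext f (pure B B (pure E H x h) (pure E H y l))) =
     sw H H (\<lambda>h1 h2. \<phi> (f (pure E E x (qact E h1 y))) (prd H h2 l)) (comult H h)"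
proof -
  note [simp] = lin_in[OF f] lin_comp[OF f]
  have b: "bilin B B B (\<lambda>s s'. sw E H (\<lambda>x h. sw E H (\<lambda>x' h'.
     sw H H (\<lambda>h1 h2. pure E H (f (pure E E x (qact E h1 x'))) (prd H h2 h')) (comult H h)) s') s)"
    by simp
  show "lin (B \<otimes> B) B (boson_ext f)"
    unfolding boson_ext_def by (rule lin_sw_map[OF _ _ _ b]) simp_all
  assume [simp]: "x \<in> carr E" "h \<in> carr H" "y \<in> carr E" "l \<in> carr H" and \<phi>: "bilin E H kvs \<phi>"
  note [simp] = bilinD1[OF \<phi>] bilinD2[OF \<phi>]
  show "sw E H \<phi> (boson_ext f (pure B B (pure E H x h) (pure E H y l))) =
     sw H H (\<lambda>h1 h2. \<phi> (f (pure E E x (qact E h1 y))) (prd H h2 l)) (comult H h)"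
    unfolding boson_ext_def by (simp add: sw_pure[OF _ _ _ b])
qed

text \<open>The first convolution factor is
  \<open>\<psi>(x\<^sup>1 \<otimes> (x\<^sup>2)\<^sub>-\<^sub>1 h\<^sub>1 y\<^sup>1) \<epsilon>((y\<^sup>2)\<^sub>-\<^sub>1 l\<^sub>1)\<close>: the coaction of \<open>y\<^sup>2\<close> is removed by the counit,
  and that of \<open>x\<^sup>2\<close> acts on \<open>y\<^sup>1\<close> as in the braided coproduct of \<open>E \<otimes> E\<close>.\<close>
lemma conv_boson_ext_left:
  assumes f: "lin (E \<otimes> E) E f" and \<psi>: "lin (E \<otimes> E) kvs \<psi>" and t: "t \<in> carr (B \<otimes> B)"
  shows "conv (scl B) (copow2 A) (\<lambda>u. \<psi> (pi2 u)) (boson_ext f) t = boson_ext (conv (scl E) (yd_copow2 H E) \<psi> f) t"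
  (is "?l t = ?r t")
proof (rule lin_ext4[OF _ _ _ _ _ _ _ _ t])
  have fg: "lin (E \<otimes> E) E (conv (scl E) (yd_copow2 H E) \<psi> f)"
    using lin_conv[of "yd_copow2 H E" E kvs E "scl E"] EF_lins f \<psi> by (simp add: bilin_scl)
  have c: "lin (B \<otimes> B) kvs (\<lambda>u. \<psi> (pi2 u))" by (rule lin_comp[OF \<psi> pi2_lin])
  show ll: "lin (B \<otimes> B) B ?l"
    using lin_conv[of "copow2 A" "E \<otimes> H" kvs "E \<otimes> H" "scl B"] A_copow_lin c boson_ext_lin[OF f]
    by (simp add: bilin_scl)
  show lr: "lin (B \<otimes> B) B ?r" by (rule boson_ext_lin[OF fg])
  note [simp] = lin_in[OF f] lin_comp[OF f] lin_comp[OF \<psi>] lin_in[OF boson_ext_lin[OF f]] lin_comp[OF boson_ext_lin[OF f]]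
  fix x h y l assume [simp]: "x \<in> carr E" "h \<in> carr H" "y \<in> carr E" "l \<in> carr H"
  let ?p = "pure B B (pure E H x h) (pure E H y l)"
  show "?l ?p = ?r ?p"
  proof (rule tensor_eq_test)
    show "?l ?p \<in> carr B" "?r ?p \<in> carr B" by (simp_all add: lin_in[OF ll] lin_in[OF lr])
    fix \<phi> :: "'e \<Rightarrow> 'h \<Rightarrow> 'k" assume \<phi>: "bilin E H kvs \<phi>"
    note [simp] = bilinD1[OF \<phi>] bilinD2[OF \<phi>]
    have s1: "\<phi> (scl E a z) w = a * \<phi> z w" if "z \<in> carr E" "w \<in> carr H" for a z w
      using that by (intro lin_scl_apply) auto
    have "sw E H \<phi> (?l ?p) = sw (B \<otimes> B) (B \<otimes> B) (\<lambda>u v. \<psi> (pi2 u) * sw E H \<phi> (boson_ext f v)) (comult (copow2 A) ?p)"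
      using conv_sw[of "copow2 A" ?p "\<lambda>u. \<psi> (pi2 u)" "\<lambda>u. \<psi> (pi2 u)" "boson_ext f" "boson_ext f" "scl B"] A_copow_lin
      by (simp add: sw_scl)
    also have "\<dots> = sw B B (\<lambda>s1 s2. sw B B (\<lambda>d1 d2.
        \<psi> (pi2 (pure B B s1 d1)) * sw E H \<phi> (boson_ext f (pure B B s2 d2)))
         (comult A (pure E H y l))) (comult A (pure E H x h))"
      using cotens_flip_comult[of A A "pure E H x h" "pure E H y l" "\<lambda>u v. \<psi> (pi2 u) * sw E H \<phi> (boson_ext f v)"] A_comult_lin
      by (simp add: copow2_def)
    also have "\<dots> = sw E E (\<lambda>x1 x2. sw H H (\<lambda>h1 h2. sw H E (\<lambda>g v. sw E E (\<lambda>y1 y2. sw H H (\<lambda>l1 l2. sw H E (\<lambda>e w.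
        \<psi> (pure E E x1 (qact E g (qact E h1 y1))) * (counit H e * counit H l1) * sw H H (\<lambda>a b. \<phi> (f (pure E E v (qact E a w))) (prd H b l2)) (comult H h2))
        (qcoact E y2)) (comult H l)) (comult E y)) (qcoact E x2)) (comult H h)) (comult E x)"
      by (simp add: A_comult_pure form_pi2[OF \<psi>] boson_ext_test[OF f] \<phi> act_prd)
    also have "\<dots> = sw E E (\<lambda>x1 x2. sw H H (\<lambda>h1 h2. sw H E (\<lambda>g v. sw E E (\<lambda>y1 y2. sw H H (\<lambda>l1 l2. counit H l1 * sw H E (\<lambda>e w. counit H e *
        (\<psi> (pure E E x1 (qact E g (qact E h1 y1))) * sw H H (\<lambda>a b. \<phi> (f (pure E E v (qact E a w))) (prd H b l2)) (comult H h2)))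
        (qcoact E y2)) (comult H l)) (comult E y)) (qcoact E x2)) (comult H h)) (comult E x)"
      by (simp add: sw_mult_left ac_simps)
    also have "\<dots> = sw E E (\<lambda>x1 x2. sw H H (\<lambda>h1 h2. sw H E (\<lambda>g v. sw E E (\<lambda>y1 y2.
        \<psi> (pure E E x1 (qact E g (qact E h1 y1))) * sw H H (\<lambda>a b. \<phi> (f (pure E E v (qact E a y2))) (prd H b l)) (comult H h2))
        (comult E y)) (qcoact E x2)) (comult H h)) (comult E x)"
      by (simp add: coact_counit coalg_counit[OF coalg_H])
    also have "\<dots> = sw E E (\<lambda>x1 x2. sw H H (\<lambda>h1 h2. sw H H (\<lambda>a b. sw H E (\<lambda>g v. sw E E (\<lambda>y1 y2.
        \<psi> (pure E E x1 (qact E g (qact E h1 y1))) * \<phi> (f (pure E E v (qact E a y2))) (prd H b l)) (comult E y)) (qcoact E x2))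
        (comult H h2)) (comult H h)) (comult E x)"
      by (simp add: sw_mult_left sw_swap[of H H H E] sw_swap[of H H E E])
    also have "\<dots> = sw E E (\<lambda>x1 x2. sw H H (\<lambda>m b. sw H H (\<lambda>h1 a. sw H E (\<lambda>g v. sw E E (\<lambda>y1 y2.
        \<psi> (pure E E x1 (qact E g (qact E h1 y1))) * \<phi> (f (pure E E v (qact E a y2))) (prd H b l)) (comult E y)) (qcoact E x2))
        (comult H m)) (comult H h)) (comult E x)"
      by (rule sw_cong1, rule coalg_coassoc[OF coalg_H, symmetric]) simp_all
    also have "\<dots> = sw H H (\<lambda>m b. sw E E (\<lambda>x1 x2. sw H H (\<lambda>h1 a. sw E E (\<lambda>y1 y2. sw H E (\<lambda>g v.
        \<psi> (pure E E x1 (qact E g (qact E h1 y1))) * \<phi> (f (pure E E v (qact E a y2))) (prd H b l)) (qcoact E x2)) (comult E y))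
        (comult H m)) (comult E x)) (comult H h)"
      by (simp only: sw_swap[of H E E E]) (rule sw_swap)
    also have "\<dots> = sw H H (\<lambda>m b. sw (E \<otimes> E) (E \<otimes> E) (\<lambda>u v. \<psi> u * \<phi> (f v) (prd H b l)) (comult (yd_copow2 H E) (pure E E x (qact E m y)))) (comult H h)"
      by (simp add: E1.EF_comult comult_act_E)
    also have "\<dots> = sw H H (\<lambda>m b. \<phi> (conv (scl E) (yd_copow2 H E) \<psi> f (pure E E x (qact E m y))) (prd H b l)) (comult H h)"
    proof (rule sw_cong1)
      fix m b assume [simp]: "m \<in> carr H" "b \<in> carr H"
      have 1: "lin E kvs (\<lambda>z. \<phi> z (prd H b l))" by simp
      show "sw (E \<otimes> E) (E \<otimes> E) (\<lambda>u v. \<psi> u * \<phi> (f v) (prd H b l)) (comult (yd_copow2 H E) (pure E E x (qact E m y))) =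
       \<phi> (conv (scl E) (yd_copow2 H E) \<psi> f (pure E E x (qact E m y))) (prd H b l)"
        using conv_sw[of "yd_copow2 H E" "pure E E x (qact E m y)" \<psi> \<psi> f f "scl E"] EF_lins
        by (simp add: lin_sw[OF 1] s1)
    qed
    also have "\<dots> = sw E H \<phi> (?r ?p)" by (simp add: boson_ext_test[OF fg] \<phi>)
    finally show "sw E H \<phi> (?l ?p) = sw E H \<phi> (?r ?p)" .
  qed simp_all
qed simp_all

text \<open>Here the coactions survive in the component \<open>H\<close> of the product, as
  \<open>(x\<^sup>2)\<^sub>-\<^sub>1 h\<^sub>2 (y\<^sup>2)\<^sub>-\<^sub>1 l\<close> next to \<open>\<psi>((x\<^sup>2)\<^sub>0 \<otimes> h\<^sub>3 (y\<^sup>2)\<^sub>0)\<close>.  The Yetter-Drinfeld condition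
  rewrites this as \<open>(x\<^sup>2)\<^sub>-\<^sub>1 (h\<^sub>2 y\<^sup>2)\<^sub>-\<^sub>1 h\<^sub>3 l\<close> next to \<open>\<psi>((x\<^sup>2)\<^sub>0 \<otimes> (h\<^sub>2 y\<^sup>2)\<^sub>0)\<close>, and the
  colinearity of \<open>\<psi>\<close> removes the two coactions.\<close>
lemma conv_boson_ext_right:
  assumes f: "lin (E \<otimes> E) E f" and \<psi>: "lin (E \<otimes> E) kvs \<psi>"
    and col: "\<And>x y \<alpha>. x \<in> carr E \<Longrightarrow> y \<in> carr E \<Longrightarrow> lin H kvs \<alpha> \<Longrightarrow>
      sw H E (\<lambda>g v. sw H E (\<lambda>e w. \<alpha> (prd H g e) * \<psi> (pure E E v w)) (qcoact E y)) (qcoact E x) = \<alpha> (unity H) * \<psi> (pure E E x y)"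
    and t: "t \<in> carr (B \<otimes> B)"
  shows "conv (\<lambda>x a. scl B a x) (copow2 A) (boson_ext f) (\<lambda>u. \<psi> (pi2 u)) t = boson_ext (conv (\<lambda>x a. scl E a x) (yd_copow2 H E) f \<psi>) t"
  (is "?l t = ?r t")
proof (rule lin_ext4[OF _ _ _ _ _ _ _ _ t])
  have fg: "lin (E \<otimes> E) E (conv (\<lambda>x a. scl E a x) (yd_copow2 H E) f \<psi>)"
    using lin_conv[of "yd_copow2 H E" E E kvs "\<lambda>x a. scl E a x"] EF_lins f \<psi> by (simp add: bilin_scl)
  have c: "lin (B \<otimes> B) kvs (\<lambda>u. \<psi> (pi2 u))" by (rule lin_comp[OF \<psi> pi2_lin])
  show ll: "lin (B \<otimes> B) B ?l"
    using lin_conv[of "copow2 A" "E \<otimes> H" "E \<otimes> H" kvs "\<lambda>x a. scl B a x"] A_copow_lin c boson_ext_lin[OF f]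
    by (simp add: bilin_scl)
  show lr: "lin (B \<otimes> B) B ?r" by (rule boson_ext_lin[OF fg])
  note [simp] = lin_in[OF f] lin_comp[OF f] lin_comp[OF \<psi>] lin_in[OF boson_ext_lin[OF f]] lin_comp[OF boson_ext_lin[OF f]]
  fix x h y l assume [simp]: "x \<in> carr E" "h \<in> carr H" "y \<in> carr E" "l \<in> carr H"
  let ?p = "pure B B (pure E H x h) (pure E H y l)"
  show "?l ?p = ?r ?p"
  proof (rule tensor_eq_test)
    show "?l ?p \<in> carr B" "?r ?p \<in> carr B" by (simp_all add: lin_in[OF ll] lin_in[OF lr])
    fix \<phi> :: "'e \<Rightarrow> 'h \<Rightarrow> 'k" assume \<phi>: "bilin E H kvs \<phi>"
    note [simp] = bilinD1[OF \<phi>] bilinD2[OF \<phi>]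
    have s1: "\<phi> (scl E a z) w = a * \<phi> z w" if "z \<in> carr E" "w \<in> carr H" for a z w
      using that by (intro lin_scl_apply) auto
    have "sw E H \<phi> (?l ?p) = sw (B \<otimes> B) (B \<otimes> B) (\<lambda>u v. \<psi> (pi2 v) * sw E H \<phi> (boson_ext f u)) (comult (copow2 A) ?p)"
      using conv_sw[of "copow2 A" ?p "boson_ext f" "boson_ext f" "\<lambda>u. \<psi> (pi2 u)" "\<lambda>u. \<psi> (pi2 u)" "\<lambda>x a. scl B a x"] A_copow_lin
      by (simp add: sw_scl)
    also have "\<dots> = sw B B (\<lambda>s1 s2. sw B B (\<lambda>d1 d2.
        \<psi> (pi2 (pure B B s2 d2)) * sw E H \<phi> (boson_ext f (pure B B s1 d1)))
         (comult A (pure E H y l))) (comult A (pure E H x h))"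
      using cotens_flip_comult[of A A "pure E H x h" "pure E H y l" "\<lambda>u v. \<psi> (pi2 v) * sw E H \<phi> (boson_ext f u)"] A_comult_lin
      by (simp add: copow2_def)
    also have "\<dots> = sw E E (\<lambda>x1 x2. sw H H (\<lambda>n m. sw H E (\<lambda>g v. sw E E (\<lambda>y1 y2. sw H H (\<lambda>l1 l2. sw H E (\<lambda>e w.
        \<psi> (pure E E v (qact E m w)) * counit H l2 * sw H H (\<lambda>g1 g2. sw H H (\<lambda>a b. \<phi> (f (pure E E x1 (qact E g1 (qact E a y1))))
          (prd H (prd H g2 b) (prd H e l1))) (comult H n)) (comult H g))
        (qcoact E y2)) (comult H l)) (comult E y)) (qcoact E x2)) (comult H h)) (comult E x)"
      by (simp add: A_comult_pure form_pi2[OF \<psi>] boson_ext_test[OF f] \<phi> act_prd comult_prd_H)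
    also have "\<dots> = sw E E (\<lambda>x1 x2. sw H H (\<lambda>n m. sw H E (\<lambda>g v. sw E E (\<lambda>y1 y2. sw H H (\<lambda>l1 l2. sw H E (\<lambda>e w.
        \<psi> (pure E E v (qact E m w)) * sw H H (\<lambda>g1 g2. sw H H (\<lambda>a b. \<phi> (f (pure E E x1 (qact E g1 (qact E a y1))))
          (prd H (prd H g2 b) (prd H e l1))) (comult H n)) (comult H g))
        (qcoact E y2) * counit H l2) (comult H l)) (comult E y)) (qcoact E x2)) (comult H h)) (comult E x)"
      by (simp add: sw_mult_left sw_mult_right ac_simps)
    also have "\<dots> = sw E E (\<lambda>x1 x2. sw H H (\<lambda>n m. sw H E (\<lambda>g v. sw E E (\<lambda>y1 y2. sw H E (\<lambda>e w.
        \<psi> (pure E E v (qact E m w)) * sw H H (\<lambda>g1 g2. sw H H (\<lambda>a b. \<phi> (f (pure E E x1 (qact E g1 (qact E a y1))))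
          (prd H (prd H g2 b) (prd H e l))) (comult H n)) (comult H g))
        (qcoact E y2)) (comult E y)) (qcoact E x2)) (comult H h)) (comult E x)"
      by (simp add: coalg_counit[OF coalg_H])
    also have "\<dots> = sw E E (\<lambda>x1 x2. sw E E (\<lambda>y1 y2. sw H H (\<lambda>n m. sw H H (\<lambda>a b. sw H E (\<lambda>e w. sw H E (\<lambda>g v. sw H H (\<lambda>g1 g2.
        \<psi> (pure E E v (qact E m w)) * \<phi> (f (pure E E x1 (qact E g1 (qact E a y1))))
          (prd H (prd H g2 b) (prd H e l))) (comult H g))
        (qcoact E x2)) (qcoact E y2)) (comult H n)) (comult H h)) (comult E y)) (comult E x)"
      by (simp only: sw_mult_left sw_swap[of H E E E] sw_swap[of H H E E],
          rule sw_cong1, rule sw_cong1, rule sw_cong1, rule trans[OF sw_swap],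
          rule trans[OF sw_cong1[OF sw_cong1[OF sw_swap]]], simp only: sw_swap[of H E H H])
    also have "\<dots> = sw E E (\<lambda>x1 x2. sw E E (\<lambda>y1 y2. sw H H (\<lambda>n m. sw H H (\<lambda>a b. sw H E (\<lambda>e w. sw H E (\<lambda>g1 v'. sw H E (\<lambda>g2 v.
        \<psi> (pure E E v (qact E m w)) * \<phi> (f (pure E E x1 (qact E g1 (qact E a y1))))
          (prd H (prd H g2 b) (prd H e l))) (qcoact E v'))
        (qcoact E x2)) (qcoact E y2)) (comult H n)) (comult H h)) (comult E y)) (comult E x)"
      by (rule sw_cong1, rule sw_cong1, rule sw_cong1, rule sw_cong1, rule sw_cong1, rule coact_coassoc) simp_all
    also have "\<dots> = sw E E (\<lambda>x1 x2. sw E E (\<lambda>y1 y2. sw H H (\<lambda>a c. sw H H (\<lambda>b m. sw H E (\<lambda>e w. sw H E (\<lambda>g1 v'. sw H E (\<lambda>g2 v.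
        \<psi> (pure E E v (qact E m w)) * \<phi> (f (pure E E x1 (qact E g1 (qact E a y1))))
          (prd H (prd H g2 b) (prd H e l))) (qcoact E v'))
        (qcoact E x2)) (qcoact E y2)) (comult H c)) (comult H h)) (comult E y)) (comult E x)"
      by (rule sw_cong1, rule sw_cong1, rule coalg_coassoc[OF coalg_H]) simp_all
    also have "\<dots> = sw E E (\<lambda>x1 x2. sw E E (\<lambda>y1 y2. sw H H (\<lambda>a c. sw H H (\<lambda>b m. sw H E (\<lambda>e w. sw H E (\<lambda>g1 v'. sw H E (\<lambda>g2 v.
        \<psi> (pure E E v (qact E m w)) * \<phi> (f (pure E E x1 (qact E g1 (qact E a y1))))
          (prd H (prd H g2 (prd H b e)) l)) (qcoact E v'))
        (qcoact E x2)) (qcoact E y2)) (comult H c)) (comult H h)) (comult E y)) (comult E x)"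
      by (simp add: prd_assoc)
    also have "\<dots> = sw E E (\<lambda>x1 x2. sw E E (\<lambda>y1 y2. sw H H (\<lambda>a c. sw H H (\<lambda>b m. sw H E (\<lambda>e w. sw H E (\<lambda>g1 v'. sw H E (\<lambda>g2 v.
        \<psi> (pure E E v w) * \<phi> (f (pure E E x1 (qact E g1 (qact E a y1))))
          (prd H (prd H g2 (prd H e m)) l)) (qcoact E v'))
        (qcoact E x2)) (qcoact E (qact E b y2))) (comult H c)) (comult H h)) (comult E y)) (comult E x)"
      by (rule sw_cong1, rule sw_cong1, rule sw_cong1, rule yd_compat[symmetric]) simp_all
    also have "\<dots> = sw E E (\<lambda>x1 x2. sw E E (\<lambda>y1 y2. sw H H (\<lambda>a c. sw H H (\<lambda>b m. sw H E (\<lambda>e w. sw H E (\<lambda>g1 v'. sw H E (\<lambda>g2 v.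
        \<phi> (f (pure E E x1 (qact E g1 (qact E a y1)))) (prd H (prd H g2 e) (prd H m l)) * \<psi> (pure E E v w)) (qcoact E v'))
        (qcoact E x2)) (qcoact E (qact E b y2))) (comult H c)) (comult H h)) (comult E y)) (comult E x)"
      by (simp add: prd_assoc mult.commute)
    also have "\<dots> = sw E E (\<lambda>x1 x2. sw E E (\<lambda>y1 y2. sw H H (\<lambda>a c. sw H H (\<lambda>b m. sw H E (\<lambda>g1 v'. sw H E (\<lambda>g2 v. sw H E (\<lambda>e w.
        \<phi> (f (pure E E x1 (qact E g1 (qact E a y1)))) (prd H (prd H g2 e) (prd H m l)) * \<psi> (pure E E v w)) (qcoact E (qact E b y2))) (qcoact E v'))
        (qcoact E x2)) (comult H c)) (comult H h)) (comult E y)) (comult E x)"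
      by (rule sw_cong1, rule sw_cong1, rule sw_cong1, rule sw_cong1, rule trans[OF sw_swap], rule sw_cong1, rule sw_swap)
    also have "\<dots> = sw E E (\<lambda>x1 x2. sw E E (\<lambda>y1 y2. sw H H (\<lambda>a c. sw H H (\<lambda>b m. sw H E (\<lambda>g v.
        \<phi> (f (pure E E x1 (qact E g (qact E a y1)))) (prd H m l) * \<psi> (pure E E v (qact E b y2)))
        (qcoact E x2)) (comult H c)) (comult H h)) (comult E y)) (comult E x)"
      by (simp add: col[of _ _ "\<lambda>z. \<phi> u (prd H z w)" for u w])
    also have "\<dots> = sw E E (\<lambda>x1 x2. sw E E (\<lambda>y1 y2. sw H H (\<lambda>n m. sw H H (\<lambda>a b. sw H E (\<lambda>g v.
        \<phi> (f (pure E E x1 (qact E g (qact E a y1)))) (prd H m l) * \<psi> (pure E E v (qact E b y2)))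
        (qcoact E x2)) (comult H n)) (comult H h)) (comult E y)) (comult E x)"
      by (rule sw_cong1, rule sw_cong1, rule coalg_coassoc[OF coalg_H, symmetric]) simp_all
    also have "\<dots> = sw H H (\<lambda>n m. sw E E (\<lambda>x1 x2. sw H H (\<lambda>a b. sw E E (\<lambda>y1 y2. sw H E (\<lambda>g v.
        \<phi> (f (pure E E x1 (qact E g (qact E a y1)))) (prd H m l) * \<psi> (pure E E v (qact E b y2)))
        (qcoact E x2)) (comult E y)) (comult H n)) (comult E x)) (comult H h)"
      by (simp only: sw_swap[of E E H H])
    also have "\<dots> = sw H H (\<lambda>m b. sw (E \<otimes> E) (E \<otimes> E) (\<lambda>u v. \<phi> (f u) (prd H b l) * \<psi> v) (comult (yd_copow2 H E) (pure E E x (qact E m y)))) (comult H h)"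
      by (simp add: E1.EF_comult comult_act_E)
    also have "\<dots> = sw H H (\<lambda>m b. \<phi> (conv (\<lambda>x a. scl E a x) (yd_copow2 H E) f \<psi> (pure E E x (qact E m y))) (prd H b l)) (comult H h)"
    proof (rule sw_cong1)
      fix m b assume [simp]: "m \<in> carr H" "b \<in> carr H"
      have 1: "lin E kvs (\<lambda>z. \<phi> z (prd H b l))" by simp
      show "sw (E \<otimes> E) (E \<otimes> E) (\<lambda>u v. \<phi> (f u) (prd H b l) * \<psi> v) (comult (yd_copow2 H E) (pure E E x (qact E m y))) =
       \<phi> (conv (\<lambda>x a. scl E a x) (yd_copow2 H E) f \<psi> (pure E E x (qact E m y))) (prd H b l)"
        using conv_sw[of "yd_copow2 H E" "pure E E x (qact E m y)" f f \<psi> \<psi> "\<lambda>x a. scl E a x"] EF_lins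
        by (simp add: lin_sw[OF 1] s1 mult.commute)
    qed
    also have "\<dots> = sw E H \<phi> (?r ?p)" by (simp add: boson_ext_test[OF fg] \<phi>)
    finally show "sw E H \<phi> (?l ?p) = sw E H \<phi> (?r ?p)" .
  qed simp_all
qed simp_all

section \<open>Twisting the bosonization\<close>

text \<open>The twist \<open>E\<^sup>\<gamma>\<close> has this form, and so has \<open>E\<close> itself.\<close>
abbreviation modified where "modified f w \<equiv> E\<lparr>mult := f, reassoc := w\<rparr>"

lemmas modified_space [simp] = same_space[of "modified f w" E for f w, simplified]

lemma mult_bos:
  assumes f: "lin (E \<otimes> E) E f" and t: "t \<in> carr (B \<otimes> B)"
  shows "mult (bosonization H (modified f w)) t = boson_ext f t"
  using t lin_in[OF f] by (simp add: bosonization_def Let_def prd_def[of "modified f w"] tlift_to_sw boson_ext_def)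

lemma mult_A: "t \<in> carr (B \<otimes> B) \<Longrightarrow> mult A t = boson_ext (mult E) t"
  using mult_bos[OF lin_mult_E, of t "reassoc E"] by simp

lemma A_mult_lin: "lin (B \<otimes> B) B (mult A)"
  by (rule lin_eq_on[OF boson_ext_lin[OF lin_mult_E]]) (simp_all add: mult_A)

lemmas A_mult_simps [simp] = lin_in[OF A_mult_lin] lin_comp[OF A_mult_lin]

lemma prd_A_test:
  assumes \<phi>: "lin B kvs \<phi>" and [simp]: "x \<in> carr E" "h \<in> carr H" "y \<in> carr E" "l \<in> carr H"
  shows "\<phi> (mult A (pure B B (pure E H x h) (pure E H y l))) =
    sw H H (\<lambda>h1 h2. \<phi> (pure E H (prd E x (qact E h1 y)) (prd H h2 l))) (comult H h)"
proof -
  note [simp] = lin_comp[OF \<phi>]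
  show ?thesis
    by (subst lin_as_sw[OF _ _ \<phi>]) (simp_all add: mult_A boson_ext_test[OF lin_mult_E] lin_in[OF boson_ext_lin[OF lin_mult_E]] prd_def)
qed

lemma reassoc_bos:
  assumes w: "lin (E \<otimes> E \<otimes> E) kvs w" and t: "t \<in> carr (B \<otimes> B \<otimes> B)"
  shows "reassoc (bosonization H (modified f w)) t = w (pi3 t)"
proof -
  note [simp] = lin_comp[OF w]
  let ?b = "\<lambda>u v z. sw E H (\<lambda>r h. sw E H (\<lambda>s l. sw E H (\<lambda>t k.
           sw H H (\<lambda>h1 h2. w (pure E (E \<otimes> E) r (pure E E (qact E h1 s) (qact E (prd H h2 l) t))))
             (comult H h) * counit H k) z) v) u"
  have 1: "lin (B \<otimes> B \<otimes> B) kvs (\<lambda>t. sw B (B \<otimes> B) (\<lambda>u. sw B B (\<lambda>v z. ?b u v z)) t)"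
    by simp
  have "reassoc (bosonization H (modified f w)) t = sw B (B \<otimes> B) (\<lambda>u. sw B B (\<lambda>v z. ?b u v z)) t"
    using t by (simp add: bosonization_def Let_def tlift3_def tlift_to_sw pure3_def)
  also have "\<dots> = w (pi3 t)"
    by (rule lin_ext6[OF _ _ _ 1 _ _ t, of "\<lambda>t. w (pi3 t)"])
      (simp_all add: form_pi3[OF w], simp_all add: pure3_def act_prd)
  finally show ?thesis .
qed

lemma bosonized_gauge_pi2:
  assumes \<psi>: "lin (E \<otimes> E) kvs \<psi>" and t: "t \<in> carr (B \<otimes> B)"
  shows "bosonized_gauge H E \<psi> t = \<psi> (pi2 t)"
proof -
  note [simp] = lin_comp[OF \<psi>]
  let ?b = "\<lambda>s s'. sw E H (\<lambda>x h. sw E H (\<lambda>x' h'. \<psi> (pure E E x (qact E h x')) * counit H h') s') s"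
  have 1: "lin (B \<otimes> B) kvs (\<lambda>t. sw B B ?b t)" by simp
  have "bosonized_gauge H E \<psi> t = sw B B ?b t"
    using t by (simp add: bosonized_gauge_def tlift_to_sw)
  also have "\<dots> = \<psi> (pi2 t)"
    by (rule lin_ext4[OF _ _ _ _ _ 1 _ _ t]) (simp_all add: form_pi2[OF \<psi>])
  finally show ?thesis .
qed

lemma reassoc_factors_lin:
  assumes \<gamma>: "lin (E \<otimes> E) kvs \<gamma>"
  shows "lin (E \<otimes> E \<otimes> E) kvs (tlift3 E (\<lambda>x y z. counit E x * \<gamma> (pure E E y z)))"
    "lin (E \<otimes> E \<otimes> E) kvs (tlift3 E (\<lambda>x y z. \<gamma> (pure E E x (prd E y z))))"
    "lin (E \<otimes> E \<otimes> E) kvs (tlift3 E (\<lambda>x y z. \<gamma> (pure E E (prd E x y) z)))"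
    "lin (E \<otimes> E \<otimes> E) kvs (tlift3 E (\<lambda>x y z. \<gamma> (pure E E x y) * counit E z))"
proof -
  note [simp] = lin_comp[OF \<gamma>]
  show "lin (E \<otimes> E \<otimes> E) kvs (tlift3 E (\<lambda>x y z. counit E x * \<gamma> (pure E E y z)))"
    "lin (E \<otimes> E \<otimes> E) kvs (tlift3 E (\<lambda>x y z. \<gamma> (pure E E x (prd E y z))))"
    "lin (E \<otimes> E \<otimes> E) kvs (tlift3 E (\<lambda>x y z. \<gamma> (pure E E (prd E x y) z)))"
    "lin (E \<otimes> E \<otimes> E) kvs (tlift3 E (\<lambda>x y z. \<gamma> (pure E E x y) * counit E z))"
    by (rule tlift3_lin; simp)+
qed

text \<open>The factors of the reassociator of a twist.  Evaluated at \<open>(r#h) \<otimes> (s#l) \<otimes> (t#k)\<close>, the claims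
  amount in turn to the invariance of \<open>\<gamma>\<close>, the \<open>H\<close>-linearity of the product of \<open>E\<close>, the definition of
  the product of \<open>A\<close>, and the counit of \<open>H\<close>.\<close>
lemma reassoc_factors:
  assumes \<gamma>: "lin (E \<otimes> E) kvs \<gamma>" and \<Gamma>: "lin (B \<otimes> B) kvs \<Gamma>"
    and \<Gamma>\<gamma>: "\<forall>t\<in>carr (B \<otimes> B). \<Gamma> t = \<gamma> (pi2 t)"
    and t: "t \<in> carr (B \<otimes> B \<otimes> B)"
  shows "(\<And>h t. h \<in> carr H \<Longrightarrow> t \<in> carr (E \<otimes> E) \<Longrightarrow> \<gamma> (act2 h t) = counit H h * \<gamma> t) \<Longrightarrow>
      tlift3 B (\<lambda>x y z. counit A x * \<Gamma> (pure B B y z)) t = tlift3 E (\<lambda>x y z. counit E x * \<gamma> (pure E E y z)) (pi3 t)"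
    "tlift3 B (\<lambda>x y z. \<Gamma> (pure B B x (mult A (pure B B y z)))) t = tlift3 E (\<lambda>x y z. \<gamma> (pure E E x (prd E y z))) (pi3 t)"
    "tlift3 B (\<lambda>x y z. \<Gamma> (pure B B (mult A (pure B B x y)) z)) t = tlift3 E (\<lambda>x y z. \<gamma> (pure E E (prd E x y) z)) (pi3 t)"
    "tlift3 B (\<lambda>x y z. \<Gamma> (pure B B x y) * counit A z) t = tlift3 E (\<lambda>x y z. \<gamma> (pure E E x y) * counit E z) (pi3 t)"
proof -
  note [simp] = lin_comp[OF \<gamma>] lin_comp[OF \<Gamma>]
  note l = reassoc_factors_lin[OF \<gamma>]
  have p: "tlift3 E (\<lambda>x y z. counit E x * \<gamma> (pure E E y z)) (pure3 E x y z) = counit E x * \<gamma> (pure E E y z)"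
    "tlift3 E (\<lambda>x y z. \<gamma> (pure E E x (prd E y z))) (pure3 E x y z) = \<gamma> (pure E E x (prd E y z))"
    "tlift3 E (\<lambda>x y z. \<gamma> (pure E E (prd E x y) z)) (pure3 E x y z) = \<gamma> (pure E E (prd E x y) z)"
    "tlift3 E (\<lambda>x y z. \<gamma> (pure E E x y) * counit E z) (pure3 E x y z) = \<gamma> (pure E E x y) * counit E z"
    if "x \<in> carr E" "y \<in> carr E" "z \<in> carr E" for x y z
    unfolding pure3_def by (rule tlift3_pure; simp add: that)+
  have L: "lin (B \<otimes> B \<otimes> B) kvs (tlift3 B (\<lambda>x y z. counit A x * \<Gamma> (pure B B y z)))"
    "lin (B \<otimes> B \<otimes> B) kvs (tlift3 B (\<lambda>x y z. \<Gamma> (pure B B x (mult A (pure B B y z)))))"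
    "lin (B \<otimes> B \<otimes> B) kvs (tlift3 B (\<lambda>x y z. \<Gamma> (pure B B (mult A (pure B B x y)) z)))"
    "lin (B \<otimes> B \<otimes> B) kvs (tlift3 B (\<lambda>x y z. \<Gamma> (pure B B x y) * counit A z))"
    by (rule tlift3_lin; simp)+
  have P: "tlift3 B (\<lambda>x y z. counit A x * \<Gamma> (pure B B y z)) (pure3 B x y z) = counit A x * \<Gamma> (pure B B y z)"
    "tlift3 B (\<lambda>x y z. \<Gamma> (pure B B x (mult A (pure B B y z)))) (pure3 B x y z) = \<Gamma> (pure B B x (mult A (pure B B y z)))"
    "tlift3 B (\<lambda>x y z. \<Gamma> (pure B B (mult A (pure B B x y)) z)) (pure3 B x y z) = \<Gamma> (pure B B (mult A (pure B B x y)) z)"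
    "tlift3 B (\<lambda>x y z. \<Gamma> (pure B B x y) * counit A z) (pure3 B x y z) = \<Gamma> (pure B B x y) * counit A z"
    if "x \<in> carr B" "y \<in> carr B" "z \<in> carr B" for x y z
    unfolding pure3_def by (rule tlift3_pure; simp add: that)+
  note l3 = l[THEN lin_comp, OF pi3_lin]
  have \<Gamma>p: "\<Gamma> (pure B B (pure E H x h) (pure E H y l)) = \<gamma> (pure E E x (qact E h y)) * counit H l"
    if "x \<in> carr E" "h \<in> carr H" "y \<in> carr E" "l \<in> carr H" for x h y l
    using that by (simp add: \<Gamma>\<gamma> form_pi2[OF \<gamma>])
  show "tlift3 B (\<lambda>x y z. counit A x * \<Gamma> (pure B B y z)) t = tlift3 E (\<lambda>x y z. counit E x * \<gamma> (pure E E y z)) (pi3 t)"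
    if inv: "\<And>h t. h \<in> carr H \<Longrightarrow> t \<in> carr (E \<otimes> E) \<Longrightarrow> \<gamma> (act2 h t) = counit H h * \<gamma> t"
  proof (rule lin_ext6[OF _ _ _ L(1) l3(1) _ t])
    fix r h s l t k assume [simp]: "r \<in> carr E" "h \<in> carr H" "s \<in> carr E" "l \<in> carr H" "t \<in> carr E" "k \<in> carr H"
    have "sw H H (\<lambda>h1 h2. \<gamma> (pure E E (qact E h1 s) (qact E h2 (qact E l t)))) (comult H h) = counit H h * \<gamma> (pure E E s (qact E l t))"
      using inv[of h "pure E E s (qact E l t)"] by (simp add: act2_pure lin_sw[OF \<gamma>])
    then show "tlift3 B (\<lambda>x y z. counit A x * \<Gamma> (pure B B y z)) (pure3 B (pure E H r h) (pure E H s l) (pure E H t k)) =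
      tlift3 E (\<lambda>x y z. counit E x * \<gamma> (pure E E y z)) (pi3 (pure3 B (pure E H r h) (pure E H s l) (pure E H t k)))"
      by (simp add: P p form_pi3[OF l(1)] \<Gamma>p sw_mult_left[symmetric])
  qed simp_all
  show "tlift3 B (\<lambda>x y z. \<Gamma> (pure B B x (mult A (pure B B y z)))) t = tlift3 E (\<lambda>x y z. \<gamma> (pure E E x (prd E y z))) (pi3 t)"
  proof (rule lin_ext6[OF _ _ _ L(2) l3(2) _ t])
    fix r h s l t k assume [simp]: "r \<in> carr E" "h \<in> carr H" "s \<in> carr E" "l \<in> carr H" "t \<in> carr E" "k \<in> carr H"
    have *: "lin B kvs (\<lambda>s. \<Gamma> (pure B B (pure E H r h) s))" by simp
    have **: "lin E kvs (\<lambda>x. \<gamma> (pure E E r x))" "lin E kvs (\<lambda>x. \<gamma> (pure E E r (qact E h x)))" by simp_all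
    have "sw H H (\<lambda>l1 l2. \<gamma> (pure E E r (qact E h (prd E s (qact E l1 t)))) * (counit H l2 * counit H k)) (comult H l) =
      sw H H (\<lambda>l1 l2. \<gamma> (pure E E r (qact E h (prd E s (qact E l1 t)))) * counit H l2) (comult H l) * counit H k"
      by (simp add: sw_mult_right mult.assoc)
    also have "\<dots> = \<gamma> (pure E E r (qact E h (prd E s (qact E l t)))) * counit H k"
      by (simp add: coalg_counit[OF coalg_H])
    finally show "tlift3 B (\<lambda>x y z. \<Gamma> (pure B B x (mult A (pure B B y z)))) (pure3 B (pure E H r h) (pure E H s l) (pure E H t k)) =
      tlift3 E (\<lambda>x y z. \<gamma> (pure E E x (prd E y z))) (pi3 (pure3 B (pure E H r h) (pure E H s l) (pure E H t k)))"
      by (simp add: P p form_pi3[OF l(2)] prd_A_test[OF *] \<Gamma>p act_prd_E[OF _ _ _ **(1)])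
  qed simp_all
  show "tlift3 B (\<lambda>x y z. \<Gamma> (pure B B (mult A (pure B B x y)) z)) t = tlift3 E (\<lambda>x y z. \<gamma> (pure E E (prd E x y) z)) (pi3 t)"
  proof (rule lin_ext6[OF _ _ _ L(3) l3(3) _ t])
    fix r h s l t k assume [simp]: "r \<in> carr E" "h \<in> carr H" "s \<in> carr E" "l \<in> carr H" "t \<in> carr E" "k \<in> carr H"
    have *: "lin B kvs (\<lambda>s. \<Gamma> (pure B B s (pure E H t k)))" by simp
    show "tlift3 B (\<lambda>x y z. \<Gamma> (pure B B (mult A (pure B B x y)) z)) (pure3 B (pure E H r h) (pure E H s l) (pure E H t k)) =
      tlift3 E (\<lambda>x y z. \<gamma> (pure E E (prd E x y) z)) (pi3 (pure3 B (pure E H r h) (pure E H s l) (pure E H t k)))"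
      by (simp add: P p form_pi3[OF l(3)] prd_A_test[OF *] \<Gamma>p act_prd sw_mult_right)
  qed simp_all
  show "tlift3 B (\<lambda>x y z. \<Gamma> (pure B B x y) * counit A z) t = tlift3 E (\<lambda>x y z. \<gamma> (pure E E x y) * counit E z) (pi3 t)"
  proof (rule lin_ext6[OF _ _ _ L(4) l3(4) _ t])
    fix r h s l t k assume [simp]: "r \<in> carr E" "h \<in> carr H" "s \<in> carr E" "l \<in> carr H" "t \<in> carr E" "k \<in> carr H"
    have "sw H H (\<lambda>h1 h2. \<gamma> (pure E E r (qact E h1 s)) * (counit H h2 * (counit H l * counit E t))) (comult H h) =
      sw H H (\<lambda>h1 h2. \<gamma> (pure E E r (qact E h1 s)) * counit H h2) (comult H h) * (counit H l * counit E t)"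
      by (simp add: sw_mult_right mult.assoc)
    also have "\<dots> = \<gamma> (pure E E r (qact E h s)) * (counit H l * counit E t)"
      by (simp add: coalg_counit[OF coalg_H])
    finally show "tlift3 B (\<lambda>x y z. \<Gamma> (pure B B x y) * counit A z) (pure3 B (pure E H r h) (pure E H s l) (pure E H t k)) =
      tlift3 E (\<lambda>x y z. \<gamma> (pure E E x y) * counit E z) (pi3 (pure3 B (pure E H r h) (pure E H s l) (pure E H t k)))"
      by (simp add: P p form_pi3[OF l(4)] \<Gamma>p mult.assoc)
  qed simp_all
qed

lemma conv_inverse_pi2:
  assumes \<gamma>: "lin (E \<otimes> E) kvs \<gamma>" "lin (E \<otimes> E) kvs \<delta>" "is_conv_inverse (yd_copow2 H E) \<gamma> \<delta>"
    and \<Gamma>: "\<And>t. t \<in> carr (B \<otimes> B) \<Longrightarrow> \<Gamma> t = \<gamma> (pi2 t)"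
  shows "is_conv_inverse (copow2 A) \<Gamma> (\<lambda>t. \<delta> (pi2 t))"
proof -
  have "conv (*) (copow2 A) \<Gamma> (\<lambda>t. \<delta> (pi2 t)) t = conv (*) (yd_copow2 H E) \<gamma> \<delta> (pi2 t)"
    "conv (*) (copow2 A) (\<lambda>t. \<delta> (pi2 t)) \<Gamma> t = conv (*) (yd_copow2 H E) \<delta> \<gamma> (pi2 t)"
    if "t \<in> carr (B \<otimes> B)" for t
    using that by (auto intro!: conv_coalg_map[OF coalg_map_pi2] simp: A_copow_lin EF_lins \<gamma> \<Gamma>)
  then show ?thesis using \<gamma>(3) coalg_map_pi2 by (simp add: is_conv_inverse_def coalg_map_def)
qed

theorem gauge_bosonization:
  assumes \<gamma>: "is_yd_gauge H E \<gamma>"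
  shows "is_gauge A (bosonized_gauge H E \<gamma>) \<and>
    cqb_eq (twist (bosonized_gauge H E \<gamma>) A) (bosonization H (yd_twist H \<gamma> E))"
proof -
  let ?\<Gamma> = "bosonized_gauge H E \<gamma>"
  obtain \<delta> where m: "yd_morphism H (yd_pow2 H E) (yd_unit H) \<gamma>"
    and d: "yd_morphism H (yd_pow2 H E) (yd_unit H) \<delta>" "is_conv_inverse (yd_copow2 H E) \<gamma> \<delta>"
    and u: "unitary E \<gamma>"
    using \<gamma> by (auto simp: is_yd_gauge_def)
  note g = yd_form[OF m] and d' = yd_form[OF d(1)]
  note \<Gamma> = bosonized_gauge_pi2[OF g(1)]
  have \<Gamma>_lin: "lin (B \<otimes> B) kvs ?\<Gamma>"
    by (rule lin_eq_on[OF lin_comp[OF g(1) pi2_lin]]) (simp_all add: \<Gamma>)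
  have \<delta>_lin: "lin (B \<otimes> B) kvs (\<lambda>t. \<delta> (pi2 t))" by (rule lin_comp[OF d'(1) pi2_lin])
  have inv: "is_conv_inverse (copow2 A) ?\<Gamma> (\<lambda>t. \<delta> (pi2 t))"
    by (rule conv_inverse_pi2[OF g(1) d'(1) d(2) \<Gamma>])
  have "unitary A ?\<Gamma>"
  proof -
    have uA: "unity A = pure E H (unity E) (unity H)" by (simp add: bosonization_def Let_def)
    have "?\<Gamma> (pure B B (unity A) s) = counit A s" if s: "s \<in> carr B" for s
      by (rule tens_ext[OF _ _ is_vs_kvs _ A_counit_lin _ s])
        (use u in \<open>simp_all add: lin_comp[OF \<Gamma>_lin] uA \<Gamma> form_pi2[OF g(1)] unitary_def\<close>)
    moreover have "?\<Gamma> (pure B B s (unity A)) = counit A s" if s: "s \<in> carr B" for s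
    proof (rule tens_ext[OF _ _ is_vs_kvs _ A_counit_lin _ s])
      fix x h assume [simp]: "x \<in> carr E" "h \<in> carr H"
      have "lin E kvs (\<lambda>y. \<gamma> (pure E E x y))" by (rule lin_comp[OF g(1)]) simp
      from lin_scl_apply[OF this] show "?\<Gamma> (pure B B (pure E H x h) (unity A)) = counit A (pure E H x h)"
        using u by (simp add: uA \<Gamma> form_pi2[OF g(1)] unitary_def act_unity_E)
    qed (simp_all add: lin_comp[OF \<Gamma>_lin] uA)
    ultimately show ?thesis by (simp add: unitary_def)
  qed
  then have gauge: "is_gauge A ?\<Gamma>"
    using \<Gamma>_lin \<delta>_lin inv by (auto simp: is_gauge_def)
  define \<Delta>' where "\<Delta>' = conv_inv (copow2 A) ?\<Gamma>"
  define \<delta>' where "\<delta>' = conv_inv (yd_copow2 H E) \<gamma>"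
  have D: "lin (B \<otimes> B) kvs \<Delta>'" "is_conv_inverse (copow2 A) ?\<Gamma> \<Delta>'"
    using conv_inv[of "copow2 A" "\<lambda>t. \<delta> (pi2 t)" ?\<Gamma>] \<delta>_lin inv by (simp_all add: \<Delta>'_def)
  have de: "lin (E \<otimes> E) kvs \<delta>'" "is_conv_inverse (yd_copow2 H E) \<gamma> \<delta>'"
    using conv_inv[of "yd_copow2 H E" \<delta> \<gamma>] d d'(1) by (simp_all add: \<delta>'_def)
  have un: "f t = f' t" if "lin (B \<otimes> B) kvs f" "is_conv_inverse (copow2 A) ?\<Gamma> f"
     "lin (B \<otimes> B) kvs f'" "is_conv_inverse (copow2 A) ?\<Gamma> f'" "t \<in> carr (B \<otimes> B)" for f f' t
    by (rule conv_inverse_unique[OF scalar_coalgebra_copow2_A]) (use that \<Gamma>_lin in simp_all)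
  \<comment> \<open>The inverses that the two twists choose correspond to each other under \<open>\<pi>\<^sub>2\<close>.\<close>
  have D\<delta>: "\<Delta>' t = \<delta>' (pi2 t)" if "t \<in> carr (B \<otimes> B)" for t
    by (rule un[OF D lin_comp[OF de(1) pi2_lin] conv_inverse_pi2[OF g(1) de \<Gamma>] that])
  have \<delta>\<delta>: "\<delta> (pi2 t) = \<delta>' (pi2 t)" if "t \<in> carr (B \<otimes> B)" for t
    by (rule un[OF \<delta>_lin inv lin_comp[OF de(1) pi2_lin] conv_inverse_pi2[OF g(1) de \<Gamma>] that])
  \<comment> \<open>The inverse chosen for \<open>\<gamma>\<close> is the given morphism \<open>\<delta>\<close>, since \<open>x \<otimes> y = \<pi>\<^sub>2((x#1) \<otimes> (y#1))\<close>;
    therefore it is colinear.\<close>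
  have \<delta>': "\<delta> t = \<delta>' t" if t: "t \<in> carr (E \<otimes> E)" for t
  proof (rule tens_ext[OF _ _ is_vs_kvs d'(1) de(1) _ t])
    fix x y assume [simp]: "x \<in> carr E" "y \<in> carr E"
    show "\<delta> (pure E E x y) = \<delta>' (pure E E x y)"
      using \<delta>\<delta>[of "pure B B (pure E H x (unity H)) (pure E H y (unity H))"]
      by (simp add: form_pi2[OF d'(1)] form_pi2[OF de(1)])
  qed simp_all
  have col: "sw H E (\<lambda>g v. sw H E (\<lambda>e w. \<alpha> (prd H g e) * \<delta>' (pure E E v w)) (qcoact E y)) (qcoact E x) = \<alpha> (unity H) * \<delta>' (pure E E x y)"
    if [simp]: "x \<in> carr E" "y \<in> carr E" and \<alpha>: "lin H kvs \<alpha>" for x y \<alpha>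
    using d'(3)[OF that] by (simp add: \<delta>')
  define f where "f = conv (\<lambda>x a. scl E a x) (yd_copow2 H E) (conv (scl E) (yd_copow2 H E) \<gamma> (mult E)) \<delta>'"
  define w where "w = conv (*) (yd_copow3 H E) (conv (*) (yd_copow3 H E) (conv (*) (yd_copow3 H E) (conv (*) (yd_copow3 H E)
     (tlift3 E (\<lambda>x y z. counit E x * \<gamma> (pure E E y z))) (tlift3 E (\<lambda>x y z. \<gamma> (pure E E x (prd E y z))))) (reassoc E))
     (tlift3 E (\<lambda>x y z. \<delta>' (pure E E (prd E x y) z)))) (tlift3 E (\<lambda>x y z. \<delta>' (pure E E x y) * counit E z))"
  have tw: "yd_twist H \<gamma> E = modified f w"
    by (simp add: yd_twist_def twist_by_def Let_def f_def w_def \<delta>'_def)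
  have f1: "lin (E \<otimes> E) E (conv (scl E) (yd_copow2 H E) \<gamma> (mult E))"
    using lin_conv[of "yd_copow2 H E" E kvs E "scl E"] EF_lins lin_mult_E g(1) by (simp add: bilin_scl)
  then have f: "lin (E \<otimes> E) E f"
    using lin_conv[of "yd_copow2 H E" E E kvs "\<lambda>x a. scl E a x"] EF_lins de(1) by (simp add: f_def bilin_scl)
  note rg = reassoc_factors[OF g(1) \<Gamma>_lin ballI[OF \<Gamma>]] and rd = reassoc_factors[OF de(1) D(1) ballI[OF D\<delta>]]
    and rl = reassoc_factors_lin[OF g(1)] reassoc_factors_lin[OF de(1)]
  have w: "lin (E \<otimes> E \<otimes> E) kvs w"
  proof -
    have "lin (yd_copow3 H E) kvs w"
      unfolding w_def using EF_lins(2) rl lin_reassoc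
      by (intro lin_conv[OF _ _ _ bilin_times]) simp_all
    then show ?thesis by simp
  qed
  have "mult (twist ?\<Gamma> A) t = mult (bosonization H (modified f w)) t" if t: "t \<in> carr (B \<otimes> B)" for t
  proof -
    have 1: "conv (scl B) (copow2 A) ?\<Gamma> (mult A) t = boson_ext (conv (scl E) (yd_copow2 H E) \<gamma> (mult E)) t"
      if t: "t \<in> carr (B \<otimes> B)" for t
    proof -
      have "conv (scl B) (copow2 A) ?\<Gamma> (mult A) t = conv (scl B) (copow2 A) (\<lambda>u. \<gamma> (pi2 u)) (boson_ext (mult E)) t"
        by (rule conv_cong) (simp_all add: A_copow_lin t \<Gamma> mult_A)
      then show ?thesis using conv_boson_ext_left[OF lin_mult_E g(1) t] by simp
    qed
    have "mult (twist ?\<Gamma> A) t = conv (\<lambda>x a. scl B a x) (copow2 A) (conv (scl B) (copow2 A) ?\<Gamma> (mult A)) \<Delta>' t"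
      by (simp add: twist_def twist_by_def Let_def \<Delta>'_def)
    also have "\<dots> = conv (\<lambda>x a. scl B a x) (copow2 A) (boson_ext (conv (scl E) (yd_copow2 H E) \<gamma> (mult E))) (\<lambda>u. \<delta>' (pi2 u)) t"
      by (rule conv_cong) (simp_all add: A_copow_lin t 1 D\<delta>)
    also have "\<dots> = boson_ext f t"
      unfolding f_def by (rule conv_boson_ext_right[OF f1 de(1) col t])
    finally show ?thesis by (simp add: mult_bos[OF f t])
  qed
  moreover have "reassoc (twist ?\<Gamma> A) t = reassoc (bosonization H (modified f w)) t" if t: "t \<in> carr (B \<otimes> B \<otimes> B)" for t
  proof -
    have "reassoc (twist ?\<Gamma> A) t = conv (*) (copow3 A) (conv (*) (copow3 A) (conv (*) (copow3 A) (conv (*) (copow3 A)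
     (tlift3 B (\<lambda>x y z. counit A x * ?\<Gamma> (pure B B y z))) (tlift3 B (\<lambda>x y z. ?\<Gamma> (pure B B x (mult A (pure B B y z)))))) (reassoc A))
     (tlift3 B (\<lambda>x y z. \<Delta>' (pure B B (mult A (pure B B x y)) z)))) (tlift3 B (\<lambda>x y z. \<Delta>' (pure B B x y) * counit A z)) t"
      by (simp add: twist_def twist_by_def Let_def \<Delta>'_def tlift3_space[OF carr_bos] prd_def[of A])
    also have "\<dots> = w (pi3 t)"
      unfolding w_def using t rg rd rl lin_reassoc reassoc_bos[OF lin_reassoc, where f = "mult E"]
      by (intro conv5_coalg_map[OF coalg_map_pi3]) (simp_all add: A_copow_lin EF_lins g(2))
    finally show ?thesis using reassoc_bos[OF w t] by simp
  qed
  moreover have "comult (bosonization H (modified f w)) t = comult A t" "counit (bosonization H (modified f w)) t = counit A t" for t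
    by (simp_all add: bosonization_def Let_def)
  moreover have "unity (bosonization H (modified f w)) = unity A" by (simp add: bosonization_def Let_def)
  moreover have "carr (twist ?\<Gamma> A) = carr B" "scl (twist ?\<Gamma> A) = scl B"
      "comult (twist ?\<Gamma> A) = comult A" "counit (twist ?\<Gamma> A) = counit A" "unity (twist ?\<Gamma> A) = unity A"
    by (simp_all add: twist_def twist_by_def Let_def)
  ultimately have "cqb_eq (twist ?\<Gamma> A) (bosonization H (yd_twist H \<gamma> E))"
    by (simp add: cqb_eq_def tw same_space[of "twist ?\<Gamma> A" "E \<otimes> H"])
  then show ?thesis using gauge by simp
qed

end

theorem proposition2p5:
  fixes H :: "('k::field, 'h::ab_group_add) hopf"
    and E :: "('k, 'h, 'e::ab_group_add) yd_cqb"
    and \<gamma> :: "('k, 'e, 'e) tensor \<Rightarrow> 'k"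
  assumes "is_hopf_algebra H"
    and "is_yd_coquasi_bialgebra H E"
    and "is_yd_gauge H E \<gamma>"
  shows "is_gauge (bosonization H E) (bosonized_gauge H E \<gamma>) \<and>
    cqb_eq (twist (bosonized_gauge H E \<gamma>) (bosonization H E)) (bosonization H (yd_twist H \<gamma> E))"
proof -
  interpret yd_setting H E
    using assms(1,2) by unfold_locales (simp_all add: is_hopf_algebra_def)
  show ?thesis by (rule gauge_bosonization[OF assms(3)])
qed

end
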